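(* For any modulus of continuity $\omega$ and any minimal continuous action of $G=\mathcal{K}(A_3)$ on $\mathbf{S}^1$, there is $g\in G$ such that the homeomorphism of $\mathbf{S}^1$ induced by $g$ does not have continuity type $\omega$.
   Context: **Moduli of continuity.** A modulus of continuity is a map $\omega\colon[0,\infty)\to[0,\infty)$ such that $\omega(0)=0$ and $\omega$ is continuous at $0$. A map $f\colon X\to Y$ between metric spaces has continuity type $\omega$ if there is $\lambda>0$ such that $d(f(x),f(x'))\leq\lambda\,\omega(d(x,x'))$ for all $x,x'\in X$. The circle has its standard metric. An action on a compact space is minimal if every orbit is dense. **Dendrites.** A dendrite is a metrizable, compact, connected, locally connected space in which any two points are joined by a unique arc. For a point $x$ of a dendrite $X$ (not reduced to a point), a branch around $x$ is a connected component of $X\setminus\{x\}$; the order of $x$ is the number of branches around it; $x$ is an end point, a regular point, or a branch point if its order is $1$, $2$, or $\geq 3$ respectively. $\mathrm{Br}(X)$ is the set of branch points. For $x\ne y$, $B_x(y)$ is the branch around $x$ containing $y$, and $(x,y)$ is the open arc between $x$ and $y$. $D_3$ is the dendrite (unique up to homeomorphism) whose branch points are dense and all have order $3$. We identify $D_3$ with the Julia set of the polynomial $z^2+i$ in $\mathbf{C}$, which is homeomorphic to it. **Carathéodory loop.** Let $\mathbf{D}$ be the open unit disk and let $\psi\colon\widehat{\mathbf{C}}\setminus\overline{\mathbf{D}}\to\widehat{\mathbf{C}}\setminus D_3$ be the conformal homeomorphism with $\psi(\infty)=\infty$ and $\psi'(\infty)=1$. It extends continuously to $\widehat{\mathbf{C}}\setminus\mathbf{D}$,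 and the restriction to the unit circle is a continuous surjection $\varphi\colon\mathbf{S}^1\to D_3$, called the Carathéodory loop. Fix the positive orientation on $\mathbf{S}^1$; for $z_1\neq z_2$, $(z_1,z_2)_+$ is the open interval of points $z$ such that $(z_1,z,z_2)$ is positively cyclically oriented. A branch point $x$ has exactly three preimages $z_1,z_2,z_3$ under $\varphi$ (ordered positively, indices mod 3), and the three branches around $x$ are the sets $\varphi((z_i,z_{i+1})_+)$, with $\varphi^{-1}$ of such a branch equal to $(z_i,z_{i+1})_+$. **Colorings.** $\widehat{x}$ is the set of branches around a branch point $x$, and $\widehat{D_3}$ is the set of all branches around branch points. Let $[3]=\{1,2,3\}$ with its standard cyclic order. A coloring is a map $c\colon\widehat{D_3}\to[3]$ whose restriction to each $\widehat{x}$ is a bijection; it is kaleidoscopic if for all branch points $x\neq y$ and all $i\neq j\in[3]$ there is a branch point $z\in(x,y)$ with $c(B_z(x))=i$ and $c(B_z(y))=j$. For the three distinct branches $A,B,C$ around a branch point $x$: $o_c(A,B,C)=+$ if $(c(A),c(B),c(C))$ is positively cyclically ordered in $[3]$ and $-$ otherwise; $o_\varphi(A,B,C)=+$ if $(i(A),i(B),i(C))$ is positively cyclically ordered and $-$ otherwise, where $i(A)$ is the index with $A=\varphi((z_i,z_{i+1})_+)$. Fix a kaleidoscopic coloring $c$ with $o_c=o_\varphi$ (one exists). **The group $G$.** For $g\in\mathrm{Homeo}(D_3)$ and a branch point $x$, the local action is $\sigma_c(g,x)=c\circ g|_{\widehat{x}}\circ (c|_{\widehat x})^{-1}\in\mathrm{Sym}([3])$.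 $G=\mathcal{K}(A_3)$ is the group of $g\in\mathrm{Homeo}(D_3)$ with $\sigma_c(g,x)\in A_3$ for every branch point $x$, where $A_3$ is the alternating group. It has the topology of uniform convergence on $D_3$ (equivalently, of pointwise convergence on the discrete set $\mathrm{Br}(D_3)$). *)

theory Defs
  imports
    "HOL-Analysis.Analysis"
    "HOL-Computational_Algebra.Polynomial"
    "HOL-Algebra.Sym_Groups"
    "HOL-Algebra.Group_Action"
begin

section \<open>Moduli of continuity\<close>

definition modulus_of_continuity :: "(real \<Rightarrow> real) \<Rightarrow> bool" where
  "modulus_of_continuity \<omega> \<longleftrightarrow>
     (\<forall>t\<ge>0. \<omega> t \<ge> 0) \<and> \<omega> 0 = 0 \<and> continuous (at 0 within {0..}) \<omega>"

definition has_continuity_type ::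
  "(real \<Rightarrow> real) \<Rightarrow> 'a::metric_space set \<Rightarrow> ('a \<Rightarrow> 'b::metric_space) \<Rightarrow> bool" where
  "has_continuity_type \<omega> S f \<longleftrightarrow>
     (\<exists>l>0. \<forall>x\<in>S. \<forall>x'\<in>S. dist (f x) (f x') \<le> l * \<omega> (dist x x'))"


section \<open>The Julia set\<close>

text \<open>For a polynomial of degree at least 2 the Julia set is the boundary of the filled
  Julia set, the set of points with bounded forward orbit.\<close>

definition filled_julia_set :: "complex poly \<Rightarrow> complex set" where
  "filled_julia_set p = {z. bounded (range (\<lambda>n. (poly p ^^ n) z))}"

definition julia_set :: "complex poly \<Rightarrow> complex set" where
  "julia_set p = frontier (filled_julia_set p)"

definition D3 :: "complex set" where
  "D3 = julia_set [:\<i>, 0, 1:]"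


section \<open>Branches\<close>

definition branches :: "'a::topological_space set \<Rightarrow> 'a \<Rightarrow> 'a set set" where
  "branches X x = components (X - {x})"

text \<open>The infinite case is listed separately because \<open>card\<close> is 0 on infinite sets.\<close>

definition branch_points :: "'a::topological_space set \<Rightarrow> 'a set" where
  "branch_points X = {x \<in> X. infinite (branches X x) \<or> card (branches X x) \<ge> 3}"

definition branch_at :: "'a::topological_space set \<Rightarrow> 'a \<Rightarrow> 'a \<Rightarrow> 'a set" where
  "branch_at X x y = connected_component_set (X - {x}) y"

text \<open>In a dendrite all arcs from \<open>x\<close> to \<open>y\<close> have the same image, so this is the open arc
  \<open>(x,y)\<close>.\<close>

definition open_arc :: "'a::topological_space set \<Rightarrow> 'a \<Rightarrow> 'a \<Rightarrow> 'a set" where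
  "open_arc X x y =
     \<Union>{path_image \<gamma> | \<gamma>. arc \<gamma> \<and> path_image \<gamma> \<subseteq> X \<and> pathstart \<gamma> = x \<and> pathfinish \<gamma> = y} - {x, y}"


section \<open>Colorings\<close>

text \<open>A branch is a set of points, and a branch of a dendrite determines the point it is around;
  so a coloring is a function on sets, of which only the values on branches around branch points
  matter.\<close>

definition coloring :: "'a::topological_space set \<Rightarrow> ('a set \<Rightarrow> nat) \<Rightarrow> bool" where
  "coloring X c \<longleftrightarrow> (\<forall>x\<in>branch_points X. bij_betw c (branches X x) {1..3})"

definition kaleidoscopic :: "'a::topological_space set \<Rightarrow> ('a set \<Rightarrow> nat) \<Rightarrow> bool" where
  "kaleidoscopic X c \<longleftrightarrow>
     coloring X c \<and>
     (\<forall>x\<in>branch_points X. \<forall>y\<in>branch_points X. x \<noteq> y \<longrightarrow>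
        (\<forall>i\<in>{1..3}. \<forall>j\<in>{1..3}. i \<noteq> j \<longrightarrow>
           (\<exists>z\<in>branch_points X \<inter> open_arc X x y.
              c (branch_at X z x) = i \<and> c (branch_at X z y) = j)))"

definition cyclic3 :: "nat \<Rightarrow> nat \<Rightarrow> nat \<Rightarrow> bool" where
  "cyclic3 i j k \<longleftrightarrow> (i, j, k) \<in> {(1, 2, 3), (2, 3, 1), (3, 1, 2)}"

definition coloring_orientation ::
  "('a set \<Rightarrow> nat) \<Rightarrow> 'a set \<Rightarrow> 'a set \<Rightarrow> 'a set \<Rightarrow> int" where
  "coloring_orientation c A B C = (if cyclic3 (c A) (c B) (c C) then 1 else - 1)"


section \<open>The Caratheodory loop and the orientation it induces\<close>

abbreviation S1 :: "complex set" where
  "S1 \<equiv> sphere 0 1"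

text \<open>The Riemann map is described on the finite part of the sphere. Since
  \<open>\<psi>(z)/z\<close> is the inverse of the difference quotient at \<open>w = 1/z = 0\<close> of \<open>w \<mapsto> 1/\<psi>(1/w)\<close>,
  the limit condition says that \<open>\<psi>\<close> fixes \<open>\<infinity>\<close> and has derivative 1 there.\<close>

definition caratheodory_loop :: "complex set \<Rightarrow> (complex \<Rightarrow> complex) \<Rightarrow> bool" where
  "caratheodory_loop X \<phi> \<longleftrightarrow>
     (\<exists>\<psi>. \<psi> holomorphic_on (- cball 0 1) \<and>
          bij_betw \<psi> (- cball 0 1) (- X) \<and>
          ((\<lambda>z. \<psi> z / z) \<longlongrightarrow> 1) at_infinity \<and>
          continuous_on (- ball 0 1) \<psi> \<and>
          (\<forall>z\<in>S1. \<phi> z = \<psi> z))"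

definition circle_oriented :: "complex \<Rightarrow> complex \<Rightarrow> complex \<Rightarrow> bool" where
  "circle_oriented z1 z2 z3 \<longleftrightarrow>
     (\<exists>a b d. a < b \<and> b < d \<and> d < a + 2 * pi \<and> z1 = cis a \<and> z2 = cis b \<and> z3 = cis d)"

definition circle_interval :: "complex \<Rightarrow> complex \<Rightarrow> complex set" where
  "circle_interval z1 z2 = {z. circle_oriented z1 z z2}"

definition preimage_enumeration ::
  "(complex \<Rightarrow> complex) \<Rightarrow> complex \<Rightarrow> (nat \<Rightarrow> complex) \<Rightarrow> bool" where
  "preimage_enumeration \<phi> x z \<longleftrightarrow>
     bij_betw z {1..3} {w \<in> S1. \<phi> w = x} \<and> circle_oriented (z 1) (z 2) (z 3)"

text \<open>Here \<open>i mod 3 + 1\<close> is the successor of \<open>i\<close> in the cyclic order of \<open>{1,2,3}\<close>.\<close>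

definition branch_index ::
  "(complex \<Rightarrow> complex) \<Rightarrow> (nat \<Rightarrow> complex) \<Rightarrow> complex set \<Rightarrow> nat" where
  "branch_index \<phi> z A =
     (THE i. i \<in> {1..3} \<and> A = \<phi> ` circle_interval (z i) (z (i mod 3 + 1)))"

text \<open>The enumeration \<open>z\<close> is determined up to a cyclic shift, which does not affect the result.\<close>

definition loop_orientation ::
  "(complex \<Rightarrow> complex) \<Rightarrow> complex \<Rightarrow> complex set \<Rightarrow> complex set \<Rightarrow> complex set \<Rightarrow> int" where
  "loop_orientation \<phi> x A B C =
     (let z = (SOME z. preimage_enumeration \<phi> x z)
      in if cyclic3 (branch_index \<phi> z A) (branch_index \<phi> z B) (branch_index \<phi> z C) then 1 else - 1)"

definition same_orientation ::
  "complex set \<Rightarrow> (complex set \<Rightarrow> nat) \<Rightarrow> (complex \<Rightarrow> complex) \<Rightarrow> bool" where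
  "same_orientation X c \<phi> \<longleftrightarrow>
     (\<forall>x\<in>branch_points X. \<forall>A\<in>branches X x. \<forall>B\<in>branches X x. \<forall>C\<in>branches X x.
        A \<noteq> B \<and> B \<noteq> C \<and> A \<noteq> C \<longrightarrow>
        coloring_orientation c A B C = loop_orientation \<phi> x A B C)"


section \<open>The kaleidoscopic group of the alternating group\<close>

text \<open>The local action, extended by the identity outside \<open>{1..3}\<close> as is customary for
  permutations of a set.\<close>

definition local_action ::
  "'a::topological_space set \<Rightarrow> ('a set \<Rightarrow> nat) \<Rightarrow> ('a \<Rightarrow> 'a) \<Rightarrow> 'a \<Rightarrow> nat \<Rightarrow> nat" where
  "local_action X c g x =
     (\<lambda>i. if i \<in> {1..3} then c (g ` inv_into (branches X x) c i) else i)"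

text \<open>Homeomorphisms of \<open>X\<close> are represented by functions that are \<open>undefined\<close> outside \<open>X\<close>, as in
  \<open>BijGroup\<close>; multiplication is composition.\<close>

definition kaleidoscopic_A3 ::
  "'a::topological_space set \<Rightarrow> ('a set \<Rightarrow> nat) \<Rightarrow> ('a \<Rightarrow> 'a) monoid" where
  "kaleidoscopic_A3 X c = (BijGroup X)
     \<lparr>carrier := {g \<in> extensional X. (\<exists>h. homeomorphism X X g h) \<and>
                   (\<forall>x\<in>branch_points X. local_action X c g x \<in> carrier (alt_group 3))}\<rparr>"

text \<open>\<open>funspace\<close> carries the supremum metric.\<close>

definition uniform_topology ::
  "'a::metric_space set \<Rightarrow> ('a \<Rightarrow> 'a) monoid \<Rightarrow> ('a \<Rightarrow> 'a) topology" where
  "uniform_topology X G = subtopology (mtopology_of (funspace X euclidean_metric)) (carrier G)"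


section \<open>Actions\<close>

definition continuous_action ::
  "('g, 'm) monoid_scheme \<Rightarrow> 'g topology \<Rightarrow> 'a::topological_space set \<Rightarrow> ('g \<Rightarrow> 'a \<Rightarrow> 'a) \<Rightarrow> bool" where
  "continuous_action G T S \<alpha> \<longleftrightarrow>
     group_action G S \<alpha> \<and>
     continuous_map (prod_topology T (top_of_set S)) (top_of_set S) (\<lambda>(g, z). \<alpha> g z)"

definition minimal_action ::
  "('g, 'm) monoid_scheme \<Rightarrow> 'a::topological_space set \<Rightarrow> ('g \<Rightarrow> 'a \<Rightarrow> 'a) \<Rightarrow> bool" where
  "minimal_action G S \<alpha> \<longleftrightarrow> (\<forall>z\<in>S. S \<subseteq> closure (orbit G \<alpha> z))"

end

theory Submission
  imports Defs "HOL-Complex_Analysis.Riemann_Mapping"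
begin

text \<open>Suppose that every element of \<open>G\<close> acts with continuity type \<open>\<omega>\<close>. An element \<open>u\<close> supported on a branch
  that some \<open>h\<close> in \<open>G\<close> shrinks to a point along a sequence of disjoint translates must act trivially on
  the circle: all infinite products of powers of the conjugates of \<open>u\<close> lie in \<open>G\<close>, the powers of a
  circle homeomorphism other than the identity that stay close to the identity are not equicontinuous,
  and a gliding hump over the exponents therefore beats every modulus. So every element
  supported on one of the three branches around the fixed point \<open>\<beta>\<close> of \<open>z\<^sup>2 + \<i>\<close> acts trivially, and the
  stabilizer of \<open>\<beta>\<close> acts through powers of a rotation \<open>r\<close> of order 3 around \<open>\<beta>\<close>. As \<open>h\<close> also acts
  trivially, a relation between \<open>r\<close>, \<open>h\<close> and the symmetry \<open>s\<close>, which is \<open>z \<mapsto> - z\<close>, shows that \<open>s\<close> acts as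
  a power of \<open>r\<close>, and \<open>r\<close>, \<open>s\<close>, \<open>h\<close> move every branch point to \<open>\<beta>\<close>. Hence all of \<open>G\<close> acts through powers
  of \<open>r\<close>, and orbits have at most three points.

  Points of the Julia set are handled through external angles: \<open>\<Phi> t\<close> is the image of
  \<open>exp (2 \<pi> \<i> t)\<close> under the loop, Boettcher's equation says that \<open>\<Phi>\<close> turns angle doubling into
  \<open>z\<^sup>2 + \<i>\<close>, and the point \<open>\<beta>\<close> has the angles \<open>1/7\<close>, \<open>2/7\<close>, \<open>4/7\<close>. A strictly increasing map of the line that
  commutes with \<open>t \<mapsto> t + 1\<close> and preserves the fibres of \<open>\<Phi>\<close> induces an element of \<open>G\<close>.\<close>

section \<open>The exterior Riemann map\<close>

text \<open>Two obstacles shape the argument. The modulus is arbitrary, so no explicit family of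
  elements can serve for all of them: the bad element has to be assembled against
  \<open>\<omega>\<close> from infinitely many commuting pieces, and this is possible because
  elements glued over disjoint saturated arcs of angles stay in \<open>G\<close> once the images of
  the arcs shrink. And the only information on the Julia set is its definition together with a
  Riemann map that has continuous boundary values, so its branches must be computed from angle
  doubling. The computation is feasible because the critical value is preperiodic:
  \<open>\<i>\<close> goes to \<open>- 1 + \<i>\<close>, then to \<open>- \<i>\<close>, and back to
  \<open>- 1 + \<i>\<close>. This fixes the constants: 1/6 is an angle of \<open>\<i>\<close>, 1/12
  and 7/12 are those of the critical point 0, and 1/3 and 2/3 those of the two-cycle. The diameter
  from 1/12 to 7/12 separates the two sheets of \<open>quad\<close>. Statements about fibres of
  \<Phi> are then obtained by expansion: a bad pair of angles would be driven apart by doubling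
  beyond a uniform bound.\<close>

definition quad :: "complex \<Rightarrow> complex" where
  "quad z = z\<^sup>2 + \<i>"

lemma poly_quad: "poly [:\<i>, 0, 1:] = quad"
  by (auto simp: quad_def power2_eq_square fun_eq_iff algebra_simps)

lemma continuous_on_quad [continuous_intros]:
  "continuous_on S f \<Longrightarrow> continuous_on S (\<lambda>x. quad (f x))"
  unfolding quad_def by (intro continuous_intros)

lemma quad_minus [simp]: "quad (- z) = quad z"
  by (simp add: quad_def)

lemma quad_eq_iff: "quad z = quad w \<longleftrightarrow> z = w \<or> z = - w"
  by (auto simp: quad_def power2_eq_iff)

section \<open>Escape to infinity and the filled Julia set\<close>

definition filled :: "complex set" where
  "filled = filled_julia_set [:\<i>, 0, 1:]"

lemma filled_iff_bounded: "z \<in> filled \<longleftrightarrow> bounded (range (\<lambda>n. (quad ^^ n) z))"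
  by (simp add: filled_def filled_julia_set_def poly_quad)

lemma D3_eq_frontier: "D3 = frontier filled"
  by (simp add: D3_def julia_set_def filled_def)

text \<open>Radius 2 is an escape radius: from there on \<open>|z|^2 - 1\<close> is at least
  \<open>2 |z| - 1\<close>, hence at least \<open>3/2 |z|\<close>.\<close>

lemma norm_quad_ge:
  assumes "2 \<le> norm z"
  shows "3/2 * norm z \<le> norm (quad z)"
proof -
  have "norm (z\<^sup>2) - norm \<i> \<le> norm (quad z)"
    unfolding quad_def by (rule norm_diff_ineq)
  moreover have "2 * norm z \<le> norm z * norm z"
    using assms by (intro mult_right_mono) auto
  ultimately show ?thesis
    using assms by (simp add: norm_mult power2_eq_square)
qed

lemma quad_escape:
  assumes "2 \<le> norm z"
  shows "(3/2) ^ n * norm z \<le> norm ((quad ^^ n) z)"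
proof (induction n)
  case (Suc n)
  have "1 * norm z \<le> (3/2) ^ n * norm z"
    by (intro mult_right_mono) auto
  then have "2 \<le> norm ((quad ^^ n) z)"
    using assms Suc by linarith
  from norm_quad_ge[OF this] Suc show ?case
    by simp
qed simp

text \<open>An orbit that leaves the disk of radius 2 once grows geometrically. The uniform bound
  exhibits the set as an intersection of closed sets.\<close>

lemma filled_iff: "z \<in> filled \<longleftrightarrow> (\<forall>n. norm ((quad ^^ n) z) \<le> 2)"
proof
  assume "z \<in> filled"
  then obtain M where M: "\<And>n. norm ((quad ^^ n) z) \<le> M"
    unfolding filled_iff_bounded bounded_iff by blast
  show "\<forall>n. norm ((quad ^^ n) z) \<le> 2"
  proof (rule ccontr)
    assume "\<not> ?thesis"
    then obtain n where n: "2 < norm ((quad ^^ n) z)"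
      by (auto simp: not_le)
    obtain m where m: "M < (3/2::real) ^ m"
      using real_arch_pow[of "3/2" M] by auto
    have "(3/2) ^ m * 1 \<le> (3/2) ^ m * norm ((quad ^^ n) z)"
      using n by (intro mult_left_mono) auto
    also have "\<dots> \<le> norm ((quad ^^ m) ((quad ^^ n) z))"
      using n by (intro quad_escape) simp
    also have "\<dots> = norm ((quad ^^ (m + n)) z)"
      by (simp add: funpow_add)
    also have "\<dots> \<le> M"
      by (rule M)
    finally show False
      using m by simp
  qed
next
  assume "\<forall>n. norm ((quad ^^ n) z) \<le> 2"
  then show "z \<in> filled"
    unfolding filled_iff_bounded bounded_iff by blast
qed

lemma quad_mem_filled_iff: "quad z \<in> filled \<longleftrightarrow> z \<in> filled"
proof -
  have "range (\<lambda>n. (quad ^^ n) z) = insert z (range (\<lambda>n. (quad ^^ n) (quad z)))"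
    (is "?A = ?B")
  proof
    show "?A \<subseteq> ?B"
    proof safe
      fix n assume "(quad ^^ n) z \<notin> range (\<lambda>n. (quad ^^ n) (quad z))"
      then show "(quad ^^ n) z = z"
        by (cases n) (auto simp: funpow_swap1)
    qed
    have "(quad ^^ n) (quad z) = (quad ^^ Suc n) z" for n
      by (simp add: funpow_swap1)
    moreover have "z = (quad ^^ 0) z"
      by simp
    ultimately show "?B \<subseteq> ?A"
      by blast
  qed
  then show ?thesis
    by (simp add: filled_iff_bounded)
qed

lemma closed_filled: "closed filled"
proof -
  have "continuous_on UNIV (\<lambda>z. (quad ^^ n) z)" for n
    by (induction n) (auto intro!: continuous_intros)
  then have "closed {z. norm ((quad ^^ n) z) \<le> 2}" for n
    by (intro closed_Collect_le continuous_intros)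
  then have "closed (\<Inter>n. {z. norm ((quad ^^ n) z) \<le> 2})"
    by blast
  also have "(\<Inter>n. {z. norm ((quad ^^ n) z) \<le> 2}) = filled"
    by (auto simp: filled_iff)
  finally show ?thesis .
qed

lemma filled_subset: "filled \<subseteq> cball 0 2"
proof
  fix z assume "z \<in> filled"
  then have "norm ((quad ^^ 0) z) \<le> 2"
    unfolding filled_iff by blast
  then show "z \<in> cball 0 2"
    by simp
qed

lemma compact_D3: "compact D3"
  unfolding D3_eq_frontier
  using filled_subset bounded_subset[OF bounded_cball] by (intro compact_frontier_bounded) blast

section \<open>The Riemann map, its inverse, and their behaviour at infinity\<close>

locale riemann_exterior =
  fixes \<psi> :: "complex \<Rightarrow> complex"
  assumes hol: "\<psi> holomorphic_on (- cball 0 1)"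
    and bij: "bij_betw \<psi> (- cball 0 1) (- D3)"
    and lim: "((\<lambda>z. \<psi> z / z) \<longlongrightarrow> 1) at_infinity"
    and cont: "continuous_on (- ball 0 1) \<psi>"
begin

lemma inj: "inj_on \<psi> (- cball 0 1)"
  using bij by (simp add: bij_betw_def)

lemma image: "\<psi> ` (- cball 0 1) = - D3"
  using bij by (simp add: bij_betw_def)

lemma connected_complement: "connected (- D3)"
proof -
  have "connected (- cball (0::complex) 1)"
    by (intro connected_complement_bounded_convex) auto
  from connected_continuous_image[OF holomorphic_on_imp_continuous_on[OF hol] this] show ?thesis
    by (simp add: image)
qed

text \<open>\<open>\<psi>\<close> covers the whole complement of the frontier of
  \<open>filled\<close>, and its domain is connected. An interior point would separate that
  complement into the interior and the outside, which contains 3. So the Julia set and the filled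
  Julia set coincide.\<close>

lemma interior_filled: "interior filled = {}"
proof (rule ccontr)
  assume ne: "interior filled \<noteq> {}"
  have D3: "D3 = filled - interior filled"
    using closed_filled by (simp add: D3_eq_frontier frontier_def)
  have "3 \<notin> filled"
    using filled_subset by auto
  then have "- filled \<inter> - D3 \<noteq> {}"
    using D3 by auto
  moreover have "interior filled \<inter> - D3 \<noteq> {}"
    using ne D3 by auto
  moreover have "- D3 \<subseteq> interior filled \<union> - filled"
    using D3 by auto
  moreover have "interior filled \<inter> - filled \<inter> - D3 = {}"
    using interior_subset by blast
  ultimately show False
    using connectedD[OF connected_complement, of "interior filled" "- filled"] closed_filled
    by (auto simp: open_Compl)
qed

lemma D3_eq_filled: "D3 = filled"
  using closed_filled interior_filled by (simp add: D3_eq_frontier frontier_def)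

lemma quad_mem_D3_iff [simp]: "quad z \<in> D3 \<longleftrightarrow> z \<in> D3"
  by (simp add: D3_eq_filled quad_mem_filled_iff)

lemma bounded_annulus: "\<exists>M. \<forall>z. 1 \<le> norm z \<and> norm z \<le> R \<longrightarrow> norm (\<psi> z) \<le> M"
proof -
  have "compact (cball 0 R - ball (0::complex) 1)"
    by (intro compact_diff) auto
  moreover have "continuous_on (cball 0 R - ball 0 1) \<psi>"
    by (rule continuous_on_subset[OF cont]) auto
  ultimately have "bounded (\<psi> ` (cball 0 R - ball 0 1))"
    by (intro compact_imp_bounded compact_continuous_image)
  then obtain M where "\<forall>w\<in>\<psi> ` (cball 0 R - ball 0 1). norm w \<le> M"
    unfolding bounded_iff by blast
  then show ?thesis
    by (intro exI[of _ M]) auto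
qed

lemma psi_at_infinity: "filterlim \<psi> at_infinity at_infinity"
proof -
  have "filterlim (\<lambda>z. \<psi> z / z * z) at_infinity at_infinity"
    by (rule tendsto_mult_filterlim_at_infinity[OF lim]) (auto simp: filterlim_ident)
  moreover have "\<forall>\<^sub>F z in at_infinity. \<psi> z / z * z = \<psi> z"
    using eventually_not_equal_at_infinity[of 0] by eventually_elim auto
  ultimately show ?thesis
    using filterlim_cong[OF refl refl] by fast
qed

definition inverse_map :: "complex \<Rightarrow> complex" where
  "inverse_map = inv_into (- cball 0 1) \<psi>"

lemma inverse_map [simp]: "1 < norm z \<Longrightarrow> inverse_map (\<psi> z) = z"
  unfolding inverse_map_def by (rule inv_into_f_f[OF inj]) simp

lemma psi_inverse_map: "w \<notin> D3 \<Longrightarrow> \<psi> (inverse_map w) = w"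
  unfolding inverse_map_def by (rule f_inv_into_f) (simp add: image)

lemma norm_inverse_map: "w \<notin> D3 \<Longrightarrow> 1 < norm (inverse_map w)"
  unfolding inverse_map_def using inv_into_into[of w \<psi> "- cball 0 1"] by (simp add: image)

lemma psi_notin_D3: "1 < norm z \<Longrightarrow> \<psi> z \<notin> D3"
  using image by auto

lemma holomorphic_inverse_map: "inverse_map holomorphic_on (- D3)"
proof -
  obtain g where g: "g holomorphic_on (\<psi> ` (- cball 0 1))"
    "\<And>z. z \<in> - cball 0 1 \<Longrightarrow> g (\<psi> z) = z"
    using holomorphic_has_inverse[OF hol _ inj] by (metis open_Compl closed_cball)
  show ?thesis
  proof (rule holomorphic_transform)
    show "g holomorphic_on (- D3)"
      using g(1) image by simp
    fix w assume "w \<in> - D3"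
    then obtain z where "z \<in> - cball 0 1" "w = \<psi> z"
      using image by blast
    then show "g w = inverse_map w"
      using g(2) by simp
  qed
qed

text \<open>\<open>\<psi>\<close> is bounded on every annulus that starts at the unit circle, so
  values far out have preimages far out.\<close>

lemma inverse_map_at_infinity: "filterlim inverse_map at_infinity at_infinity"
  unfolding filterlim_at_infinity[OF order_refl]
proof (intro allI impI)
  fix R :: real
  obtain M where M: "\<And>z. 1 \<le> norm z \<Longrightarrow> norm z \<le> R \<Longrightarrow> norm (\<psi> z) \<le> M"
    using bounded_annulus by blast
  have "\<forall>\<^sub>F w in at_infinity. max M 2 + 1 \<le> norm w"
    by (auto simp: eventually_at_infinity)
  then show "\<forall>\<^sub>F w in at_infinity. R \<le> norm (inverse_map w)"
  proof eventually_elim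
    case (elim w)
    then have "w \<notin> D3"
      using filled_subset by (auto simp: D3_eq_filled)
    then have "1 \<le> norm (inverse_map w)" "\<psi> (inverse_map w) = w"
      using norm_inverse_map psi_inverse_map by (auto intro: less_imp_le)
    then show ?case
      using M[of "inverse_map w"] elim by (cases "norm (inverse_map w) \<le> R") auto
  qed
qed

text \<open>\<open>?F z / z^2\<close> is the product of \<open>?F z / \<psi> (?F z)\<close>, of
  \<open>quad (\<psi> z) / (\<psi> z)^2\<close> and of \<open>(\<psi> z / z)^2\<close>. Each factor
  tends to 1, the first and the last by the normalization of \<open>\<psi>\<close>.\<close>

lemma conjugate_asymptotic:
  "((\<lambda>z. inverse_map (quad (\<psi> z)) / z\<^sup>2) \<longlongrightarrow> 1) at_infinity"
proof -
  let ?F = "\<lambda>z. inverse_map (quad (\<psi> z))"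
  have sq: "filterlim (\<lambda>z. (\<psi> z)\<^sup>2) at_infinity at_infinity"
    unfolding power2_eq_square by (rule filterlim_at_infinity_times[OF psi_at_infinity psi_at_infinity])
  have q: "filterlim (\<lambda>z. quad (\<psi> z)) at_infinity at_infinity"
    unfolding quad_def by (rule tendsto_add_filterlim_at_infinity'[OF sq tendsto_const])
  have F: "filterlim ?F at_infinity at_infinity"
    by (rule filterlim_compose[OF inverse_map_at_infinity q])
  have "((\<lambda>z. \<psi> (?F z) / ?F z) \<longlongrightarrow> 1) at_infinity"
    by (rule filterlim_compose[OF lim F])
  then have 1: "((\<lambda>z. inverse (\<psi> (?F z) / ?F z)) \<longlongrightarrow> inverse 1) at_infinity"
    by (rule tendsto_inverse) simp
  have "((\<lambda>z. 1 + \<i> * inverse ((\<psi> z)\<^sup>2)) \<longlongrightarrow> 1 + \<i> * 0) at_infinity"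
    by (intro tendsto_intros filterlim_compose[OF tendsto_inverse_0 sq])
  then have "((\<lambda>z. inverse (\<psi> (?F z) / ?F z) * ((1 + \<i> * inverse ((\<psi> z)\<^sup>2)) * (\<psi> z / z)\<^sup>2)) \<longlongrightarrow>
      inverse 1 * ((1 + \<i> * 0) * 1\<^sup>2)) at_infinity"
    by (intro tendsto_mult 1 tendsto_power lim)
  then have *: "((\<lambda>z. inverse (\<psi> (?F z) / ?F z) * ((1 + \<i> * inverse ((\<psi> z)\<^sup>2)) * (\<psi> z / z)\<^sup>2)) \<longlongrightarrow> 1)
      at_infinity" by simp
  have large: "\<forall>\<^sub>F z in at_infinity. 1 < norm (z::complex)"
    by (auto simp: eventually_at_infinity intro!: exI[of _ 2])
  have "\<forall>\<^sub>F z in at_infinity. inverse (\<psi> (?F z) / ?F z) *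
      ((1 + \<i> * inverse ((\<psi> z)\<^sup>2)) * (\<psi> z / z)\<^sup>2) = ?F z / z\<^sup>2"
    using psi_at_infinity[THEN filterlim_at_infinity_imp_eventually_ne, of 0]
      q[THEN filterlim_at_infinity_imp_eventually_ne, of 0]
      eventually_not_equal_at_infinity[of 0] large
  proof eventually_elim
    case (elim z)
    then have "\<psi> (?F z) = quad (\<psi> z)"
      using psi_inverse_map[of "quad (\<psi> z)"] psi_notin_D3[of z] by simp
    then have "inverse (\<psi> (?F z) / ?F z) * ((1 + \<i> * inverse ((\<psi> z)\<^sup>2)) * (\<psi> z / z)\<^sup>2)
      = ?F z / quad (\<psi> z) * (quad (\<psi> z) / (\<psi> z)\<^sup>2 * (\<psi> z / z)\<^sup>2)"
      using elim by (simp add: field_simps quad_def)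
    also have "\<dots> = ?F z / z\<^sup>2"
      using elim by (simp add: field_simps)
    finally show ?case .
  qed
  then show ?thesis
    using tendsto_cong * by fast
qed

text \<open>Boettcher's equation. The conjugate of \<open>quad\<close> at infinity is a self-map of the disk that is
  asymptotic to \<open>w \<mapsto> w\<^sup>2\<close>, so it equals \<open>w \<mapsto> w\<^sup>2\<close> by the argument for the equality case in the
  Schwarz lemma.\<close>

lemma psi_square_open:
  assumes "1 < norm z"
  shows "\<psi> (z\<^sup>2) = quad (\<psi> z)"
proof -
  define F where "F = (\<lambda>z. inverse_map (quad (\<psi> z)))"
  \<comment> \<open>In the coordinate \<open>w = 1 / z\<close> the conjugated map is
    \<open>1 / F (1 / w)\<close>; \<open>b\<close> is its quotient by \<open>w^2\<close>, and the
    value 1 at 0 is the limit supplied by \<open>conjugate_asymptotic\<close>.\<close>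
  define b where "b = (\<lambda>w. if w = 0 then 1 else 1 / (w\<^sup>2 * F (1 / w)))"
  have normF: "1 < norm (F z)" if "1 < norm z" for z
    unfolding F_def using that by (intro norm_inverse_map) (simp add: psi_notin_D3)
  have holF: "F holomorphic_on (- cball 0 1)"
    unfolding F_def
  proof (rule holomorphic_on_compose_gen[OF _ holomorphic_inverse_map, unfolded o_def])
    show "(\<lambda>z. quad (\<psi> z)) holomorphic_on (- cball 0 1)"
      unfolding quad_def by (intro holomorphic_intros hol)
    show "(\<lambda>z. quad (\<psi> z)) ` (- cball 0 1) \<subseteq> - D3"
      using psi_notin_D3 by auto
  qed
  have out: "1 < norm (1 / w)" if "w \<in> ball 0 1 - {0}" for w :: complex
    using that by (simp add: norm_divide field_simps)
  have holb0: "b holomorphic_on (ball 0 1 - {0})"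
  proof (rule holomorphic_transform)
    have "(\<lambda>w. F (1 / w)) holomorphic_on (ball 0 1 - {0})"
    proof (rule holomorphic_on_compose_gen[OF _ holF, unfolded o_def])
      show "(\<lambda>w. 1 / w) holomorphic_on (ball 0 1 - {0})"
        by (intro holomorphic_intros) auto
      show "(\<lambda>w. 1 / w) ` (ball 0 1 - {0}) \<subseteq> - cball (0::complex) 1"
      proof (rule image_subsetI)
        fix w :: complex assume "w \<in> ball 0 1 - {0}"
        from out[OF this] show "1 / w \<in> - cball 0 1"
          by (simp add: not_le)
      qed
    qed
    moreover have "w\<^sup>2 * F (1 / w) \<noteq> 0" if "w \<in> ball 0 1 - {0}" for w
      using normF[OF out[OF that]] that by auto
    ultimately show "(\<lambda>w. 1 / (w\<^sup>2 * F (1 / w))) holomorphic_on (ball 0 1 - {0})"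
      by (intro holomorphic_intros)
  qed (auto simp: b_def)
  have "((\<lambda>z. inverse (F z / z\<^sup>2)) \<longlongrightarrow> inverse 1) at_infinity"
    unfolding F_def by (intro tendsto_inverse conjugate_asymptotic) simp
  then have "((\<lambda>w. inverse (F (inverse w) / (inverse w)\<^sup>2)) \<longlongrightarrow> 1) (at 0)"
    unfolding lim_at_infinity_0 o_def by simp
  moreover have "\<forall>\<^sub>F w in at 0. inverse (F (inverse w) / (inverse w)\<^sup>2) = b w"
    unfolding eventually_at by (intro exI[of _ 1]) (auto simp: b_def field_simps)
  ultimately have b0: "(b \<longlongrightarrow> b 0) (at 0)"
    using tendsto_cong by (fastforce simp: b_def)
  have "continuous_on (ball 0 1) b"
    unfolding continuous_on_eq_continuous_at[OF open_ball]
  proof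
    fix w :: complex assume w: "w \<in> ball 0 1"
    show "isCont b w"
    proof (cases "w = 0")
      case True then show ?thesis using b0 by (simp add: isCont_def)
    next
      case False
      have "open (ball (0::complex) 1 - {0})" by (simp add: open_delete)
      then show ?thesis
        using holomorphic_on_imp_continuous_on[OF holb0] False w continuous_on_eq_continuous_at by blast
    qed
  qed
  then have holb: "b holomorphic_on ball 0 1"
    using no_isolated_singularity[OF _ holb0] by simp
  \<comment> \<open>On the circle of radius \<open>\<rho>\<close> the factor
    \<open>F (1 / z)\<close> has modulus above 1, so \<open>1 / \<rho>^2\<close> remains as a bound.
    Letting \<open>\<rho>\<close> tend to 1 bounds \<open>b\<close> by 1, which is attained at the
    interior point 0.\<close>
  have bound: "norm (b w) \<le> 1 / \<rho>\<^sup>2" if w: "norm w < \<rho>" and \<rho>: "\<rho> < 1" for w \<rho>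
  proof (rule maximum_modulus_frontier[where S = "ball 0 \<rho>" and f = b])
    have \<rho>0: "0 < \<rho>"
      using w norm_ge_zero[of w] by linarith
    show "b holomorphic_on interior (ball 0 \<rho>)"
      using \<rho> by (intro holomorphic_on_subset[OF holb]) auto
    show "continuous_on (closure (ball 0 \<rho>)) b"
      using \<rho> \<rho>0 by (intro continuous_on_subset[OF holomorphic_on_imp_continuous_on[OF holb]]) auto
    show "bounded (ball (0::complex) \<rho>)" "w \<in> ball 0 \<rho>"
      using w by auto
    fix z :: complex assume "z \<in> frontier (ball 0 \<rho>)"
    then have z: "norm z = \<rho>"
      using \<rho>0 by (simp add: frontier_ball)
    have "1 \<le> norm (F (1 / z))"
      using normF[OF out[of z]] z \<rho> \<rho>0 by auto
    then have "\<rho>\<^sup>2 * 1 \<le> \<rho>\<^sup>2 * norm (F (1 / z))"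
      by (intro mult_left_mono) auto
    moreover have "F (1 / z) \<noteq> 0"
      using \<open>1 \<le> norm (F (1 / z))\<close> by auto
    ultimately show "norm (b z) \<le> 1 / \<rho>\<^sup>2"
      using z \<rho>0 by (auto simp: b_def norm_divide norm_mult norm_power intro!: divide_left_mono mult_pos_pos)
  qed
  have b1: "norm (b w) \<le> 1" if w: "norm w < 1" for w
  proof (rule tendsto_lowerbound)
    show "((\<lambda>\<rho>. 1 / \<rho>\<^sup>2) \<longlongrightarrow> 1) (at_left (1::real))"
      by (auto intro!: tendsto_eq_intros)
    have "\<forall>\<^sub>F \<rho> in at_left 1. norm w < \<rho> \<and> \<rho> < 1"
      using eventually_at_left_real[OF w] by simp
    then show "\<forall>\<^sub>F \<rho> in at_left 1. norm (b w) \<le> 1 / \<rho>\<^sup>2"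
      by eventually_elim (simp add: bound)
  qed simp
  have "b constant_on ball 0 1"
    using b1 by (intro maximum_modulus_principle[OF holb _ _ open_ball subset_refl, of 0])
      (auto simp: b_def)
  then obtain k where k: "\<And>w. w \<in> ball 0 1 \<Longrightarrow> b w = k"
    unfolding constant_on_def by blast
  have "k = 1"
    using k[of 0] by (simp add: b_def)
  moreover have z: "1 / z \<in> ball 0 1" "z \<noteq> 0"
    using assms by (auto simp: norm_divide divide_less_eq_1)
  ultimately have "F z = z\<^sup>2"
    using k[OF z(1)] by (auto simp: b_def field_simps)
  then show ?thesis
    unfolding F_def using psi_inverse_map[of "quad (\<psi> z)"] psi_notin_D3[OF assms] by simp
qed

section \<open>Boundary values of the Riemann map on the unit circle\<close>

lemma closure_exterior: "closure (- cball (0::complex) 1) = - ball 0 1"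
  by (simp add: closure_complement)

lemma psi_square:
  assumes "1 \<le> norm z"
  shows "\<psi> (z\<^sup>2) = quad (\<psi> z)"
proof -
  have "\<psi> (z\<^sup>2) - quad (\<psi> z) = 0"
  proof (rule continuous_constant_on_closure[where S = "- cball 0 1"
        and f = "\<lambda>z. \<psi> (z\<^sup>2) - quad (\<psi> z)"])
    have "\<not> norm (z\<^sup>2) < 1" if "\<not> norm z < 1" for z :: complex
      using that by (simp add: norm_power not_less one_le_power)
    then have "continuous_on (- ball 0 1) (\<lambda>z. \<psi> (z\<^sup>2))"
      by (intro continuous_on_compose2[OF cont]) (auto intro!: continuous_intros)
    then show "continuous_on (closure (- cball 0 1)) (\<lambda>z. \<psi> (z\<^sup>2) - quad (\<psi> z))"
      unfolding closure_exterior by (intro continuous_intros cont)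
  qed (use assms in \<open>auto simp: psi_square_open closure_exterior not_less\<close>)
  then show ?thesis by simp
qed

text \<open>Squaring forgets the sign, so \<open>quad\<close> agrees on the two values and these are
  equal or opposite. Injectivity of \<open>\<psi>\<close> excludes equality in the open exterior,
  and continuity carries the equation to the circle.\<close>

lemma psi_minus:
  assumes "1 \<le> norm z"
  shows "\<psi> (- z) = - \<psi> z"
proof -
  have "\<psi> (- z) + \<psi> z = 0"
  proof (rule continuous_constant_on_closure[where S = "- cball 0 1" and f = "\<lambda>z. \<psi> (- z) + \<psi> z"])
    have "continuous_on (- ball 0 1) (\<lambda>z. \<psi> (- z))"
      by (rule continuous_on_compose2[OF cont]) (auto intro!: continuous_intros)
    then show "continuous_on (closure (- cball 0 1)) (\<lambda>z. \<psi> (- z) + \<psi> z)"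
      unfolding closure_exterior by (intro continuous_intros cont)
    fix z :: complex assume z: "z \<in> - cball 0 1"
    then have "quad (\<psi> (- z)) = quad (\<psi> z)"
      using psi_square[of z] psi_square[of "- z"] by simp
    moreover have "\<psi> (- z) \<noteq> \<psi> z"
      using inj_onD[OF inj, of "- z" z] z by auto
    ultimately show "\<psi> (- z) + \<psi> z = 0"
      by (simp add: quad_eq_iff)
  qed (use assms in \<open>auto simp: closure_exterior not_less\<close>)
  then show ?thesis by (simp add: eq_neg_iff_add_eq_0)
qed

text \<open>If the boundary value lay outside \<open>D3\<close>, the inverse map would be continuous
  there and would send the values along the radius to a point of modulus above 1, although their
  preimages tend to \<open>z\<close>.\<close>

lemma psi_circle_in_D3:
  assumes z: "norm z = 1"
  shows "\<psi> z \<in> D3"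
proof (rule ccontr)
  assume n: "\<psi> z \<notin> D3"
  define w where "w = inverse_map (\<psi> z)"
  have w: "1 < norm w"
    unfolding w_def by (rule norm_inverse_map[OF n])
  define X where "X = (\<lambda>n. (1 + 1 / real (Suc n)) *\<^sub>R z)"
  have "(\<lambda>n. 1 + 1 / real (Suc n)) \<longlonglongrightarrow> 1 + 0"
    by (intro tendsto_intros LIMSEQ_Suc[OF lim_1_over_n])
  then have X: "X \<longlonglongrightarrow> z"
    unfolding X_def using tendsto_scaleR[of "\<lambda>n. 1 + 1 / real (Suc n)" 1 sequentially "\<lambda>_. z" z] by simp
  have nX: "1 < norm (X n)" for n
    unfolding X_def using z by (simp add: field_simps)
  have "isCont inverse_map (\<psi> z)"
    using holomorphic_on_imp_continuous_on[OF holomorphic_inverse_map] n compact_imp_closed[OF compact_D3]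
    by (simp add: continuous_on_eq_continuous_at open_Compl)
  moreover have "(\<lambda>n. \<psi> (X n)) \<longlonglongrightarrow> \<psi> z"
    using continuous_on_tendsto_compose[OF cont X] z nX by (auto simp: not_less less_imp_le)
  ultimately have "(\<lambda>n. inverse_map (\<psi> (X n))) \<longlonglongrightarrow> w"
    unfolding w_def by (rule isCont_tendsto_compose)
  then have "X \<longlonglongrightarrow> w"
    using nX by simp
  then have "w = z"
    using X LIMSEQ_unique by blast
  then show False
    using w z by simp
qed

text \<open>As \<open>filled\<close> has no interior, every point of \<open>D3\<close> is a limit of
  values of \<open>\<psi>\<close>. The preimages stay bounded because \<open>\<psi>\<close> tends to
  infinity, and a limit point of them can only lie on the circle.\<close>

lemma psi_image_circle: "\<psi> ` S1 = D3"
proof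
  show "\<psi> ` S1 \<subseteq> D3"
    using psi_circle_in_D3 by auto
  show "D3 \<subseteq> \<psi> ` S1"
  proof
    fix x assume x: "x \<in> D3"
    have "x \<in> closure (- D3)"
      using x interior_filled by (simp add: closure_complement D3_eq_filled)
    then obtain W where W: "\<And>n. W n \<notin> D3" "W \<longlonglongrightarrow> x"
      unfolding closure_sequential by auto
    define Z where "Z = (\<lambda>n. inverse_map (W n))"
    have Z: "1 < norm (Z n)" "\<psi> (Z n) = W n" for n
      unfolding Z_def using W(1) by (auto simp: norm_inverse_map psi_inverse_map)
    obtain M where M: "\<And>n. norm (W n) \<le> M"
      using convergent_imp_bounded[OF W(2)] unfolding bounded_iff by auto
    obtain R where R: "\<And>z. R \<le> norm z \<Longrightarrow> M + 1 \<le> norm (\<psi> z)"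
    proof -
      have "0 < max M 0 + 1" by simp
      then obtain b where "\<And>z. b \<le> norm z \<Longrightarrow> max M 0 + 1 \<le> norm (\<psi> z)"
        using psi_at_infinity[unfolded filterlim_at_infinity[OF order_refl], rule_format, of "max M 0 + 1"]
        unfolding eventually_at_infinity by auto
      then show ?thesis
        by (intro that[of b]) (metis add_le_cancel_right max.boundedE max_add_distrib_left)
    qed
    have "norm (Z n) < R" for n
      using R[of "Z n"] M[of n] Z(2)[of n] by fastforce
    then have "\<forall>n. Z n \<in> cball 0 R - ball 0 1"
      using Z(1) by (simp add: less_imp_le not_less)
    moreover have "compact (cball 0 R - ball (0::complex) 1)"
      by (intro compact_diff) auto
    ultimately obtain l r where l: "l \<in> cball 0 R - ball 0 1" "strict_mono (r :: nat \<Rightarrow> nat)" "(Z \<circ> r) \<longlonglongrightarrow> l"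
      unfolding compact_def by metis
    have "(\<lambda>n. \<psi> ((Z \<circ> r) n)) \<longlonglongrightarrow> \<psi> l"
      using continuous_on_tendsto_compose[OF cont l(3)] l(1) Z(1) by (auto simp: not_less less_imp_le)
    moreover have "(\<lambda>n. \<psi> ((Z \<circ> r) n)) \<longlonglongrightarrow> x"
      using LIMSEQ_subseq_LIMSEQ[OF W(2) l(2)] Z(2) by (simp add: o_def)
    ultimately have "\<psi> l = x"
      using LIMSEQ_unique by blast
    moreover have "norm l = 1"
      using psi_notin_D3[of l] l(1) x \<open>\<psi> l = x\<close> by (force simp: not_less)
    ultimately show "x \<in> \<psi> ` S1"
      by auto
  qed
qed

end

section \<open>External angles and landing of rays\<close>

definition e :: "real \<Rightarrow> complex" where
  "e t = cis (2 * pi * t)"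

lemma norm_e [simp]: "norm (e t) = 1"
  by (simp add: e_def)

lemma e_add: "e (s + t) = e s * e t"
  by (simp add: e_def distrib_left cis_mult)

lemma e_add_int [simp]: "e (t + of_int k) = e t"
proof -
  have "e (of_int k) = 1"
    unfolding e_def by (rule cis_multiple_2pi) simp
  then show ?thesis
    by (simp add: e_add)
qed

lemma e_double: "e (2 * t) = (e t)\<^sup>2"
  by (simp add: e_def power2_eq_square cis_mult)

lemma e_add_half: "e (t + 1/2) = - e t"
proof -
  have "e (1/2) = - 1"
    by (simp add: e_def)
  then show ?thesis
    by (simp add: e_add)
qed

lemma e_eq_iff: "e s = e t \<longleftrightarrow> (\<exists>k::int. s = t + k)"
proof
  assume "e s = e t"
  then have "sin (2 * pi * s) = sin (2 * pi * t) \<and> cos (2 * pi * s) = cos (2 * pi * t)"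
    by (auto simp: e_def complex_eq_iff)
  then obtain n :: int where "2 * pi * s = 2 * pi * t + 2 * pi * n"
    unfolding sin_cos_eq_iff by auto
  then have "2 * pi * (s - (t + n)) = 0"
    by (simp add: algebra_simps)
  then show "\<exists>k::int. s = t + k"
    by auto
next
  assume "\<exists>k::int. s = t + k"
  then obtain k :: int where "s = t + k" ..
  then show "e s = e t" by simp
qed

lemma ex_int_shift: "\<exists>k::int. a \<le> t + k \<and> t + k < a + (1::real)"
proof
  show "a \<le> t + of_int (- \<lfloor>t - a\<rfloor>) \<and> t + of_int (- \<lfloor>t - a\<rfloor>) < a + 1"
    by linarith
qed

lemma e_surj:
  assumes "norm z = 1"
  shows "\<exists>t. a \<le> t \<and> t < a + 1 \<and> z = e t"
proof -
  obtain s where "z = cis s"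
    using assms by (metis cis_Arg norm_eq_zero zero_neq_one sgn_eq div_by_1 of_real_1)
  then have "z = e (s / (2 * pi))"
    by (simp add: e_def)
  then show ?thesis
    using ex_int_shift[of a "s / (2 * pi)"] e_add_int by metis
qed

lemma continuous_on_e [continuous_intros]:
  "continuous_on S f \<Longrightarrow> continuous_on S (\<lambda>x. e (f x))"
  unfolding e_def by (intro continuous_intros)

lemma polar_e:
  fixes z :: complex
  assumes "z \<noteq> 0"
  obtains t where "a \<le> t" "t < a + 1" "z = of_real (norm z) * e t"
proof -
  have "norm (z / of_real (norm z)) = 1"
    using assms by (simp add: norm_divide)
  from e_surj[OF this, of a] obtain t where "a \<le> t" "t < a + 1" "z / of_real (norm z) = e t"
    by auto
  then show ?thesis
    using assms by (intro that[of t]) (auto simp: field_simps)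
qed

context riemann_exterior
begin

section \<open>Landing points of external rays\<close>

lemma psi_large: "\<exists>R. \<forall>z. R \<le> norm z \<longrightarrow> M < norm (\<psi> z)"
proof -
  have "0 < max M 0 + 1"
    by simp
  then obtain b where "\<And>z. b \<le> norm z \<Longrightarrow> max M 0 + 1 \<le> norm (\<psi> z)"
    using psi_at_infinity[unfolded filterlim_at_infinity[OF order_refl], rule_format, of "max M 0 + 1"]
    unfolding eventually_at_infinity by auto
  then have "\<forall>z. b \<le> norm z \<longrightarrow> M < norm (\<psi> z)"
    by fastforce
  then show ?thesis ..
qed

definition \<Phi> :: "real \<Rightarrow> complex" where
  "\<Phi> t = \<psi> (e t)"

lemma Phi_add_int [simp]: "\<Phi> (t + of_int k) = \<Phi> t"
  by (simp add: \<Phi>_def)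

lemma Phi_double: "\<Phi> (2 * t) = quad (\<Phi> t)"
  by (simp add: \<Phi>_def e_double psi_square)

lemma Phi_add_half: "\<Phi> (t + 1/2) = - \<Phi> t"
  by (simp add: \<Phi>_def e_add_half psi_minus)

lemma Phi_range: "range \<Phi> = D3"
proof -
  have "range \<Phi> = \<psi> ` range e"
    by (auto simp: \<Phi>_def)
  also have "range e = S1"
  proof
    show "S1 \<subseteq> range e"
      using e_surj[of _ 0] by (metis dist_0_norm mem_sphere rangeI subsetI)
  qed auto
  finally show ?thesis
    by (simp add: psi_image_circle)
qed

lemma Phi_in_D3 [simp]: "\<Phi> t \<in> D3"
  using Phi_range by auto

lemma D3_Phi:
  assumes "x \<in> D3"
  obtains t where "a \<le> t" "t < a + 1" "x = \<Phi> t"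
proof -
  obtain s where "x = \<Phi> s"
    using assms Phi_range by auto
  then show ?thesis
    using ex_int_shift[of a s] that[of "s + of_int k" for k] by auto
qed

lemma continuous_on_ray: "continuous_on {1..} (\<lambda>r. \<psi> (of_real r * e t))"
  by (rule continuous_on_compose2[OF cont]) (auto simp: norm_mult intro!: continuous_intros)

lemma continuous_on_Phi: "continuous_on S \<Phi>"
proof -
  have "continuous_on UNIV \<Phi>"
    unfolding \<Phi>_def by (rule continuous_on_compose2[OF cont]) (auto intro!: continuous_intros)
  then show ?thesis
    using continuous_on_subset by blast
qed

lemma psi_ray_tendsto: "(\<lambda>n. \<psi> (of_real (1 + 1 / real (Suc n)) * e t)) \<longlonglongrightarrow> \<Phi> t"
proof -
  have 1: "(\<lambda>n. 1 + 1 / real (Suc n)) \<longlonglongrightarrow> 1 + 0"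
    by (intro tendsto_intros LIMSEQ_Suc[OF lim_1_over_n])
  have "(\<lambda>n. \<psi> (of_real (1 + 1 / real (Suc n)) * e t)) \<longlonglongrightarrow> \<psi> (of_real (1 + 0) * e t)"
    by (rule continuous_on_tendsto_compose[OF continuous_on_ray 1]) auto
  then show ?thesis
    by (simp add: \<Phi>_def)
qed

lemma quad_ray: "1 \<le> r \<Longrightarrow> quad (\<psi> (of_real r * e t)) = \<psi> (of_real (r\<^sup>2) * e (2 * t))"
  using psi_square[of "of_real r * e t"] by (simp add: norm_mult e_double power_mult_distrib)

section \<open>The rays of angles 1/3 and 2/3 and the angles of the critical orbit\<close>

lemma rays_far:
  "\<exists>R>1. \<forall>r\<ge>R. Re (\<psi> (of_real r * e (1/3))) < 0 \<and> Im (\<psi> (of_real r * e (2/3))) < 0"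
proof -
  have "\<forall>\<^sub>F z in at_infinity. dist (\<psi> z / z) 1 < 1/4"
    using lim by (rule tendstoD) simp
  then obtain R where R: "\<And>z. R \<le> norm z \<Longrightarrow> norm (\<psi> z / z - 1) < 1/4"
    unfolding eventually_at_infinity dist_norm by auto
  \<comment> \<open>Far out, \<open>\<psi>\<close> differs from the identity by a relative error
    below 1/4, while the real part of \<open>e (1/3)\<close> and the imaginary part of
    \<open>e (2/3)\<close> are at most -1/2; so the signs survive.\<close>
  have part: "norm (\<psi> (of_real r * u) - of_real r * u) < r / 4"
    if "max R 2 \<le> r" "norm u = 1" for r u
  proof -
    have "norm (\<psi> (of_real r * u) / (of_real r * u) - 1) < 1/4"
      using that by (intro R) (simp add: norm_mult)
    also have "\<psi> (of_real r * u) / (of_real r * u) - 1 =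
        (\<psi> (of_real r * u) - of_real r * u) / (of_real r * u)"
      using that by (auto simp: diff_divide_distrib)
    finally show ?thesis
      using that by (simp add: norm_divide norm_mult field_simps)
  qed
  have "Re (e (1/3)) = -1/2"
    using cos_120 by (simp add: e_def field_simps)
  moreover have "Im (e (2/3)) = - sin (pi/3)"
    using sin_periodic_pi2[of "pi/3"] by (simp add: e_def field_simps)
  moreover have "1 \<le> sqrt (3::real)"
    by simp
  ultimately have u: "Re (e (1/3)) = -1/2" "Im (e (2/3)) \<le> -1/2"
    by (auto simp: sin_60)
  have "Re (\<psi> (of_real r * e (1/3))) < 0 \<and> Im (\<psi> (of_real r * e (2/3))) < 0"
    if r: "max R 2 \<le> r" for r
  proof
    show "Re (\<psi> (of_real r * e (1/3))) < 0"
      using part[OF r, of "e (1/3)"] abs_Re_le_cmod[of "\<psi> (of_real r * e (1/3)) - of_real r * e (1/3)"]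
        r u by simp
    have "r * Im (e (2/3)) \<le> r * (-1/2)"
      using r u by (intro mult_left_mono) auto
    then show "Im (\<psi> (of_real r * e (2/3))) < 0"
      using part[OF r, of "e (2/3)"] abs_Im_le_cmod[of "\<psi> (of_real r * e (2/3)) - of_real r * e (2/3)"]
        r by simp
  qed
  then show ?thesis
    by (intro exI[of _ "max R 2"]) auto
qed

lemma IVT_negative:
  fixes g :: "real \<Rightarrow> real"
  assumes "continuous_on {a..} g" "\<And>t. a \<le> t \<Longrightarrow> g t \<noteq> 0" "a \<le> b" "g b < 0"
  shows "g a < 0"
proof (rule ccontr)
  assume "\<not> g a < 0"
  moreover have "continuous_on {a..b} g"
    by (rule continuous_on_subset[OF assms(1)]) auto
  ultimately have "\<exists>x\<ge>a. x \<le> b \<and> g x = 0"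
    using assms(3,4) by (intro IVT2') auto
  then show False
    using assms(2) by auto
qed

text \<open>The rays of angles \<open>1/3\<close> and \<open>2/3\<close> are exchanged by \<open>quad\<close>, and \<open>quad\<close> maps the real
  axis into the right and the imaginary axis into the upper half plane. So the rays cannot
  leave the half planes in which they start.\<close>

lemma rays_half_planes:
  assumes "1 < r"
  shows "Re (\<psi> (of_real r * e (1/3))) < 0 \<and> Im (\<psi> (of_real r * e (2/3))) < 0"
proof -
  let ?g = "\<lambda>r. \<psi> (of_real r * e (1/3))" and ?h = "\<lambda>r. \<psi> (of_real r * e (2/3))"
  obtain R where R: "1 < R" "\<And>r. R \<le> r \<Longrightarrow> Re (?g r) < 0 \<and> Im (?h r) < 0"
    using rays_far by auto
  \<comment> \<open>Induction on the number of squarings that bring the radius \<open>r\<close>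
    beyond \<open>R\<close>; one step of it is one application of \<open>quad\<close>, which swaps
    the two rays.\<close>
  have "Re (?g r) < 0 \<and> Im (?h r) < 0" if "1 < r" "R \<le> r ^ (2 ^ n)" for n r
    using that
  proof (induction n arbitrary: r)
    case 0
    then show ?case using R by simp
  next
    case (Suc n)
    have *: "Re (?g (t\<^sup>2)) < 0 \<and> Im (?h (t\<^sup>2)) < 0" if "r \<le> t" for t
    proof (rule Suc.IH)
      have "r ^ (2 ^ Suc n) \<le> t ^ (2 ^ Suc n)"
        using Suc.prems that by (intro power_mono) auto
      with Suc.prems(2) have "R \<le> t ^ (2 ^ Suc n)"
        by (rule order_trans)
      then show "R \<le> t\<^sup>2 ^ (2 ^ n)"
        by (simp add: power_mult)
      show "1 < t\<^sup>2"
        using Suc.prems that by simp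
    qed
    have "e (4/3) = e (1/3)"
      using e_add_int[of "1/3" 1] by simp
    then have h: "quad (?h t) = ?g (t\<^sup>2)" and g: "quad (?g t) = ?h (t\<^sup>2)" if "r \<le> t" for t
      using that Suc.prems by (simp_all add: quad_ray)
    have sub: "{r..} \<subseteq> {1..}"
      using Suc.prems by auto
    have "Im (?h r) < 0"
    proof (rule IVT_negative[where b = "max r R" and g = "\<lambda>t. Im (?h t)"])
      show "continuous_on {r..} (\<lambda>t. Im (?h t))"
        by (intro continuous_intros continuous_on_subset[OF continuous_on_ray sub])
      fix t assume t: "r \<le> t"
      show "Im (?h t) \<noteq> 0"
      proof
        assume "Im (?h t) = 0"
        then have "0 \<le> Re (quad (?h t))"
          by (simp add: quad_def power2_eq_square)
        then show False
          using *[OF t] h[OF t] by simp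
      qed
    qed (use R(2)[of "max r R"] in auto)
    moreover have "Re (?g r) < 0"
    proof (rule IVT_negative[where b = "max r R" and g = "\<lambda>t. Re (?g t)"])
      show "continuous_on {r..} (\<lambda>t. Re (?g t))"
        by (intro continuous_intros continuous_on_subset[OF continuous_on_ray sub])
      fix t assume t: "r \<le> t"
      show "Re (?g t) \<noteq> 0"
      proof
        assume "Re (?g t) = 0"
        then have "0 \<le> Im (quad (?g t))"
          by (simp add: quad_def power2_eq_square)
        then show False
          using *[OF t] g[OF t] by simp
      qed
    qed (use R(2)[of "max r R"] in auto)
    ultimately show ?case by simp
  qed
  moreover obtain n where "R < r ^ n"
    using real_arch_pow[OF assms, of R] by auto
  moreover have "r ^ n \<le> r ^ (2 ^ n)"
    using assms less_exp[of n] by (intro power_increasing) auto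
  ultimately show ?thesis
    using assms by (metis less_imp_le order_trans)
qed

text \<open>The landing points lie in closed half planes and are exchanged by \<open>quad\<close>,
  so \<open>p\<close> is a root of a quartic that splits into the quadratic of the fixed points and
  the two points of the cycle. If \<open>p\<close> were fixed, both half planes would contain it,
  and the imaginary part of the fixed point equation would be at least 1. The root
  \<open>- \<i>\<close> would give \<open>q\<close> a positive imaginary part.\<close>

lemma Phi_third: "\<Phi> (1/3) = - 1 + \<i>" and Phi_two_thirds: "\<Phi> (2/3) = - \<i>"
proof -
  define p q where "p = \<Phi> (1/3)" and "q = \<Phi> (2/3)"
  have "Re p \<le> 0"
    unfolding p_def
  proof (rule LIMSEQ_le_const2[OF tendsto_Re[OF psi_ray_tendsto]], intro exI allI impI)
    fix n show "Re (\<psi> (of_real (1 + 1 / real (Suc n)) * e (1/3))) \<le> 0"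
      using rays_half_planes[of "1 + 1 / real (Suc n)"] by (simp add: less_imp_le)
  qed
  have "Im q \<le> 0"
    unfolding q_def
  proof (rule LIMSEQ_le_const2[OF tendsto_Im[OF psi_ray_tendsto]], intro exI allI impI)
    fix n show "Im (\<psi> (of_real (1 + 1 / real (Suc n)) * e (2/3))) \<le> 0"
      using rays_half_planes[of "1 + 1 / real (Suc n)"] by (simp add: less_imp_le)
  qed
  have q: "q = quad p"
    unfolding p_def q_def using Phi_double[of "1/3"] by simp
  have p: "p = quad q"
    unfolding p_def q_def using Phi_double[of "2/3"] Phi_add_int[of "1/3" 1] by simp
  have "(p\<^sup>2 - p + \<i>) * ((p + \<i>) * (p + 1 - \<i>)) = quad (quad p) - p"
    by (simp add: quad_def algebra_simps power2_eq_square)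
  also have "\<dots> = 0"
    using p q by simp
  finally have "p\<^sup>2 - p + \<i> = 0 \<or> p + \<i> = 0 \<or> p + 1 - \<i> = 0"
    unfolding mult_eq_0_iff .
  then consider "p\<^sup>2 - p + \<i> = 0" | "p = - \<i>" | "p = - 1 + \<i>"
    by (metis add.commute add.left_commute eq_neg_iff_add_eq_0 eq_iff_diff_eq_0 minus_add_cancel)
  then have "p = - 1 + \<i>"
  proof cases
    case 1
    then have "q = p"
      by (simp add: q quad_def algebra_simps)
    have "Im (p\<^sup>2 - p + \<i>) = 0"
      using 1 by simp
    then have "2 * (Re p * Im p) - Im p + 1 = 0"
      by (simp add: power2_eq_square algebra_simps)
    moreover have "0 \<le> Re p * Im p"
      using \<open>Re p \<le> 0\<close> \<open>Im q \<le> 0\<close> \<open>q = p\<close> by (simp add: mult_nonpos_nonpos)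
    ultimately show ?thesis
      using \<open>Im q \<le> 0\<close> \<open>q = p\<close> by simp
  next
    case 2
    then have "Im q = 1"
      by (simp add: q quad_def)
    then show ?thesis
      using \<open>Im q \<le> 0\<close> by simp
  qed
  moreover from this have "q = quad (- 1 + \<i>)"
    unfolding q by (rule arg_cong)
  then have "q = - \<i>"
    by (simp add: quad_def power2_eq_square algebra_simps)
  ultimately show "\<Phi> (1/3) = - 1 + \<i>" "\<Phi> (2/3) = - \<i>"
    by (simp_all add: p_def q_def)
qed

lemma Phi_sixth: "\<Phi> (1/6) = \<i>"
  using Phi_add_half[of "1/6"] Phi_two_thirds by (simp add: neg_equal_iff_equal)

lemma Phi_twelfth: "\<Phi> (1/12) = 0" and Phi_seven_twelfths: "\<Phi> (7/12) = 0"
proof -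
  show "\<Phi> (1/12) = 0"
    using Phi_double[of "1/12"] Phi_sixth by (simp add: quad_def)
  then show "\<Phi> (7/12) = 0"
    using Phi_add_half[of "1/12"] by simp
qed

text \<open>The complement of the closed ray of angle \<open>1/6\<close>, which ends at the critical value
  \<open>\<i>\<close>, is simply connected and so carries a branch of the inverse of \<open>quad\<close>. On the exterior
  domain this branch halves the angles, hence so it does on the Julia set.\<close>

lemma Phi_half_eq:
  assumes st: "1/6 < s" "s < 7/6" "1/6 < t" "t < 7/6" and eq: "\<Phi> s = \<Phi> t" and ni: "\<Phi> s \<noteq> \<i>"
  shows "\<Phi> (s/2) = \<Phi> (t/2)"
proof -
  define X where "X = (\<lambda>r. \<psi> (of_real r * e (1/6))) ` {1..}"
  \<comment> \<open>\<open>C\<close> is the exterior domain slit along the ray. It is connected as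
    the image of a convex set and dense in the complement of \<open>X\<close>, which is therefore
    connected too.\<close>
  define C where "C = (\<lambda>(r, t). \<psi> (of_real r * e t)) ` ({1<..} \<times> {1/6<..<7/6})"
  have iX: "\<i> \<in> X"
    unfolding X_def using Phi_sixth by (intro image_eqI[of _ _ 1]) (auto simp: \<Phi>_def)
  have XD3: "x = \<i>" if xX: "x \<in> X" and xD: "x \<in> D3" for x
  proof -
    obtain r where r: "1 \<le> r" "x = \<psi> (of_real r * e (1/6))"
      using xX unfolding X_def by auto
    then have "r = 1"
      using psi_notin_D3[of "of_real r * e (1/6)"] xD by (cases "1 < r") (auto simp: norm_mult)
    then show ?thesis
      using r Phi_sixth by (simp add: \<Phi>_def)
  qed
  have notX: "\<psi> (of_real r * e t) \<notin> X" if "1 < r" "1/6 < t" "t < 7/6" for r :: real and t :: real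
  proof
    assume "\<psi> (of_real r * e t) \<in> X"
    then obtain r' where r': "1 \<le> r'" "\<psi> (of_real r * e t) = \<psi> (of_real r' * e (1/6))"
      by (auto simp: X_def)
    have "r' \<noteq> 1"
      using psi_notin_D3[of "of_real r * e t"] r'(2) that(1) Phi_in_D3[of "1/6"]
      by (auto simp: norm_mult \<Phi>_def)
    then have *: "of_real r * e t = of_real r' * e (1/6)"
      using inj_onD[OF inj r'(2)] r'(1) that(1) by (simp add: norm_mult)
    then have "norm (of_real r * e t) = norm (of_real r' * e (1/6))"
      by simp
    then have "r = r'"
      using that(1) r'(1) by (simp add: norm_mult)
    then have "e t = e (1/6)"
      using * that(1) by simp
    then obtain k :: int where "t = 1/6 + k"
      unfolding e_eq_iff by auto
    then have "0 < real_of_int k" "real_of_int k < 1"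
      using that by auto
    then show False
      by simp
  qed
  have contX: "continuous_on {1..} (\<lambda>r. \<psi> (of_real r * e (1/6)))"
    by (rule continuous_on_ray)
  have "closed X"
    unfolding closed_sequential_limits
  proof (intro allI impI, elim conjE)
    fix y l assume y: "\<forall>n. y n \<in> X" "y \<longlonglongrightarrow> l"
    then obtain M where M: "\<And>n. norm (y n) \<le> M"
      using convergent_imp_bounded[OF y(2)] unfolding bounded_iff by auto
    obtain R where R: "\<And>z. R \<le> norm z \<Longrightarrow> M < norm (\<psi> z)"
      using psi_large by blast
    let ?Y = "(\<lambda>r. \<psi> (of_real r * e (1/6))) ` {1..R}"
    have "y n \<in> ?Y" for n
    proof -
      obtain r where r: "1 \<le> r" "y n = \<psi> (of_real r * e (1/6))"
        using y(1) by (force simp: X_def)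
      then have "r \<le> R"
        using R[of "of_real r * e (1/6)"] M[of n] by (cases "r \<le> R") (auto simp: norm_mult)
      then show ?thesis
        using r by auto
    qed
    moreover have "compact ?Y"
      by (intro compact_continuous_image continuous_on_subset[OF contX]) auto
    ultimately have "l \<in> ?Y"
      using y(2) compact_imp_closed closed_sequentially by blast
    then show "l \<in> X"
      by (auto simp: X_def)
  qed
  have "connected C"
    unfolding C_def
  proof (rule connected_continuous_image)
    show "continuous_on ({1<..} \<times> {1/6<..<7/6}) (\<lambda>(r, t). \<psi> (of_real r * e t))"
      unfolding split_beta
      by (rule continuous_on_compose2[OF cont]) (auto simp: norm_mult intro!: continuous_intros)
  qed (intro convex_connected convex_Times convex_real_interval)
  moreover have "C \<subseteq> - X"
    using notX by (auto simp: C_def)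
  moreover have "- X \<subseteq> closure C"
  proof
    fix x assume x: "x \<in> - X"
    show "x \<in> closure C"
    proof (cases "x \<in> D3")
      case True
      then obtain t where t: "1/6 \<le> t" "t < 1/6 + 1" "x = \<Phi> t"
        by (rule D3_Phi)
      then have t16: "1/6 < t"
        using x Phi_sixth iX by (cases "t = 1/6") auto
      have "\<psi> (of_real (1 + 1 / real (Suc n)) * e t) \<in> C" for n
        unfolding C_def using t t16 by (intro image_eqI[of _ _ "(1 + 1 / real (Suc n), t)"]) auto
      then show ?thesis
        unfolding closure_sequential t(3) using psi_ray_tendsto[of t] by (intro exI conjI allI)
    next
      case False
      define z where "z = inverse_map x"
      have z: "1 < norm z" "\<psi> z = x"
        using False by (auto simp: z_def norm_inverse_map psi_inverse_map)
      then obtain t where t: "1/6 \<le> t" "t < 1/6 + 1" "z = of_real (norm z) * e t"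
        using polar_e[of z "1/6"] by (metis norm_zero not_one_less_zero)
      have "t \<noteq> 1/6"
      proof
        assume "t = 1/6"
        then have "x \<in> X"
          unfolding X_def using z t(3) by (intro image_eqI[of _ _ "norm z"]) (metis, simp)
        then show False
          using x by simp
      qed
      then have "x \<in> C"
        unfolding C_def using z t by (intro image_eqI[of _ _ "(norm z, t)"]) auto
      then show ?thesis
        using closure_subset by blast
    qed
  qed
  ultimately have "connected (- X)"
    by (rule connected_intermediate_closure)
  have "connected X"
    unfolding X_def by (intro connected_continuous_image contX) simp
  have "\<not> bounded X"
  proof
    assume "bounded X"
    then obtain M where M: "\<And>x. x \<in> X \<Longrightarrow> norm x \<le> M"
      unfolding bounded_iff by auto
    obtain R where R: "\<And>z. R \<le> norm z \<Longrightarrow> M < norm (\<psi> z)"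
      using psi_large by blast
    have "\<psi> (of_real (max R 1) * e (1/6)) \<in> X"
      by (auto simp: X_def)
    from M[OF this] show False
      using R[of "of_real (max R 1) * e (1/6)"] by (simp add: norm_mult)
  qed
  moreover have "components X = {X}"
    using \<open>connected X\<close> iX by (auto simp: components_eq_sing_iff)
  \<comment> \<open>The only component of \<open>X\<close> is unbounded, so its complement has no
    hole and carries a square root of \<open>w - \<i>\<close>.\<close>
  ultimately have "simply_connected (- X)"
    using \<open>connected (- X)\<close> \<open>closed X\<close> by (simp add: simply_connected_eq_unbounded_complement_components open_Compl)
  then have "\<exists>\<sigma>. continuous_on (- X) \<sigma> \<and> (\<forall>w\<in>- X. w - \<i> = (\<sigma> w)\<^sup>2)"
  proof (subst (asm) simply_connected_eq_continuous_sqrt)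
    assume sq: "connected (- X) \<and> (\<forall>f::complex \<Rightarrow> complex. continuous_on (- X) f \<and> (\<forall>z\<in>- X. f z \<noteq> 0) \<longrightarrow>
        (\<exists>g. continuous_on (- X) g \<and> (\<forall>z\<in>- X. f z = (g z)\<^sup>2)))"
    have "continuous_on (- X) (\<lambda>w. w - \<i>)" "\<forall>w\<in>- X. w - \<i> \<noteq> 0"
      using iX by (auto intro!: continuous_intros)
    then show ?thesis
      using sq[THEN conjunct2, rule_format, of "\<lambda>w. w - \<i>"] by blast
  qed (use \<open>closed X\<close> in \<open>auto simp: open_Compl\<close>)
  then obtain \<sigma> where \<sigma>: "continuous_on (- X) \<sigma>" "\<And>w. w \<in> - X \<Longrightarrow> w - \<i> = (\<sigma> w)\<^sup>2"
    by blast
  \<comment> \<open>Radius and angle off the slit. The boundary \<open>r = 1\<close> is included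
    except at angles landing at \<open>\<i>\<close>, so that the comparison can be evaluated on the
    Julia set itself.\<close>
  define W :: "(real \<times> real) set" where "W = {(r, t). 1 \<le> r \<and> 1/6 < t \<and> t < 7/6 \<and> (r = 1 \<longrightarrow> \<Phi> t \<noteq> \<i>)}"
  have WX: "\<psi> (of_real r * e t) \<in> - X" if "(r, t) \<in> W" for r :: real and t :: real
  proof (cases "r = 1")
    case True
    then show ?thesis
      using that XD3[of "\<Phi> t"] Phi_in_D3[of t] by (auto simp: W_def \<Phi>_def)
  next
    case False
    then show ?thesis
      using that notX by (auto simp: W_def)
  qed
  \<comment> \<open>Numerator and denominator both have the square
    \<open>\<psi> (r e t) - \<i>\<close>, so the quotient is a sign; being continuous on the
    connected set \<open>W\<close>, it is the same sign for \<open>s\<close> and for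
    \<open>t\<close>.\<close>
  define q where "q = (\<lambda>(r, t). \<psi> (of_real (sqrt r) * e (t / 2)) / \<sigma> (\<psi> (of_real r * e t)))"
  have \<sigma>0: "\<sigma> w \<noteq> 0" if "w \<in> - X" for w
    using \<sigma>(2)[OF that] that iX by auto
  have q2: "q (r, t) \<in> {1, -1}" if "(r, t) \<in> W" for r :: real and t :: real
  proof -
    have "1 \<le> r"
      using that by (simp add: W_def)
    then have "quad (\<psi> (of_real (sqrt r) * e (t / 2))) = \<psi> (of_real r * e t)"
      using quad_ray[of "sqrt r" "t / 2"] by simp
    then have "(\<psi> (of_real (sqrt r) * e (t / 2)))\<^sup>2 = (\<sigma> (\<psi> (of_real r * e t)))\<^sup>2"
      using \<sigma>(2)[OF WX[OF that]] by (metis add_diff_cancel_right' quad_def)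
    then show ?thesis
      using \<sigma>0[OF WX[OF that]] by (auto simp: q_def power2_eq_iff)
  qed
  have "continuous_on W q"
    unfolding q_def split_beta
  proof (intro continuous_on_divide)
    show "continuous_on W (\<lambda>x. \<psi> (of_real (sqrt (fst x)) * e (snd x / 2)))"
      by (rule continuous_on_compose2[OF cont]) (auto simp: norm_mult W_def intro!: continuous_intros)
    have "continuous_on W (\<lambda>x. \<psi> (of_real (fst x) * e (snd x)))"
      by (rule continuous_on_compose2[OF cont]) (auto simp: norm_mult W_def intro!: continuous_intros)
    then show "continuous_on W (\<lambda>x. \<sigma> (\<psi> (of_real (fst x) * e (snd x))))"
      by (rule continuous_on_compose2[OF \<sigma>(1)]) (use WX in auto)
    show "\<forall>x\<in>W. \<sigma> (\<psi> (of_real (fst x) * e (snd x))) \<noteq> 0"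
      using WX \<sigma>0 by auto
  qed
  moreover have "connected W"
  proof (rule connected_intermediate_closure)
    show "connected ({1<..} \<times> {1/6<..<7/6::real} :: (real \<times> real) set)"
      by (intro convex_connected convex_Times convex_real_interval)
    show "{1<..} \<times> {1/6<..<7/6} \<subseteq> W"
      by (auto simp: W_def)
    show "W \<subseteq> closure ({1<..} \<times> {1/6<..<7/6})"
      by (auto simp: W_def closure_Times)
  qed
  moreover have "finite (q ` W)"
    by (rule finite_subset[of _ "{1, -1}"]) (use q2 in auto)
  ultimately obtain k where k: "\<And>x. x \<in> W \<Longrightarrow> q x = k"
    using continuous_finite_range_constant[of W q] unfolding constant_on_def by metis
  have "(1, s) \<in> W" "(1, t) \<in> W"
    using st ni eq by (auto simp: W_def)
  from k[OF this(1)] k[OF this(2)] \<sigma>0[OF WX[OF this(1)]] show ?thesis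
    using eq by (simp add: q_def flip: \<Phi>_def) (metis divide_cancel_right)
qed

end

section \<open>Which angles land together\<close>

lemma int_eq_0: "- 1 < real_of_int k \<Longrightarrow> real_of_int k < 1 \<Longrightarrow> k = 0"
  by linarith

lemma no_int: "- 1 < real_of_int k \<Longrightarrow> real_of_int k < 0 \<Longrightarrow> False"
  using int_eq_0[of k] by simp

text \<open>The set \<open>{1/7, 2/7, 4/7}\<close> is the only cycle of angle doubling in the closed half circle
  \<open>[1/12, 7/12]\<close>.\<close>

lemma doubling_invariant_set:
  fixes X :: "real set"
  assumes X: "X \<subseteq> {1/12..7/12}" and inv: "\<And>x. x \<in> X \<Longrightarrow> 2 * x \<in> X \<or> 2 * x - 1 \<in> X"
  shows "X \<subseteq> {1/7, 2/7, 4/7}"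
proof
  fix x assume x: "x \<in> X"
  have I: "1/12 \<le> x \<and> x \<le> 7/12" if "x \<in> X" for x
    using X that by auto
  have S1: "x \<le> 7/24 \<or> 13/24 \<le> x" if "x \<in> X" for x
    using I[of "2 * x"] I[of "2 * x - 1"] inv[OF that] by linarith
  \<comment> \<open>The signed distance to that point of the cycle which belongs to the piece
    containing \<open>x\<close>. By \<open>S2\<close> an invariant set keeps to three short pieces,
    each of which doubling carries towards the next one while it doubles \<open>d\<close>; a bounded
    quantity that can always be doubled is 0.\<close>
  define d where "d = (\<lambda>x. if x \<le> 7/48 then x - 1/7 else if x \<le> 7/24 then x - 2/7 else x - (4/7::real))"
  have S2: "x \<le> 7/48 \<or> (13/48 \<le> x \<and> x \<le> 7/24) \<or> 13/24 \<le> x" if "x \<in> X" for x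
    using I[OF that] S1[OF that] I[of "2 * x - 1"] S1[of "2 * x"] inv[OF that] by linarith
  have "\<exists>y\<in>X. \<bar>d y\<bar> = 2 * \<bar>d x\<bar>" if "x \<in> X" for x
    using inv[OF that]
  proof
    assume y: "2 * x \<in> X"
    have "\<bar>d (2 * x)\<bar> = 2 * \<bar>d x\<bar>"
      using S2[OF that] I[OF that] I[OF y] S2[OF y] unfolding d_def
      by (auto simp: abs_if field_simps)
    then show ?thesis using y by blast
  next
    assume y: "2 * x - 1 \<in> X"
    have "\<bar>d (2 * x - 1)\<bar> = 2 * \<bar>d x\<bar>"
      using S2[OF that] I[OF that] I[OF y] S2[OF y] unfolding d_def
      by (auto simp: abs_if field_simps)
    then show ?thesis using y by blast
  qed
  then have "\<forall>x\<in>X. \<bar>d x\<bar> \<le> (1/2) ^ n" for n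
  proof (induction n)
    case 0
    have "\<bar>d x\<bar> \<le> 1" if "x \<in> X" for x
      using I[OF that] by (auto simp: d_def abs_if)
    then show ?case by simp
  next
    case (Suc n)
    show ?case
    proof
      fix x assume "x \<in> X"
      then obtain y where "y \<in> X" "\<bar>d y\<bar> = 2 * \<bar>d x\<bar>"
        using Suc.prems by blast
      then show "\<bar>d x\<bar> \<le> (1/2) ^ Suc n"
        using Suc.IH[OF Suc.prems] by force
    qed
  qed
  then have "\<bar>d x\<bar> \<le> 0"
    using x by (intro LIMSEQ_le_const[OF LIMSEQ_power_zero[of "1/2"]]) auto
  then show "x \<in> {1/7, 2/7, 4/7}"
    by (auto simp: d_def split: if_splits)
qed

text \<open>\<open>p\<close> names a target for each point. A distance bounded by 1 that can be
  doubled within \<open>X\<close> again and again must vanish.\<close>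

lemma doubling_contraction:
  fixes X :: "real set"
  assumes X: "\<And>x. x \<in> X \<Longrightarrow> \<bar>x - p x\<bar> \<le> 1" and inv: "\<And>x. x \<in> X \<Longrightarrow> \<exists>y\<in>X. \<bar>y - p y\<bar> = 2 * \<bar>x - p x\<bar>"
    and x: "x \<in> X"
  shows "x = p x"
proof -
  have "\<forall>x\<in>X. \<bar>x - p x\<bar> \<le> (1/2) ^ n" for n
  proof (induction n)
    case (Suc n)
    show ?case
    proof
      fix x assume "x \<in> X"
      then obtain y where "y \<in> X" "\<bar>y - p y\<bar> = 2 * \<bar>x - p x\<bar>"
        using inv by blast
      then show "\<bar>x - p x\<bar> \<le> (1/2) ^ Suc n"
        using Suc.IH by force
    qed
  qed (use X in auto)
  then have "\<bar>x - p x\<bar> \<le> 0"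
    using x by (intro LIMSEQ_le_const[OF LIMSEQ_power_zero[of "1/2"]]) auto
  then show ?thesis
    by simp
qed

context riemann_exterior
begin

section \<open>The critical diameter and the angles of 0 and of the two-cycle\<close>

lemma Phi_add_1 [simp]: "\<Phi> (t + 1) = \<Phi> t" and Phi_diff_1 [simp]: "\<Phi> (t - 1) = \<Phi> t"
  using Phi_add_int[of t 1] Phi_add_int[of t "-1"] by simp_all

lemma Phi_diff_half: "\<Phi> (t - 1/2) = - \<Phi> t"
  using Phi_add_half[of "t - 1/2"] by simp

text \<open>Halving with the inverse branch of \<open>Phi_half_eq\<close> takes \<open>2 * a\<close>
  to \<open>a\<close>, but \<open>2 * b - 1\<close> to \<open>b - 1/2\<close>. As the doubled angles
  land together, so do the halves, and the common landing point of \<open>a\<close> and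
  \<open>b\<close> equals its own negative.\<close>

lemma Phi_eq_opposite_sides:
  assumes a: "1/12 < a" "a < 7/12" and b: "7/12 < b" "b < 13/12" and eq: "\<Phi> a = \<Phi> b"
  shows "\<Phi> a = 0"
proof (cases "\<Phi> (2 * a) = \<i>")
  case True
  then show ?thesis by (simp add: Phi_double quad_def)
next
  case False
  have "\<Phi> (2 * a) = \<Phi> (2 * b - 1)"
    using eq by (simp add: Phi_double)
  then have "\<Phi> (2 * a / 2) = \<Phi> ((2 * b - 1) / 2)"
    using a b False by (intro Phi_half_eq) auto
  also have "(2 * b - 1) / 2 = b - 1/2"
    by simp
  finally have "\<Phi> a = - \<Phi> a"
    using eq by (simp add: Phi_diff_half)
  then show ?thesis by simp
qed

text \<open>The two points lie on opposite sides of the critical diameter. Doubling exchanges their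
  angles and doubles the distance to 1/3 and 2/3, so expansion leaves no other angle.\<close>

lemma Phi_eq_two_cycle:
  assumes "1/12 \<le> a" "a < 13/12"
  shows "(\<Phi> a = - 1 + \<i> \<longrightarrow> a = 1/3) \<and> (\<Phi> a = - \<i> \<longrightarrow> a = 2/3)"
proof -
  have third: "1/12 < a \<and> a < 7/12" if "1/12 \<le> a" "a < 13/12" "\<Phi> a = - 1 + \<i>" for a
  proof -
    have "\<Phi> a \<noteq> 0"
      using that by (auto simp: complex_eq_iff)
    then have "a \<noteq> 1/12" "a \<noteq> 7/12"
      using Phi_twelfth Phi_seven_twelfths by metis+
    moreover have "\<not> 7/12 < a"
      using Phi_eq_opposite_sides[of "1/3" a] that Phi_third by (auto simp: complex_eq_iff)
    ultimately show ?thesis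
      using that by auto
  qed
  have two: "7/12 < a \<and> a < 13/12" if "1/12 \<le> a" "a < 13/12" "\<Phi> a = - \<i>" for a
  proof -
    have "\<Phi> a \<noteq> 0"
      using that by (auto simp: complex_eq_iff)
    then have "a \<noteq> 1/12" "a \<noteq> 7/12"
      using Phi_twelfth Phi_seven_twelfths by metis+
    moreover have "\<not> a < 7/12" if "1/12 < a"
      using Phi_eq_opposite_sides[of a "2/3"] that \<open>\<Phi> a = - \<i>\<close> Phi_two_thirds by auto
    ultimately show ?thesis
      using that by auto
  qed
  define X where "X = {a. 1/12 \<le> a \<and> a < 13/12 \<and> \<Phi> a \<in> {- 1 + \<i>, - \<i>}}"
  define p where "p = (\<lambda>a. if \<Phi> a = - 1 + \<i> then 1/3 else 2/3::real)"
  have ne: "- 1 + \<i> \<noteq> - \<i>"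
    by (auto simp: complex_eq_iff)
  have "\<bar>a - p a\<bar> \<le> 1" if "a \<in> X" for a
    using that unfolding X_def p_def by (auto simp: abs_if)
  moreover have "\<exists>y\<in>X. \<bar>y - p y\<bar> = 2 * \<bar>a - p a\<bar>" if "a \<in> X" for a
  proof (cases "\<Phi> a = - 1 + \<i>")
    case True
    have a: "1/12 < a" "a < 7/12"
      using third that True by (auto simp: X_def)
    have *: "\<Phi> (2 * a) = - \<i>"
      unfolding Phi_double True by (simp add: quad_def power2_eq_square algebra_simps)
    moreover have "2 * a < 13/12"
    proof (rule ccontr)
      assume "\<not> ?thesis"
      then show False
        using two[of "2 * a - 1"] a * by simp
    qed
    ultimately have "2 * a \<in> X"
      using a by (auto simp: X_def)
    moreover have "\<bar>2 * a - p (2 * a)\<bar> = 2 * \<bar>a - p a\<bar>"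
      using True * ne by (simp add: p_def abs_if)
    ultimately show ?thesis by blast
  next
    case False
    then have Fa: "\<Phi> a = - \<i>"
      using that by (auto simp: X_def)
    have a: "7/12 < a" "a < 13/12"
      using two that Fa by (auto simp: X_def)
    have *: "\<Phi> (2 * a - 1) = - 1 + \<i>"
      unfolding Phi_diff_1 Phi_double Fa by (simp add: quad_def)
    moreover have "2 * a - 1 < 13/12"
    proof (rule ccontr)
      assume "\<not> ?thesis"
      \<comment> \<open>An overshoot makes \<open>2 * a - 2\<close> an angle of
        \<open>- 1 + \<i>\<close> below 1/6; its double, below 1/3, would be an angle of
        \<open>- \<i>\<close>, but those exceed 7/12.\<close>
      then have b: "1/12 \<le> 2 * (2 * a - 2)" "2 * (2 * a - 2) < 13/12"
        using a by auto
      have F2: "\<Phi> (2 * a - 2) = - 1 + \<i>"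
        using * Phi_diff_1[of "2 * a - 1"] by simp
      from F2 have "\<Phi> (2 * (2 * a - 2)) = quad (- 1 + \<i>)"
        by (simp only: Phi_double)
      also have "quad (- 1 + \<i>) = - \<i>"
        by (simp add: quad_def power2_eq_square algebra_simps)
      finally have "7/12 < 2 * (2 * a - 2)"
        using two[OF b] by blast
      then show False
        using a by auto
    qed
    ultimately have "2 * a - 1 \<in> X"
      using a by (auto simp: X_def)
    moreover have "\<bar>2 * a - 1 - p (2 * a - 1)\<bar> = 2 * \<bar>a - p a\<bar>"
      using Fa * ne by (simp add: p_def abs_if)
    ultimately show ?thesis by blast
  qed
  ultimately have "a = p a" if "a \<in> X"
    using doubling_contraction[of X p a] that by blast
  then have "\<Phi> a = - 1 + \<i> \<or> \<Phi> a = - \<i> \<Longrightarrow> a = p a"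
    using assms by (auto simp: X_def)
  then show ?thesis
    using ne unfolding p_def by (metis (full_types))
qed

text \<open>Two steps of \<open>quad\<close> take 0 to \<open>- 1 + \<i>\<close>, so
  \<open>4 * a\<close> is 1/3 modulo 1. Of the four solutions, 1/3 and 5/6 land at
  \<open>- 1 + \<i>\<close> and at its negative.\<close>

lemma Phi_eq_0:
  assumes a: "1/12 \<le> a" "a < 13/12" and 0: "\<Phi> a = 0"
  shows "a = 1/12 \<or> a = 7/12"
proof -
  have "\<Phi> (2 * (2 * a)) = - 1 + \<i>"
    unfolding Phi_double 0 by (simp add: quad_def)
  then have 4: "\<Phi> (4 * a) = - 1 + \<i>"
    by simp
  obtain k :: int where k: "1/12 \<le> 4 * a + k" "4 * a + k < 1/12 + 1"
    using ex_int_shift by blast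
  have "4 * a + k = 1/3"
    using Phi_eq_two_cycle[of "4 * a + k"] k 4 by simp
  then have "- 4 < real_of_int k" "real_of_int k < 1" and a_k: "a = (1/3 - k) / 4"
    using a by auto
  then have "- 4 < k" "k < 1"
    by linarith+
  then have "k = 0 \<or> k = -1 \<or> k = -2 \<or> k = -3"
    by presburger
  then have "a = 1/12 \<or> a = 1/3 \<or> a = 7/12 \<or> a = 5/6"
    using a_k by auto
  moreover have "\<Phi> (1/3) \<noteq> 0"
    unfolding Phi_third by (auto simp: complex_eq_iff)
  moreover have "\<Phi> (5/6) \<noteq> 0"
    using calculation(2) Phi_add_half[of "1/3"] by simp
  ultimately show ?thesis
    using 0 by metis
qed

lemma Phi_opposite_sides:
  assumes "1/12 < a" "a < 7/12" "7/12 < b" "b < 13/12"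
  shows "\<Phi> a \<noteq> \<Phi> b"
  using Phi_eq_opposite_sides[OF assms] Phi_eq_0[of a] assms by auto

lemma Phi_left:
  assumes a: "1/12 < a" "a < 7/12" and eq: "\<Phi> a = \<Phi> b"
  obtains k :: int where "1/12 < b + k" "b + k < 7/12"
proof -
  obtain k :: int where k: "1/12 \<le> b + k" "b + k < 1/12 + 1"
    using ex_int_shift by blast
  have "\<Phi> (b + k) \<noteq> 0"
    using Phi_eq_0[of a] a eq by auto
  then have "b + k \<noteq> 1/12" "b + k \<noteq> 7/12"
    using Phi_twelfth Phi_seven_twelfths by metis+
  moreover have "\<not> 7/12 < b + k"
    using Phi_opposite_sides[OF a, of "b + k"] k eq by auto
  ultimately show ?thesis
    using k by (intro that[of k]) linarith+
qed

text \<open>Injectivity of \<open>quad\<close> on one sheet, read on angles. Doubled angles that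
  land at \<open>\<i>\<close>, which the inverse branch omits, come from 0 only.\<close>

lemma Phi_double_left:
  assumes a: "1/12 \<le> a" "a \<le> 7/12" and b: "1/12 \<le> b" "b \<le> 7/12"
  shows "\<Phi> (2 * a) = \<Phi> (2 * b) \<longleftrightarrow> \<Phi> a = \<Phi> b"
proof
  assume eq: "\<Phi> (2 * a) = \<Phi> (2 * b)"
  show "\<Phi> a = \<Phi> b"
  proof (cases "\<Phi> (2 * a) = \<i>")
    case True
    then show ?thesis
      using eq by (simp add: Phi_double quad_def)
  next
    case False
    have "\<Phi> (7/6) = \<i>"
      using Phi_add_1[of "1/6"] Phi_sixth by simp
    then have "2 * a \<noteq> 1/6" "2 * a \<noteq> 7/6" "2 * b \<noteq> 1/6" "2 * b \<noteq> 7/6"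
      using False eq Phi_sixth by metis+
    then have "\<Phi> (2 * a / 2) = \<Phi> (2 * b / 2)"
      using a b eq False by (intro Phi_half_eq) auto
    then show ?thesis by simp
  qed
qed (simp add: Phi_double)

section \<open>The fixed point with three angles\<close>

definition \<beta> :: complex where
  "\<beta> = \<Phi> (1/7)"

lemma fixed_point_nonzero: "quad z = z \<Longrightarrow> z \<noteq> 0"
  by (auto simp: quad_def)

lemma fixed_point_angles_left:
  assumes z: "quad z = z" and a: "1/12 \<le> a" "a \<le> 7/12" "\<Phi> a = z"
  shows "a \<in> {1/7, 2/7, 4/7}"
proof -
  define X where "X = {a. 1/12 \<le> a \<and> a \<le> 7/12 \<and> \<Phi> a = z}"
  have "2 * a \<in> X \<or> 2 * a - 1 \<in> X" if "a \<in> X" for a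
  proof -
    have "\<Phi> a \<noteq> 0"
      using that fixed_point_nonzero[OF z] by (simp add: X_def)
    then have "a \<noteq> 1/12" "a \<noteq> 7/12"
      using Phi_twelfth Phi_seven_twelfths by metis+
    then have "1/12 < a" "a < 7/12"
      using that by (auto simp: X_def)
    moreover have "\<Phi> a = \<Phi> (2 * a)"
      using that z by (simp add: X_def Phi_double)
    ultimately obtain k :: int where k: "1/12 < 2 * a + k" "2 * a + k < 7/12"
      by (rule Phi_left)
    then have "- 2 < real_of_int k" "real_of_int k < 1"
      using \<open>1/12 < a\<close> \<open>a < 7/12\<close> by linarith+
    then have "k = 0 \<or> k = -1"
      by linarith
    then show ?thesis
      using k \<open>\<Phi> a = \<Phi> (2 * a)\<close> that by (auto simp: X_def)
  qed
  then have "X \<subseteq> {1/7, 2/7, 4/7}"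
    by (intro doubling_invariant_set) (auto simp: X_def)
  then show ?thesis
    using a by (auto simp: X_def)
qed

lemma fixed_point_angles_right:
  assumes z: "quad z = z" and a: "7/12 < a" "a < 13/12" "\<Phi> a = z"
  shows "a = 1"
proof -
  define X where "X = {a. 7/12 < a \<and> a < 13/12 \<and> \<Phi> a = z}"
  have "\<exists>y\<in>X. \<bar>y - 1\<bar> = 2 * \<bar>a - 1\<bar>" if "a \<in> X" for a
  proof
    have a: "7/12 < a" "a < 13/12" "\<Phi> a = z"
      using that by (auto simp: X_def)
    have *: "\<Phi> (2 * a - 1) = z"
      using a(3) z by (simp add: Phi_double)
    have "2 * a - 1 \<noteq> 7/12"
      using * fixed_point_nonzero[OF z] Phi_seven_twelfths by metis
    moreover have "\<not> 2 * a - 1 < 7/12"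
      using Phi_opposite_sides[of "2 * a - 1" a] a * by auto
    moreover have "2 * a - 1 \<noteq> 13/12"
    proof
      assume "2 * a - 1 = 13/12"
      then have "2 * a - 1 = 1/12 + 1" by simp
      then show False
        using * fixed_point_nonzero[OF z] Phi_twelfth Phi_add_1[of "1/12"] by metis
    qed
    moreover have "\<not> 13/12 < 2 * a - 1"
      using Phi_opposite_sides[of "2 * a - 1 - 1" a] a * Phi_diff_1[of "2 * a - 1"] by auto
    ultimately show "2 * a - 1 \<in> X"
      using * by (auto simp: X_def)
  qed (auto simp: abs_if)
  then show ?thesis
    using doubling_contraction[of X "\<lambda>_. 1" a] a by (auto simp: X_def abs_if)
qed

text \<open>The fixed points of \<open>quad\<close> are \<open>(1 + s) / 2\<close> and
  \<open>(1 - s) / 2\<close>, with \<open>s\<close> a root of the discriminant, and both lie in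
  \<open>D3\<close>. An angle of a fixed point belongs to the cycle of 1/7 or equals 1 modulo 1. As
  the two points differ, one of them has an angle in the cycle, and doubling spreads it over the
  whole cycle.\<close>

lemma Phi_sevenths: "\<Phi> (1/7) = \<beta>" "\<Phi> (2/7) = \<beta>" "\<Phi> (4/7) = \<beta>" and quad_beta: "quad \<beta> = \<beta>"
proof -
  define s where "s = csqrt (1 - 4 * \<i>)"
  have s: "s\<^sup>2 = 1 - 4 * \<i>"
    by (simp add: s_def)
  have fp: "quad ((1 + s) / 2) = (1 + s) / 2" "quad ((1 - s) / 2) = (1 - s) / 2"
  proof -
    have s': "s * s = 1 - 4 * \<i>"
      using s by (simp add: power2_eq_square)
    show "quad ((1 + s) / 2) = (1 + s) / 2" "quad ((1 - s) / 2) = (1 - s) / 2"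
      by (simp_all add: quad_def power2_eq_square field_simps s')
  qed
  have D3: "z \<in> D3" if "quad z = z" for z
  proof -
    have "(quad ^^ n) z = z" for n
      by (induction n) (auto simp: that)
    then show ?thesis
      by (simp add: D3_eq_filled filled_iff_bounded)
  qed
  have angle: "\<exists>a\<in>{1/7, 2/7, 4/7, 1}. z = \<Phi> a" if z: "quad z = z" for z
  proof -
    obtain a where a: "1/12 \<le> a" "a < 1/12 + 1" "z = \<Phi> a"
      using D3_Phi[OF D3[OF z]] by blast
    then show ?thesis
      using fixed_point_angles_left[OF z, of a] fixed_point_angles_right[OF z, of a]
      by (cases "a \<le> 7/12") (blast, force)
  qed
  have "(1 + s) / 2 \<noteq> (1 - s) / 2"
    using s by (auto simp: complex_eq_iff)
  then have "(1 + s) / 2 \<noteq> \<Phi> 1 \<or> (1 - s) / 2 \<noteq> \<Phi> 1"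
    by metis
  then obtain z where z: "quad z = z" "z = \<Phi> (1/7) \<or> z = \<Phi> (2/7) \<or> z = \<Phi> (4/7)"
    using angle[OF fp(1)] angle[OF fp(2)] fp by auto
  have "\<Phi> (2/7) = quad (\<Phi> (1/7))" "\<Phi> (4/7) = quad (\<Phi> (2/7))" "\<Phi> (1/7) = quad (\<Phi> (4/7))"
    using Phi_double[of "1/7"] Phi_double[of "2/7"] Phi_double[of "4/7"] Phi_add_1[of "1/7"] by auto
  then show "\<Phi> (1/7) = \<beta>" "\<Phi> (2/7) = \<beta>" "\<Phi> (4/7) = \<beta>" "quad \<beta> = \<beta>"
    using z unfolding \<beta>_def by metis+
qed

lemma beta_nonzero: "\<beta> \<noteq> 0"
  by (rule fixed_point_nonzero[OF quad_beta])

lemma Phi_eq_beta: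
  assumes "\<Phi> a = \<beta>"
  obtains k :: int where "a + k \<in> {1/7, 2/7, 4/7}"
proof -
  obtain k :: int where k: "1/12 < a + k" "a + k < 7/12"
    using Phi_left[of "1/7" a] assms Phi_sevenths by auto
  then show ?thesis
    using fixed_point_angles_left[OF quad_beta, of "a + k"] assms by (intro that[of k]) auto
qed

lemma Phi_eq_beta_window:
  assumes "\<Phi> a = \<beta>" "1/7 \<le> a" "a < 8/7"
  shows "a \<in> {1/7, 2/7, 4/7}"
proof -
  obtain k :: int where k: "a + k \<in> {1/7, 2/7, 4/7}"
    using Phi_eq_beta[OF assms(1)] .
  then have "k = 0"
    using assms(2,3) by (intro int_eq_0) auto
  then show ?thesis
    using k by simp
qed

text \<open>The open arc \<open>(u, v)\<close> of angles is a union of fibres of \<open>\<Phi>\<close>. If moreover \<open>\<Phi> u = \<Phi> v\<close>, its image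
  is a union of branches around that point.\<close>

definition sat :: "real \<Rightarrow> real \<Rightarrow> bool" where
  "sat u v \<longleftrightarrow> (\<forall>a b. u < a \<and> a < v \<and> \<Phi> a = \<Phi> b \<longrightarrow> (\<exists>k::int. u < b + k \<and> b + k < v))"

lemma satD:
  assumes "sat u v" "u < a" "a < v" "\<Phi> a = \<Phi> b"
  obtains k :: int where "u < b + k" "b + k < v"
  using assms unfolding sat_def by blast

section \<open>The three sectors of angles around the fixed point\<close>

definition sector :: "real \<Rightarrow> nat" where
  "sector a = (if a < 1/7 then 3 else if a < 2/7 then 1 else if a < 4/7 then 2 else 3)"

lemma sector_range: "sector a \<in> {1, 2, 3}"
  by (simp add: sector_def)

text \<open>Doubling moves the sectors cyclically. Only from sector 2 can the doubled angle leave
  the half \<open>[1/12, 7/12]\<close>; the hypothesis \<open>left\<close> brings it back by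
  requiring that its fibre meet the open half.\<close>

lemma sector_double:
  assumes a: "1/12 \<le> a" "a \<le> 7/12" and nb: "\<Phi> a \<noteq> \<beta>"
    and left: "sector a = 2 \<Longrightarrow> \<exists>y. 1/12 < y \<and> y < 7/12 \<and> \<Phi> y = \<Phi> (2 * a)"
  shows "\<exists>a'\<in>{2 * a, 2 * a - 1}. 1/12 \<le> a' \<and> a' \<le> 7/12 \<and> sector a' = sector a mod 3 + 1 \<and>
    (sector a \<noteq> 2 \<longrightarrow> 1/12 < a' \<and> a' < 7/12)"
proof -
  have ne: "a \<noteq> 1/7" "a \<noteq> 2/7" "a \<noteq> 4/7"
    using nb Phi_sevenths by metis+
  then consider "a < 1/7" | "1/7 < a" "a < 2/7" | "2/7 < a" "a < 4/7" | "4/7 < a"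
    by linarith
  then show ?thesis
  proof cases
    case 1
    then show ?thesis using a by (auto simp: sector_def)
  next
    case 2
    then show ?thesis using a by (auto simp: sector_def)
  next
    case 3
    then have s: "sector a = 2"
      by (simp add: sector_def)
    then obtain y where y: "1/12 < y" "y < 7/12" "\<Phi> y = \<Phi> (2 * a)"
      using left by blast
    then obtain k :: int where k: "1/12 < 2 * a + k" "2 * a + k < 7/12"
      by (rule Phi_left)
    then have "k = 0 \<or> k = -1"
      using 3 by linarith
    then show ?thesis
      using 3 k s by (auto simp: sector_def)
  next
    case 4
    then show ?thesis using a by (auto simp: sector_def)
  qed
qed

text \<open>The angles in this half whose fibre meets two sectors form a set that doubling preserves
  modulo 1. Such a set is contained in the cycle of 1/7, which lands at
  \<open>\<beta>\<close>.\<close>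

lemma sector_eq:
  assumes a: "1/12 \<le> a" "a \<le> 7/12" and b: "1/12 \<le> b" "b \<le> 7/12"
    and eq: "\<Phi> a = \<Phi> b" and nb: "\<Phi> a \<noteq> \<beta>"
  shows "sector a = sector b"
proof (rule ccontr)
  assume ne: "sector a \<noteq> sector b"
  define X where "X = {a. 1/12 \<le> a \<and> a \<le> 7/12 \<and> \<Phi> a \<noteq> \<beta> \<and>
    (\<exists>b. 1/12 \<le> b \<and> b \<le> 7/12 \<and> \<Phi> a = \<Phi> b \<and> sector a \<noteq> sector b)}"
  have "2 * a \<in> X \<or> 2 * a - 1 \<in> X" if aX: "a \<in> X" for a
  proof -
    obtain b where a: "1/12 \<le> a" "a \<le> 7/12" "\<Phi> a \<noteq> \<beta>" and b: "1/12 \<le> b" "b \<le> 7/12"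
      and eq: "\<Phi> a = \<Phi> b" and ne: "sector a \<noteq> sector b"
      using aX by (auto simp: X_def)
    have 2: "\<Phi> (2 * a) = \<Phi> (2 * b)"
      using eq by (simp add: Phi_double)
    \<comment> \<open>At least one of \<open>a\<close> and \<open>b\<close> is outside sector 2. It
      doubles into the open half and so provides the hypothesis \<open>left\<close> for
      both.\<close>
    have "\<exists>y. 1/12 < y \<and> y < 7/12 \<and> \<Phi> y = \<Phi> (2 * a)"
    proof (cases "sector a = 2")
      case True
      then show ?thesis
        using sector_double[OF b] a eq ne 2 by (metis Phi_diff_1 insert_iff singletonD)
    next
      case False
      then show ?thesis
        using sector_double[OF a] by (metis Phi_diff_1 insert_iff singletonD)
    qed
    then obtain a' b' where a': "a' \<in> {2 * a, 2 * a - 1}" "1/12 \<le> a'" "a' \<le> 7/12"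
        "sector a' = sector a mod 3 + 1"
      and b': "b' \<in> {2 * b, 2 * b - 1}" "1/12 \<le> b'" "b' \<le> 7/12" "sector b' = sector b mod 3 + 1"
      using sector_double[OF a] sector_double[OF b] a(3) eq 2 by metis
    have "\<Phi> a' = \<Phi> (2 * a)" "\<Phi> b' = \<Phi> (2 * b)"
      using a'(1) b'(1) by auto
    moreover have "sector a' \<noteq> sector b'"
      using ne a'(4) b'(4) sector_range[of a] sector_range[of b] by auto
    \<comment> \<open>The other preimage of \<open>\<beta>\<close> is \<open>- \<beta>\<close>,
      which has the angle 9/14 on the opposite side of the critical diameter.\<close>
    moreover have "\<Phi> (2 * a) \<noteq> \<beta>"
    proof
      assume "\<Phi> (2 * a) = \<beta>"
      then have "\<Phi> a = - \<beta>"
        using a(3) quad_eq_iff[of "\<Phi> a" \<beta>] by (simp add: Phi_double quad_beta)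
      then have *: "\<Phi> a = \<Phi> (9/14)"
        using Phi_add_half[of "1/7"] Phi_sevenths(1) by simp
      have "\<Phi> a \<noteq> 0"
        using \<open>\<Phi> a = - \<beta>\<close> beta_nonzero by simp
      then have "a \<noteq> 1/12" "a \<noteq> 7/12"
        using Phi_twelfth Phi_seven_twelfths by metis+
      then show False
        using Phi_opposite_sides[of a "9/14"] * a by auto
    qed
    ultimately have "a' \<in> X"
      using a' b' 2 by (auto simp: X_def)
    then show ?thesis
      using a'(1) by auto
  qed
  then have "X \<subseteq> {1/7, 2/7, 4/7}"
    by (intro doubling_invariant_set) (auto simp: X_def)
  moreover have "a \<in> X"
    using a b eq nb ne by (auto simp: X_def)
  ultimately show False
    using nb Phi_sevenths by auto
qed

lemma sat_sector_left:
  assumes "u = 1/7 \<and> v = 2/7 \<or> u = 2/7 \<and> v = 4/7"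
  shows "sat u v"
  unfolding sat_def
proof (intro allI impI, elim conjE)
  fix a b assume a: "u < a" "a < v" and eq: "\<Phi> a = \<Phi> b"
  have nb: "\<Phi> a \<noteq> \<beta>"
    using Phi_eq_beta_window[of a] a assms by auto
  have "1/12 < a" "a < 7/12"
    using a assms by auto
  then obtain k :: int where k: "1/12 < b + k" "b + k < 7/12"
    using Phi_left eq by blast
  have s: "sector a = sector (b + k)"
    using \<open>1/12 < a\<close> \<open>a < 7/12\<close> k eq nb by (intro sector_eq) auto
  have "b + k \<noteq> 1/7" "b + k \<noteq> 2/7"
    using nb eq Phi_sevenths Phi_add_int[of b k] by metis+
  then have "u < b + k \<and> b + k < v"
    using s a assms by (auto simp: sector_def split: if_splits)
  then show "\<exists>k::int. u < b + k \<and> b + k < v" ..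
qed

text \<open>The third sector is what the other two and the fibre of \<open>\<beta>\<close> leave
  over, and so it inherits saturation.\<close>

lemma sat_sectors: "sat (1/7) (2/7)" "sat (2/7) (4/7)" "sat (4/7) (8/7)"
proof -
  show 12: "sat (1/7) (2/7)" "sat (2/7) (4/7)"
    using sat_sector_left by auto
  show "sat (4/7) (8/7)"
    unfolding sat_def
  proof (intro allI impI, elim conjE)
    fix a b assume a: "4/7 < a" "a < 8/7" and eq: "\<Phi> a = \<Phi> b"
    obtain k :: int where k: "1/7 \<le> b + k" "b + k < 1/7 + 1"
      using ex_int_shift by blast
    have nb: "\<Phi> a \<noteq> \<beta>"
      using Phi_eq_beta_window[of a] a by auto
    then have "b + k \<noteq> 1/7" "b + k \<noteq> 2/7" "b + k \<noteq> 4/7"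
      using eq Phi_sevenths Phi_add_int[of b k] by metis+
    moreover have "\<not> (1/7 < b + k \<and> b + k < 2/7)"
    proof
      assume "1/7 < b + k \<and> b + k < 2/7"
      then obtain j :: int where j: "1/7 < a + j" "a + j < 2/7"
        using satD[OF 12(1), of "b + k" a] eq by auto
      then have "- 1 < real_of_int j" "real_of_int j < 0"
        using a by linarith+
      then show False
        by (rule no_int)
    qed
    moreover have "\<not> (2/7 < b + k \<and> b + k < 4/7)"
    proof
      assume "2/7 < b + k \<and> b + k < 4/7"
      then obtain j :: int where j: "2/7 < a + j" "a + j < 4/7"
        using satD[OF 12(2), of "b + k" a] eq by auto
      then have "- 1 < real_of_int j" "real_of_int j < 0"
        using a by linarith+
      then show False
        by (rule no_int)
    qed
    ultimately show "\<exists>k::int. 4/7 < b + k \<and> b + k < 8/7"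
      using k by (intro exI[of _ k]) auto
  qed
qed

end

section \<open>Branch points and their branches\<close>

lemma not_int_shift: "p < q \<Longrightarrow> q < p + 1 \<Longrightarrow> p \<noteq> q + real_of_int k"
  using no_int[of k] by auto

context riemann_exterior
begin

section \<open>Saturated arcs under integer shifts, the half turn and halving\<close>

lemma sat_add_int:
  assumes "sat u v"
  shows "sat (u + of_int j) (v + of_int j)"
  unfolding sat_def
proof (intro allI impI, elim conjE)
  fix a b assume "u + of_int j < a" "a < v + of_int j" "\<Phi> a = \<Phi> b"
  then have "u < a + of_int (- j)" "a + of_int (- j) < v" "\<Phi> (a + of_int (- j)) = \<Phi> b"
    by (simp_all only: Phi_add_int)
  then obtain k :: int where "u < b + k" "b + k < v"
    by (rule satD[OF assms])
  then show "\<exists>k::int. u + of_int j < b + k \<and> b + k < v + of_int j"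
    by (intro exI[of _ "k + j"]) auto
qed

lemma sat_add_half:
  assumes "sat u v"
  shows "sat (u + 1/2) (v + 1/2)"
  unfolding sat_def
proof (intro allI impI, elim conjE)
  fix a b assume "u + 1/2 < a" "a < v + 1/2" "\<Phi> a = \<Phi> b"
  then have "u < a - 1/2" "a - 1/2 < v" "\<Phi> (a - 1/2) = \<Phi> (b - 1/2)"
    by (simp_all add: Phi_diff_half)
  then obtain k :: int where "u < b - 1/2 + k" "b - 1/2 + k < v"
    by (rule satD[OF assms])
  then show "\<exists>k::int. u + 1/2 < b + k \<and> b + k < v + 1/2"
    by (intro exI[of _ k]) auto
qed

text \<open>The fibre of an angle in the open left half has its representatives in that half, and
  there doubling is injective modulo 1; so saturation of the doubled arc descends.\<close>

lemma sat_halve: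
  assumes "sat (2 * u) (2 * v)" "1/12 \<le> u" "v \<le> 7/12"
  shows "sat u v"
  unfolding sat_def
proof (intro allI impI, elim conjE)
  fix a b assume a: "u < a" "a < v" and eq: "\<Phi> a = \<Phi> b"
  obtain k :: int where k: "1/12 < b + k" "b + k < 7/12"
    using Phi_left[of a b] a assms eq by auto
  have "\<Phi> (2 * a) = \<Phi> (2 * (b + k))"
    unfolding Phi_double using eq by simp
  then obtain j :: int where j: "2 * u < 2 * (b + k) + j" "2 * (b + k) + j < 2 * v"
    using satD[OF assms(1), of "2 * a" "2 * (b + k)"] a by auto
  have "j = 0"
    using j k assms by (intro int_eq_0) (auto simp: distrib_left)
  then show "\<exists>k::int. u < b + k \<and> b + k < v"
    using j by (intro exI[of _ k]) auto
qed

lemma sat_disjoint: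
  assumes "sat u v" "u < a" "a < v" "v \<le> b" "b \<le> u + 1"
  shows "\<Phi> a \<noteq> \<Phi> b"
proof
  assume "\<Phi> a = \<Phi> b"
  then obtain k :: int where "u < b + k" "b + k < v"
    using satD[OF assms(1-3)] by blast
  then have "- 1 < real_of_int k" "real_of_int k < 0"
    using assms by linarith+
  then show False by (rule no_int)
qed

text \<open>Lifts of the angles of a branch point in positive order; the third arc wraps around and
  ends at \<open>x1 + 1\<close>. Saturation ensures that there are no further angles and that the
  images of the three arcs are the branches, so a triple also records the cyclic orientation at
  \<open>x\<close>.\<close>

definition tri :: "real \<Rightarrow> real \<Rightarrow> real \<Rightarrow> complex \<Rightarrow> bool" where
  "tri x1 x2 x3 x \<longleftrightarrow> x1 < x2 \<and> x2 < x3 \<and> x3 < x1 + 1 \<and> \<Phi> x1 = x \<and> \<Phi> x2 = x \<and> \<Phi> x3 = x \<and>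
     sat x1 x2 \<and> sat x2 x3 \<and> sat x3 (x1 + 1)"

lemma tri_beta: "tri (1/7) (2/7) (4/7) \<beta>"
  using sat_sectors Phi_sevenths by (simp add: tri_def)

lemma tri_rotate: "tri x1 x2 x3 x \<Longrightarrow> tri x2 x3 (x1 + 1) x"
  using sat_add_int[of x1 x2 1] by (simp add: tri_def)

lemma tri_add_int: "tri x1 x2 x3 x \<Longrightarrow> tri (x1 + of_int k) (x2 + of_int k) (x3 + of_int k) x"
  using sat_add_int[of x1 x2 k] sat_add_int[of x2 x3 k] sat_add_int[of x3 "x1 + 1" k]
  by (simp add: tri_def ac_simps)

lemma tri_minus: "tri x1 x2 x3 x \<Longrightarrow> tri (x1 + 1/2) (x2 + 1/2) (x3 + 1/2) (- x)"
  using sat_add_half[of x1 x2] sat_add_half[of x2 x3] sat_add_half[of x3 "x1 + 1"]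
  by (simp add: tri_def Phi_add_half ac_simps)

lemma tri_in_D3: "tri x1 x2 x3 x \<Longrightarrow> x \<in> D3"
  unfolding tri_def by auto

lemma tri_fibre:
  assumes "tri x1 x2 x3 x" "\<Phi> a = x" "x1 \<le> a" "a < x1 + 1"
  shows "a = x1 \<or> a = x2 \<or> a = x3"
proof -
  have "\<not> (x1 < a \<and> a < x2)" "\<not> (x2 < a \<and> a < x3)" "\<not> (x3 < a \<and> a < x1 + 1)"
    using assms sat_disjoint[of x1 x2 a x2] sat_disjoint[of x2 x3 a x3] sat_disjoint[of x3 "x1 + 1" a "x1 + 1"]
    by (auto simp: tri_def)
  then show ?thesis
    using assms(3,4) by linarith
qed

lemma tri_start:
  assumes "tri x1 x2 x3 x" "\<Phi> a = x"
  obtains y2 y3 where "tri a y2 y3 x"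
proof -
  obtain k :: int where k: "x1 \<le> a + k" "a + k < x1 + 1"
    using ex_int_shift by blast
  have "a + k = x1 \<or> a + k = x2 \<or> a + k = x3"
    using tri_fibre[OF assms(1), of "a + k"] k assms(2) by simp
  then obtain y2 y3 where "tri (a + k) y2 y3 x"
    using assms(1) tri_rotate by metis
  from tri_add_int[OF this, of "- k"] show ?thesis
    by (intro that[of "y2 + of_int (- k)" "y3 + of_int (- k)"]) simp
qed

lemma tri_window:
  assumes "tri x1 x2 x3 x" "\<Phi> a \<noteq> x"
  obtains y1 y2 y3 where "tri y1 y2 y3 x" "a < y1" "y3 < a + 1"
proof -
  obtain k :: int where k: "a \<le> x1 + k" "x1 + k < a + 1"
    using ex_int_shift by blast
  define z1 z2 z3 where "z1 = x1 + k" and "z2 = x2 + k" and "z3 = x3 + k"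
  have z: "tri z1 z2 z3 x"
    unfolding z1_def z2_def z3_def by (rule tri_add_int[OF assms(1)])
  have z1: "a \<le> z1" "z1 < a + 1"
    using k by (auto simp: z1_def)
  have r1: "tri (z3 - 1) z1 z2 x"
    using tri_add_int[OF tri_rotate[OF tri_rotate[OF z]], of "-1"] by simp
  then have r2: "tri (z2 - 1) (z3 - 1) z1 x"
    using tri_add_int[OF tri_rotate[OF tri_rotate[OF r1]], of "-1"] by simp
  have ne: "a \<noteq> z1" "a \<noteq> z2 - 1" "a \<noteq> z3 - 1"
    using z assms(2) Phi_diff_1 unfolding tri_def by metis+
  have o: "z1 < z2" "z2 < z3" "z3 < z1 + 1"
    using z by (auto simp: tri_def)
  consider "z3 < a + 1" | "a + 1 \<le> z3" "z2 < a + 1" | "a + 1 \<le> z2"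
    by linarith
  then show ?thesis
  proof cases
    case 1 show ?thesis by (rule that[OF z]) (use 1 ne z1 in linarith)+
  next
    case 2 show ?thesis by (rule that[OF r1]) (use 2 ne z1 in linarith)+
  next
    case 3 show ?thesis by (rule that[OF r2]) (use 3 ne z1 in linarith)+
  qed
qed

text \<open>As \<open>quad x\<close> is not \<open>\<i>\<close>, its angles fit strictly between 1/6
  and 7/6, and their halves lie on one side of the critical diameter. There they land at a single
  preimage of \<open>quad x\<close>; the half turn treats the other preimage.\<close>

lemma tri_pull_back:
  assumes y: "tri y1 y2 y3 (quad x)" and ni: "quad x \<noteq> \<i>"
  shows "\<exists>x1 x2 x3. tri x1 x2 x3 x"
proof -
  obtain z1 z2 z3 where z: "tri z1 z2 z3 (quad x)" and w: "1/6 < z1" "z3 < 7/6"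
    using tri_window[OF y, of "1/6"] ni Phi_sixth by auto
  have o: "z1 < z2" "z2 < z3" "z3 < z1 + 1" and Fz: "\<Phi> z1 = quad x" "\<Phi> z2 = quad x" "\<Phi> z3 = quad x"
    and s: "sat z1 z2" "sat z2 z3"
    using z by (auto simp: tri_def)
  define u1 u2 u3 where "u1 = z1 / 2" and "u2 = z2 / 2" and "u3 = z3 / 2"
  have u: "1/12 < u1" "u1 < u2" "u2 < u3" "u3 < 7/12" "2 * u1 = z1" "2 * u2 = z2" "2 * u3 = z3"
    using o w by (auto simp: u1_def u2_def u3_def)
  define x' where "x' = \<Phi> u1"
  have F: "\<Phi> u1 = x'" "\<Phi> u2 = x'" "\<Phi> u3 = x'"
    using Phi_double_left[of u1 u2] Phi_double_left[of u1 u3] u Fz by (auto simp: x'_def)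
  have s12: "sat u1 u2" "sat u2 u3"
    using s u by (auto intro: sat_halve)
  \<comment> \<open>This arc is not contained in one half, so halving does not apply. A partner of
    \<open>a\<close> outside the arc would lie in an inner arc, against its saturation, or land at
    \<open>x'\<close>; but doubling an angle of \<open>x'\<close> gives one of \<open>z1\<close>,
    \<open>z2\<close>, \<open>z3\<close> modulo 1, so \<open>a\<close> would be \<open>u1\<close>,
    \<open>u2\<close> or \<open>u3\<close> modulo 1.\<close>
  have "sat u3 (u1 + 1)"
    unfolding sat_def
  proof (intro allI impI, elim conjE)
    fix a b assume a: "u3 < a" "a < u1 + 1" and eq: "\<Phi> a = \<Phi> b"
    obtain k :: int where k: "u1 \<le> b + k" "b + k < u1 + 1"
      using ex_int_shift by blast
    have "u3 < b + k"
    proof (rule ccontr)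
      assume "\<not> u3 < b + k"
      then consider "\<Phi> (b + k) = x'" | "u1 < b + k" "b + k < u2" | "u2 < b + k" "b + k < u3"
        using k F by (cases "b + k = u1"; cases "b + k = u2"; cases "b + k = u3"; force)
      then show False
      proof cases
        case 1
        then have "\<Phi> u1 = \<Phi> a"
          using eq F by simp
        then obtain j :: int where j: "1/12 < a + j" "a + j < 7/12"
          using Phi_left[of u1 a] u by auto
        have *: "\<Phi> (2 * (a + j)) = quad x"
          unfolding Phi_double using \<open>\<Phi> u1 = \<Phi> a\<close> Phi_double[of u1] u Fz by simp
        obtain m :: int where m: "z1 \<le> 2 * (a + j) + m" "2 * (a + j) + m < z1 + 1"
          using ex_int_shift by blast
        have "2 * (a + j) + m \<in> {z1, z2, z3}"
          using tri_fibre[OF z, of "2 * (a + j) + m"] m * by auto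
        moreover from this have "m = 0"
          using j w o by (intro int_eq_0) auto
        ultimately have "a + j \<in> {u1, u2, u3}"
          using u by auto
        then have "- 1 < real_of_int j" "real_of_int j < 0"
          using a u by auto
        then show False by (rule no_int)
      next
        case 2
        then show False
          using sat_disjoint[OF s12(1), of "b + k" a] eq a u by simp
      next
        case 3
        then show False
          using sat_disjoint[OF s12(2), of "b + k" a] eq a u by simp
      qed
    qed
    then show "\<exists>k::int. u3 < b + k \<and> b + k < u1 + 1"
      using k by blast
  qed
  then have t: "tri u1 u2 u3 x'"
    using F s12 u w o by (auto simp: tri_def u1_def u3_def)
  have "quad x' = quad x"
    unfolding x'_def using Phi_double[of u1] u Fz by simp
  then have "x = x' \<or> x = - x'"
    by (auto simp: quad_eq_iff)
  then show ?thesis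
    using t tri_minus[OF t] by blast
qed

lemma critical_orbit: "(quad ^^ n) \<i> \<in> {\<i>, - 1 + \<i>, - \<i>}"
proof (induction n)
  case (Suc n)
  have "quad \<i> = - 1 + \<i>" "quad (- 1 + \<i>) = - \<i>" "quad (- \<i>) = - 1 + \<i>"
    by (simp_all add: quad_def power2_eq_square algebra_simps)
  then show ?case
    using Suc by auto
qed simp

text \<open>The critical value is caught by the two-cycle. Hence pulling triples back along an orbit
  that ends at \<open>\<beta>\<close> never meets the excluded case
  \<open>quad x = \<i>\<close>.\<close>

lemma critical_orbit_beta: "(quad ^^ n) \<i> \<noteq> \<beta>"
proof
  assume "(quad ^^ n) \<i> = \<beta>"
  then have "\<beta> \<in> {\<i>, - 1 + \<i>, - \<i>}"
    using critical_orbit[of n] by simp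
  then show False
    using quad_beta by (auto simp: quad_def power2_eq_square complex_eq_iff)
qed

lemma tri_of_orbit:
  assumes "(quad ^^ n) x = \<beta>"
  shows "\<exists>x1 x2 x3. tri x1 x2 x3 x"
  using assms
proof (induction n arbitrary: x)
  case 0
  then show ?case using tri_beta by auto
next
  case (Suc n)
  then have n: "(quad ^^ n) (quad x) = \<beta>"
    by (simp add: funpow_swap1)
  then have "quad x \<noteq> \<i>"
    using critical_orbit_beta by auto
  then show ?case
    using Suc.IH[OF n] tri_pull_back by blast
qed

section \<open>Points with three angles reach the fixed point\<close>

definition three :: "complex \<Rightarrow> bool" where
  "three x \<longleftrightarrow> (\<exists>a b c. \<Phi> a = x \<and> \<Phi> b = x \<and> \<Phi> c = x \<and>
     (\<forall>k::int. a \<noteq> b + k \<and> b \<noteq> c + k \<and> a \<noteq> c + k))"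

text \<open>Distinct angles merge under doubling only if they differ by 1/2 modulo 1, and then they
  land at opposite points; a common landing point would be 0.\<close>

lemma three_quad:
  assumes "three x" "x \<noteq> 0"
  shows "three (quad x)"
proof -
  obtain a b c where x: "\<Phi> a = x" "\<Phi> b = x" "\<Phi> c = x"
    and ne: "\<And>k::int. a \<noteq> b + k" "\<And>k::int. b \<noteq> c + k" "\<And>k::int. a \<noteq> c + k"
    using assms(1) by (auto simp: three_def)
  have *: "2 * s \<noteq> 2 * t + k" if "\<Phi> s = x" "\<Phi> t = x" "\<And>k::int. s \<noteq> t + k" for s t and k :: int
  proof
    assume eq: "2 * s = 2 * t + k"
    show False
    proof (cases "even k")
      case True
      then obtain m where "k = 2 * m" by blast
      then show False
        using eq that(3)[of m] by simp
    next
      case False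
      then obtain m where "k = 2 * m + 1" by (auto elim: oddE)
      then have "s = t + 1/2 + m"
        using eq by simp
      then have "x = - x"
        using that(1,2) Phi_add_half[of t] by simp
      then show False
        using assms(2) by simp
    qed
  qed
  show ?thesis
    unfolding three_def
    by (intro exI[of _ "2 * a"] exI[of _ "2 * b"] exI[of _ "2 * c"]) (auto simp: Phi_double x * ne)
qed

lemma not_three_0: "\<not> three 0"
proof
  assume "three 0"
  then obtain a b c where x: "\<Phi> a = 0" "\<Phi> b = 0" "\<Phi> c = 0"
    and ne: "\<And>k::int. a \<noteq> b + k" "\<And>k::int. b \<noteq> c + k" "\<And>k::int. a \<noteq> c + k"
    by (auto simp: three_def)
  have rep: "\<exists>k::int. t = 1/12 + k \<or> t = 7/12 + k" if "\<Phi> t = 0" for t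
  proof -
    obtain k :: int where k: "1/12 \<le> t + k" "t + k < 1/12 + 1"
      using ex_int_shift by blast
    then have "t + k = 1/12 \<or> t + k = 7/12"
      using Phi_eq_0[of "t + k"] that by auto
    then show ?thesis
      by (intro exI[of _ "- k"]) auto
  qed
  obtain i j k :: int where "a = 1/12 + i \<or> a = 7/12 + i" "b = 1/12 + j \<or> b = 7/12 + j"
    "c = 1/12 + k \<or> c = 7/12 + k"
    using rep x by metis
  moreover have "a \<noteq> b + of_int (i - j)" "b \<noteq> c + of_int (j - k)" "a \<noteq> c + of_int (i - k)"
    using ne by blast+
  ultimately show False
    by auto
qed

lemma three_orbit: "three x \<Longrightarrow> three ((quad ^^ n) x)"
proof (induction n)
  case (Suc n)
  then show ?case
    using three_quad[of "(quad ^^ n) x"] not_three_0 by (cases "(quad ^^ n) x = 0") auto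
qed simp

text \<open>The angle 2/3 lands at \<open>- \<i>\<close>, the third iterate of 0. Multiplication by
  8 sends both angles 7/12 and 13/12 of 0 to it modulo 1, so after expansion the side of 2/3 tells
  from which of the two arcs of a cell an angle came.\<close>

definition close :: "nat \<Rightarrow> real \<Rightarrow> real \<Rightarrow> bool" where
  "close n a b \<longleftrightarrow> (a \<le> 2/3 \<and> b \<le> 2/3 \<or> 2/3 \<le> a \<and> 2/3 \<le> b) \<and> \<bar>a - b\<bar> \<le> (1/2) ^ n"

lemma Phi_minus_beta: "\<Phi> (9/14) = - \<beta>" "\<Phi> (11/14) = - \<beta>" "\<Phi> (15/14) = - \<beta>"
  using Phi_add_half[of "1/7"] Phi_add_half[of "2/7"] Phi_add_half[of "4/7"] Phi_sevenths by simp_all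

lemma sat_minus_sectors: "sat (9/14) (11/14)" "sat (11/14) (15/14)"
  using sat_add_half[OF sat_sectors(1)] sat_add_half[OF sat_sectors(2)] by simp_all

lemma Phi_thirteen_twelfths: "\<Phi> (13/12) = 0"
  using Phi_add_1[of "1/12"] Phi_twelfth by simp

text \<open>The branch \<open>\<Phi> (4/7, 8/7)\<close> is cut by the points \<open>- \<beta>\<close> and \<open>0\<close> into four cells, each of which
  is mapped homeomorphically onto the whole branch by an iterate of \<open>quad\<close>. On angles this
  iterate is the map below; it expands, and it preserves the relation of being on
  the same side of \<open>2/3\<close>.\<close>

lemma cell_expansion:
  assumes x: "x \<noteq> - \<beta>" "x \<noteq> 0"
  obtains m j where
    "\<And>a. 4/7 < a \<Longrightarrow> a < 8/7 \<Longrightarrow> \<Phi> a = x \<Longrightarrow> 4/7 < m a \<and> m a < 8/7 \<and> \<Phi> (m a) = (quad ^^ j) x"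
    "\<And>a b n. 4/7 < a \<Longrightarrow> a < 8/7 \<Longrightarrow> \<Phi> a = x \<Longrightarrow> 4/7 < b \<Longrightarrow> b < 8/7 \<Longrightarrow> \<Phi> b = x \<Longrightarrow>
      close n (m a) (m b) \<Longrightarrow> close (Suc n) a b"
proof -
  have ne: "a \<noteq> 9/14" "a \<noteq> 11/14" "a \<noteq> 15/14" "a \<noteq> 7/12" "a \<noteq> 13/12" if "\<Phi> a = x" for a
    using that x Phi_minus_beta Phi_seven_twelfths Phi_thirteen_twelfths by metis+
  have same: "u < b \<and> b < v" if s: "sat u v" and a: "u < a" "a < v" and F: "\<Phi> a = x" "\<Phi> b = x"
    and b: "4/7 < b" "b < 8/7" and uv: "4/7 \<le> u" "v \<le> 8/7" for u v a b
  proof -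
    obtain k :: int where k: "u < b + k" "b + k < v"
      using satD[OF s a, of b] F by auto
    then have "k = 0"
      using b uv by (intro int_eq_0) linarith+
    then show ?thesis
      using k by simp
  qed
  consider a where "\<Phi> a = x" "9/14 < a" "a < 11/14" | a where "\<Phi> a = x" "11/14 < a" "a < 15/14"
    | "\<And>a. 4/7 < a \<Longrightarrow> a < 8/7 \<Longrightarrow> \<Phi> a = x \<Longrightarrow> a < 9/14 \<or> 15/14 < a"
    using ne by (metis linorder_neqE_linordered_idom)
  then show ?thesis
  proof cases
    case (1 a)
    have "9/14 < b \<and> b < 11/14" if "4/7 < b" "b < 8/7" "\<Phi> b = x" for b
      using same[OF sat_minus_sectors(1) 1(2,3,1)] that by auto
    moreover have "\<Phi> (4 * b - 2) = (quad ^^ 2) x" if "\<Phi> b = x" for b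
      using that Phi_double[of b] Phi_double[of "2 * b"] Phi_add_int[of "4 * b" "-2"]
      by (simp add: numeral_2_eq_2)
    ultimately show ?thesis
      by (intro that[of "\<lambda>b. 4 * b - 2" 2]) (fastforce, auto simp: close_def abs_if)
  next
    case (2 a)
    have "11/14 < b \<and> b < 15/14" if "4/7 < b" "b < 8/7" "\<Phi> b = x" for b
      using same[OF sat_minus_sectors(2) 2(2,3,1)] that by auto
    moreover have "\<Phi> (2 * b - 1) = (quad ^^ 1) x" if "\<Phi> b = x" for b
      using that Phi_double[of b] by simp
    ultimately show ?thesis
      by (intro that[of "\<lambda>b. 2 * b - 1" 1]) (fastforce, fastforce simp: close_def abs_if)
  next
    case 3
    \<comment> \<open>The two remaining cells consist of an arc near 4/7 and an arc near 8/7 each.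
      Multiplication by 8 is reduced by 4 or by 8 so that the images fall between 4/7 and
      8/7.\<close>
    define m where "m = (\<lambda>b::real. if b < 9/14 then 8 * b - 4 else 8 * b - 8)"
    have opp: "\<Phi> s \<noteq> \<Phi> t" if "s < 7/12 \<or> 13/12 < s" "7/12 < t" "t < 13/12" "4/7 < s" "s < 8/7" for s t
      using that Phi_opposite_sides[of s t] Phi_opposite_sides[of "s - 1" t] by auto
    have "\<Phi> (8 * b) = (quad ^^ 3) x" if "\<Phi> b = x" for b
      using that Phi_double[of b] Phi_double[of "2 * b"] Phi_double[of "4 * b"]
      by (simp add: numeral_3_eq_3)
    then have "\<Phi> (m b) = (quad ^^ 3) x" if "\<Phi> b = x" for b
      using that Phi_add_int[of "8 * b" "-4"] Phi_add_int[of "8 * b" "-8"] by (simp add: m_def)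
    moreover have "4/7 < m b \<and> m b < 8/7" if "4/7 < b" "b < 8/7" "\<Phi> b = x" for b
      using 3[OF that] that by (auto simp: m_def)
    moreover have "close (Suc n) a b" if a: "4/7 < a" "a < 8/7" "\<Phi> a = x"
      and b: "4/7 < b" "b < 8/7" "\<Phi> b = x" and cl: "close n (m a) (m b)" for a b n
    proof -
      have imp: "t < 7/12 \<or> 13/12 < t" if s: "s < 7/12 \<or> 13/12 < s" "4/7 < s" "s < 8/7" "\<Phi> s = x"
        and t: "\<Phi> t = x" for s t
      proof (rule ccontr)
        assume "\<not> ?thesis"
        then have "7/12 < t" "t < 13/12"
          using ne(4,5)[OF t] by linarith+
        from opp[OF s(1) this s(2,3)] show False
          using s(4) t by simp
      qed
      \<comment> \<open>The critical diameter puts all angles of \<open>x\<close> into the same one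
        of the two cells.\<close>
      have *: "(a < 7/12 \<or> 13/12 < a) \<longleftrightarrow> (b < 7/12 \<or> 13/12 < b)"
        using imp[of a b] imp[of b a] a b by blast
      \<comment> \<open>Within one cell, the side of 2/3 on which \<open>m a\<close> lies determines
        the formula that was used. So close images come from the same arc, and the distance was
        multiplied by exactly 8.\<close>
      have A: "a < 7/12 \<and> m a = 8 * a - 4 \<and> m a < 2/3 \<or> 7/12 < a \<and> a < 9/14 \<and> m a = 8 * a - 4 \<and> 2/3 < m a \<or>
          15/14 < a \<and> a < 13/12 \<and> m a = 8 * a - 8 \<and> m a < 2/3 \<or> 13/12 < a \<and> m a = 8 * a - 8 \<and> 2/3 < m a"
        if "4/7 < a" "a < 8/7" "\<Phi> a = x" for a
      using 3[OF that]
      proof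
        assume "a < 9/14"
        then show ?thesis
          using ne(4)[OF that(3)] by (cases "a < 7/12") (auto simp: m_def)
      next
        assume a: "15/14 < a"
        then have m: "m a = 8 * a - 8"
          by (simp add: m_def)
        show ?thesis
        proof (cases "a < 13/12")
          case True
          then have "m a < 2/3"
            using m by simp
          then show ?thesis
            using a True m by blast
        next
          case False
          then have "13/12 < a"
            using ne(5)[OF that(3)] by simp
          moreover from this have "2/3 < m a"
            using m by simp
          ultimately show ?thesis
            using m by blast
        qed
      qed
      have d: "m a \<le> 2/3 \<and> m b \<le> 2/3 \<or> 2/3 \<le> m a \<and> 2/3 \<le> m b" "\<bar>m a - m b\<bar> \<le> (1/2) ^ n"
        using cl by (simp_all add: close_def)
      have mm: "m a - m b = 8 * (a - b) \<and> (a \<le> 2/3 \<and> b \<le> 2/3 \<or> 2/3 \<le> a \<and> 2/3 \<le> b)"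
        using A[OF a] A[OF b] * d(1) by (elim disjE conjE) simp_all
      then have "\<bar>m a - m b\<bar> = 8 * \<bar>a - b\<bar>"
        by (metis abs_mult abs_numeral)
      then show ?thesis
        using d(2) mm by (auto simp: close_def)
    qed
    ultimately show ?thesis
      by (intro that[of m 3]) blast+
  qed
qed

text \<open>Of three angles, two lie on the same side of 2/3. Made after \<open>n\<close>
  expansions, this choice is carried back through the cells and gains a factor of at least 2 at
  every step.\<close>

lemma close_pair:
  assumes "\<And>j. (quad ^^ j) x \<notin> {0, \<beta>}"
    and "\<And>t. t \<in> {a, b, c} \<Longrightarrow> 4/7 < t \<and> t < 8/7 \<and> \<Phi> t = x"
  shows "close n a b \<or> close n b c \<or> close n a c"
  using assms
proof (induction n arbitrary: x a b c)
  case 0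
  then have "4/7 < t \<and> t < 8/7" if "t \<in> {a, b, c}" for t
    using that by blast
  then have "close 0 s t" if "s \<in> {a, b, c}" "t \<in> {a, b, c}" "(s \<le> 2/3) = (t \<le> 2/3)" for s t
  proof -
    have "4/7 < s" "s < 8/7" "4/7 < t" "t < 8/7"
      using \<open>\<And>t. t \<in> {a, b, c} \<Longrightarrow> 4/7 < t \<and> t < 8/7\<close> that by blast+
    then show ?thesis
      using that(3) unfolding close_def by (cases "s \<le> 2/3") auto
  qed
  then show ?case
    by (cases "a \<le> 2/3"; cases "b \<le> 2/3"; cases "c \<le> 2/3") simp_all
next
  case (Suc n)
  have "x \<noteq> - \<beta>" "x \<noteq> 0"
    using Suc.prems(1)[of 1] Suc.prems(1)[of 0] by (auto simp: quad_beta)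
  then obtain m j where m: "\<And>a. 4/7 < a \<Longrightarrow> a < 8/7 \<Longrightarrow> \<Phi> a = x \<Longrightarrow>
      4/7 < m a \<and> m a < 8/7 \<and> \<Phi> (m a) = (quad ^^ j) x"
    "\<And>a b n. 4/7 < a \<Longrightarrow> a < 8/7 \<Longrightarrow> \<Phi> a = x \<Longrightarrow> 4/7 < b \<Longrightarrow> b < 8/7 \<Longrightarrow> \<Phi> b = x \<Longrightarrow>
      close n (m a) (m b) \<Longrightarrow> close (Suc n) a b"
    by (rule cell_expansion) blast
  have "close n (m a) (m b) \<or> close n (m b) (m c) \<or> close n (m a) (m c)"
  proof (rule Suc.IH)
    show "(quad ^^ i) ((quad ^^ j) x) \<notin> {0, \<beta>}" for i
      using Suc.prems(1)[of "i + j"] by (simp add: funpow_add)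
    show "4/7 < t \<and> t < 8/7 \<and> \<Phi> t = (quad ^^ j) x" if "t \<in> {m a, m b, m c}" for t
      using that m(1) Suc.prems(2) by auto
  qed
  then show ?case
    using m(2) Suc.prems(2) by (metis insertCI)
qed

text \<open>If the orbit avoids \<open>\<beta>\<close>, one of its first three points has an angle
  between 4/7 and 8/7, and by saturation three of them. At every scale two of the three would be
  close, but distinct angles have a positive least distance.\<close>

lemma three_orbit_beta:
  assumes "three x"
  shows "\<exists>n. (quad ^^ n) x = \<beta>"
proof (rule ccontr)
  assume nb: "\<not> ?thesis"
  have "\<exists>j t. 4/7 < t \<and> t < 8/7 \<and> \<Phi> t = (quad ^^ j) x"
  proof -
    obtain t where t: "1/7 \<le> t" "t < 1/7 + 1" "\<Phi> t = x"
      using assms ex_int_shift[of "1/7"] Phi_add_int unfolding three_def by metis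
    have "x \<noteq> \<beta>"
      using nb by (metis funpow_0)
    then have ne: "t \<noteq> 1/7" "t \<noteq> 2/7" "t \<noteq> 4/7"
      using t Phi_sevenths by metis+
    consider "t < 2/7" | "2/7 < t" "t < 4/7" | "4/7 < t"
      using ne by linarith
    then show ?thesis
    proof cases
      case 1
      have "\<Phi> (2 * (2 * t)) = (quad ^^ 2) x"
        unfolding Phi_double t(3) by (simp add: numeral_2_eq_2)
      then show ?thesis using 1 t ne by (intro exI[of _ 2] exI[of _ "2 * (2 * t)"]) auto
    next
      case 2
      have "\<Phi> (2 * t) = (quad ^^ 1) x"
        unfolding Phi_double t(3) by simp
      then show ?thesis using 2 by (intro exI[of _ 1] exI[of _ "2 * t"]) auto
    next
      case 3
      then show ?thesis using t by (intro exI[of _ 0] exI[of _ t]) auto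
    qed
  qed
  then obtain j t where t: "4/7 < t" "t < 8/7" "\<Phi> t = (quad ^^ j) x"
    by blast
  obtain a b c where abc: "\<Phi> a = \<Phi> t" "\<Phi> b = \<Phi> t" "\<Phi> c = \<Phi> t"
    and ne: "\<And>k::int. a \<noteq> b + k" "\<And>k::int. b \<noteq> c + k" "\<And>k::int. a \<noteq> c + k"
    using three_orbit[OF assms, of j] t(3) unfolding three_def by metis
  obtain i k l :: int where i: "4/7 < a + i" "a + i < 8/7" and k: "4/7 < b + k" "b + k < 8/7"
    and l: "4/7 < c + l" "c + l < 8/7"
    using satD[OF sat_sectors(3) t(1,2)] abc by metis
  let ?a = "a + i" and ?b = "b + k" and ?c = "c + l"
  have cl: "close n ?a ?b \<or> close n ?b ?c \<or> close n ?a ?c" for n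
  proof (rule close_pair)
    show "(quad ^^ m) (\<Phi> t) \<notin> {0, \<beta>}" for m
      using nb three_orbit[OF assms, of "m + j"] not_three_0 t(3) funpow_add[of m j quad]
      by (metis comp_apply insert_iff singletonD)
    show "4/7 < s \<and> s < 8/7 \<and> \<Phi> s = \<Phi> t" if "s \<in> {?a, ?b, ?c}" for s
      using that i k l abc by auto
  qed
  have "?a \<noteq> ?b" "?b \<noteq> ?c" "?a \<noteq> ?c"
    using ne(1)[of "k - i"] ne(2)[of "l - k"] ne(3)[of "l - i"] by auto
  then have pos: "0 < min \<bar>?a - ?b\<bar> (min \<bar>?b - ?c\<bar> \<bar>?a - ?c\<bar>)"
    by auto
  have "\<exists>n. (1/2::real) ^ n < min \<bar>?a - ?b\<bar> (min \<bar>?b - ?c\<bar> \<bar>?a - ?c\<bar>)"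
    by (rule real_arch_pow_inv[OF pos]) simp
  then obtain n where "(1/2::real) ^ n < min \<bar>?a - ?b\<bar> (min \<bar>?b - ?c\<bar> \<bar>?a - ?c\<bar>)" ..
  then show False
    using cl[of n] unfolding close_def min_less_iff_conj by linarith
qed

section \<open>Components of the complement of a point\<close>

lemma connected_component_gap:
  assumes "sat u v" "v \<le> u + 1" "\<Phi> u = x" "\<Phi> v = x" and a: "u < a" "a < v"
  shows "connected_component_set (D3 - {x}) (\<Phi> a) = \<Phi> ` {u<..<v}"
proof
  have nx: "\<Phi> b \<noteq> x" if "u < b" "b < v" for b
    using sat_disjoint[OF assms(1) that, of v] assms by auto
  show "\<Phi> ` {u<..<v} \<subseteq> connected_component_set (D3 - {x}) (\<Phi> a)"
  proof (intro connected_component_maximal connected_continuous_image continuous_on_Phi)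
    show "\<Phi> ` {u<..<v} \<subseteq> D3 - {x}"
      using nx by fastforce
  qed (use a in auto)
  let ?K = "connected_component_set (D3 - {x}) (\<Phi> a)"
  have K: "?K \<subseteq> D3 - {x}"
    by (rule connected_component_subset)
  have cl: "closed (\<Phi> ` {s..t})" for s t
    by (intro compact_imp_closed compact_continuous_image continuous_on_Phi) simp
  have cover: "D3 \<subseteq> \<Phi> ` {u..v} \<union> \<Phi> ` {v..u + 1}"
  proof
    fix y assume "y \<in> D3"
    then obtain t where "u \<le> t" "t < u + 1" "y = \<Phi> t"
      by (rule D3_Phi)
    then show "y \<in> \<Phi> ` {u..v} \<union> \<Phi> ` {v..u + 1}"
      by (cases "t \<le> v") auto
  qed
  \<comment> \<open>The images of the two closed arcs are closed, cover \<open>D3\<close> and meet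
    in \<open>x\<close> only; a connected set that avoids \<open>x\<close> lies in one of
    them.\<close>
  have disj: "\<Phi> ` {u..v} \<inter> \<Phi> ` {v..u + 1} \<inter> ?K = {}"
  proof (rule ccontr)
    assume "\<not> ?thesis"
    then obtain s t where st: "s \<in> {u..v}" "t \<in> {v..u + 1}" "\<Phi> s = \<Phi> t" "\<Phi> s \<noteq> x"
      using K by fastforce
    then have "s \<noteq> u" "s \<noteq> v"
      using assms by auto
    then show False
      using sat_disjoint[OF assms(1), of s t] st by auto
  qed
  have "\<Phi> a \<in> ?K"
    using nx a by simp
  then have "\<Phi> ` {u..v} \<inter> ?K \<noteq> {}"
    using a by (metis (no_types, lifting) IntI atLeastAtMost_iff empty_iff imageI less_imp_le)
  then have "\<Phi> ` {v..u + 1} \<inter> ?K = {}"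
    using connected_closedD[OF connected_connected_component disj _ cl cl] cover K by blast
  then have "?K \<subseteq> \<Phi> ` {u..v} - {x}"
    using cover K by blast
  also have "\<dots> \<subseteq> \<Phi> ` {u<..<v}"
    using assms(3,4) by (force simp: less_le)
  finally show "?K \<subseteq> \<Phi> ` {u<..<v}" .
qed

lemma branches_tri:
  assumes "tri x1 x2 x3 x"
  shows "branches D3 x = {\<Phi> ` {x1<..<x2}, \<Phi> ` {x2<..<x3}, \<Phi> ` {x3<..<x1 + 1}}"
    and "distinct [\<Phi> ` {x1<..<x2}, \<Phi> ` {x2<..<x3}, \<Phi> ` {x3<..<x1 + 1}]"
proof -
  let ?A = "\<Phi> ` {x1<..<x2}" and ?B = "\<Phi> ` {x2<..<x3}" and ?C = "\<Phi> ` {x3<..<x1 + 1}"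
  have o: "x1 < x2" "x2 < x3" "x3 < x1 + 1" and F: "\<Phi> x1 = x" "\<Phi> x2 = x" "\<Phi> x3 = x"
    and s: "sat x1 x2" "sat x2 x3" "sat x3 (x1 + 1)"
    using assms by (auto simp: tri_def)
  have A: "connected_component_set (D3 - {x}) (\<Phi> a) = ?A" if "x1 < a" "a < x2" for a
    using connected_component_gap[OF s(1)] that o F by simp
  have B: "connected_component_set (D3 - {x}) (\<Phi> a) = ?B" if "x2 < a" "a < x3" for a
    using connected_component_gap[OF s(2)] that o F by simp
  have C: "connected_component_set (D3 - {x}) (\<Phi> a) = ?C" if "x3 < a" "a < x1 + 1" for a
    using connected_component_gap[OF s(3)] that o F by simp
  have "C \<in> branches D3 x \<longleftrightarrow> (\<exists>a. \<Phi> a \<noteq> x \<and> C = connected_component_set (D3 - {x}) (\<Phi> a))" for C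
    unfolding branches_def components_def using Phi_in_D3 Phi_range by fastforce
  also have "(\<exists>a. \<Phi> a \<noteq> x \<and> C = connected_component_set (D3 - {x}) (\<Phi> a)) \<longleftrightarrow> C \<in> {?A, ?B, ?C}" for C
  proof
    assume "\<exists>a. \<Phi> a \<noteq> x \<and> C = connected_component_set (D3 - {x}) (\<Phi> a)"
    then obtain a where a: "x1 \<le> a" "a < x1 + 1" "\<Phi> a \<noteq> x" "C = connected_component_set (D3 - {x}) (\<Phi> a)"
      using ex_int_shift[of x1] Phi_add_int by metis
    then have "a \<noteq> x1" "a \<noteq> x2" "a \<noteq> x3"
      using F by auto
    then consider "x1 < a" "a < x2" | "x2 < a" "a < x3" | "x3 < a"
      using a by linarith
    then show "C \<in> {?A, ?B, ?C}"
      using A B C a by cases auto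
  next
    assume "C \<in> {?A, ?B, ?C}"
    moreover have "\<Phi> ((x1 + x2) / 2) \<noteq> x" "\<Phi> ((x2 + x3) / 2) \<noteq> x" "\<Phi> ((x3 + (x1 + 1)) / 2) \<noteq> x"
      using sat_disjoint[OF s(1), of "(x1 + x2) / 2" x2] sat_disjoint[OF s(2), of "(x2 + x3) / 2" x3]
        sat_disjoint[OF s(3), of "(x3 + (x1 + 1)) / 2" "x1 + 1"] o F by auto
    moreover have "connected_component_set (D3 - {x}) (\<Phi> ((x1 + x2) / 2)) = ?A"
      "connected_component_set (D3 - {x}) (\<Phi> ((x2 + x3) / 2)) = ?B"
      "connected_component_set (D3 - {x}) (\<Phi> ((x3 + (x1 + 1)) / 2)) = ?C"
      using o by (auto intro!: A B C)
    ultimately show "\<exists>a. \<Phi> a \<noteq> x \<and> C = connected_component_set (D3 - {x}) (\<Phi> a)"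
      by (metis empty_iff insert_iff)
  qed
  finally show "branches D3 x = {?A, ?B, ?C}"
    by blast
  have "?A \<inter> ?B = {}" "?A \<inter> ?C = {}" "?B \<inter> ?C = {}"
    using sat_disjoint[OF s(1)] sat_disjoint[OF s(2)] o by fastforce+
  moreover have "?A \<noteq> {}" "?B \<noteq> {}"
    using o by auto
  ultimately show "distinct [?A, ?B, ?C]"
    by auto
qed

lemma fibre_between:
  assumes "s < t" "connected_component_set (D3 - {x}) (\<Phi> s) \<noteq> connected_component_set (D3 - {x}) (\<Phi> t)"
  obtains r where "s \<le> r" "r \<le> t" "\<Phi> r = x"
proof (rule ccontr)
  assume nt: "\<not> thesis"
  note found = that
  have "\<Phi> r \<noteq> x" if "r \<in> {s..t}" for r
    using nt found[of r] that by auto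
  then have "\<Phi> ` {s..t} \<subseteq> D3 - {x}"
    by (intro image_subsetI) simp
  moreover have "connected (\<Phi> ` {s..t})"
    by (intro connected_continuous_image continuous_on_Phi) simp
  ultimately have "connected_component (D3 - {x}) (\<Phi> s) (\<Phi> t)"
    unfolding connected_component_def using assms(1) by (intro exI[of _ "\<Phi> ` {s..t}"]) auto
  then show False
    using assms(2) connected_component_eq by blast
qed

text \<open>One turn around the circle passes from each of the three components to the next, and
  every passage crosses the fibre of \<open>x\<close>.\<close>

lemma three_of_components:
  assumes t: "t1 < t2" "t2 < t3" "t3 < t1 + 1"
    and x: "\<Phi> t1 \<noteq> x" "\<Phi> t2 \<noteq> x" "\<Phi> t3 \<noteq> x"
    and ne: "connected_component_set (D3 - {x}) (\<Phi> t1) \<noteq> connected_component_set (D3 - {x}) (\<Phi> t2)"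
      "connected_component_set (D3 - {x}) (\<Phi> t2) \<noteq> connected_component_set (D3 - {x}) (\<Phi> t3)"
      "connected_component_set (D3 - {x}) (\<Phi> t3) \<noteq> connected_component_set (D3 - {x}) (\<Phi> t1)"
  shows "three x"
proof -
  obtain r1 where r1: "t1 \<le> r1" "r1 \<le> t2" "\<Phi> r1 = x"
    using fibre_between[OF t(1) ne(1)] .
  obtain r2 where r2: "t2 \<le> r2" "r2 \<le> t3" "\<Phi> r2 = x"
    using fibre_between[OF t(2) ne(2)] .
  obtain r3 where r3: "t3 \<le> r3" "r3 \<le> t1 + 1" "\<Phi> r3 = x"
    using fibre_between[of t3 "t1 + 1" x] t ne(3) by auto
  have s: "t1 < r1" "r1 < t2" "t2 < r2" "r2 < t3" "t3 < r3" "r3 < t1 + 1"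
    using r1 r2 r3 x Phi_add_1[of t1] by (auto simp: order.strict_iff_order)
  have "r1 < r2" "r2 < r1 + 1" "r2 < r3" "r3 < r2 + 1" "r1 < r3" "r3 < r1 + 1"
    using s by linarith+
  then have "\<forall>k::int. r1 \<noteq> r2 + k \<and> r2 \<noteq> r3 + k \<and> r1 \<noteq> r3 + k"
    using not_int_shift by blast
  then show ?thesis
    unfolding three_def using r1 r2 r3 by blast
qed

text \<open>Three components give three angles, three angles force the orbit to reach
  \<open>\<beta>\<close>, and the triple at \<open>\<beta>\<close> pulls back to one at
  \<open>x\<close>. The detour through the dynamics also bounds the number of branches by
  three.\<close>

lemma branch_points_D3: "branch_points D3 = {x. \<exists>x1 x2 x3. tri x1 x2 x3 x}"
proof safe
  fix x assume x: "x \<in> branch_points D3"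
  then have xD: "x \<in> D3" and big: "infinite (branches D3 x) \<or> 3 \<le> card (branches D3 x)"
    by (auto simp: branch_points_def)
  obtain B where B: "B \<subseteq> branches D3 x" "card B = 3" "finite B"
  proof (cases "finite (branches D3 x)")
    case True
    then show ?thesis
      using obtain_subset_with_card_n[of 3 "branches D3 x"] big that by (metis)
  next
    case False
    then show ?thesis
      using infinite_arbitrarily_large[of "branches D3 x" 3] that by metis
  qed
  then obtain C1 C2 C3 where C: "{C1, C2, C3} \<subseteq> branches D3 x" "C1 \<noteq> C2" "C2 \<noteq> C3" "C3 \<noteq> C1"
    unfolding card_3_iff by auto
  let ?K = "\<lambda>t. connected_component_set (D3 - {x}) (\<Phi> t)"
  have rep: "\<exists>t. 0 \<le> t \<and> t < 1 \<and> C = ?K t \<and> \<Phi> t \<noteq> x" if C: "C \<in> branches D3 x" for C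
  proof -
    obtain y where y: "y \<in> D3" "y \<noteq> x" "C = connected_component_set (D3 - {x}) y"
      using C unfolding branches_def components_def by auto
    obtain t where "0 \<le> t" "t < 0 + 1" "y = \<Phi> t"
      using D3_Phi[OF y(1)] by blast
    then show ?thesis
      using y by auto
  qed
  obtain t1 t2 t3 where t: "0 \<le> t1" "t1 < 1" "C1 = ?K t1" "\<Phi> t1 \<noteq> x"
     "0 \<le> t2" "t2 < 1" "C2 = ?K t2" "\<Phi> t2 \<noteq> x" "0 \<le> t3" "t3 < 1" "C3 = ?K t3" "\<Phi> t3 \<noteq> x"
    using rep[of C1] rep[of C2] rep[of C3] C(1) by auto
  have "t1 \<noteq> t2" "t2 \<noteq> t3" "t3 \<noteq> t1"
    using C(2-4) t by auto
  have "?K t1 \<noteq> ?K t2" "?K t2 \<noteq> ?K t3" "?K t3 \<noteq> ?K t1"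
    using C(2-4) t by auto
  note K = this this[symmetric]
  have "t1 < t2 \<and> t2 < t3 \<or> t2 < t3 \<and> t3 < t1 \<or> t3 < t1 \<and> t1 < t2
    \<or> t1 < t3 \<and> t3 < t2 \<or> t3 < t2 \<and> t2 < t1 \<or> t2 < t1 \<and> t1 < t3"
    using \<open>t1 \<noteq> t2\<close> \<open>t2 \<noteq> t3\<close> \<open>t3 \<noteq> t1\<close> by linarith
  then consider "t1 < t2" "t2 < t3" | "t2 < t3" "t3 < t1" | "t3 < t1" "t1 < t2"
    | "t1 < t3" "t3 < t2" | "t3 < t2" "t2 < t1" | "t2 < t1" "t1 < t3"
    by blast
  then have "three x"
  proof cases
    case 1 then show ?thesis using t K by (intro three_of_components[of t1 t2 t3 x]) auto
  next
    case 2 then show ?thesis using t K by (intro three_of_components[of t2 t3 t1 x]) auto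
  next
    case 3 then show ?thesis using t K by (intro three_of_components[of t3 t1 t2 x]) auto
  next
    case 4 then show ?thesis using t K by (intro three_of_components[of t1 t3 t2 x]) auto
  next
    case 5 then show ?thesis using t K by (intro three_of_components[of t3 t2 t1 x]) auto
  next
    case 6 then show ?thesis using t K by (intro three_of_components[of t2 t1 t3 x]) auto
  qed
  then obtain n where "(quad ^^ n) x = \<beta>"
    using three_orbit_beta by blast
  then show "\<exists>x1 x2 x3. tri x1 x2 x3 x"
    using tri_of_orbit by blast
next
  fix x x1 x2 x3 assume t: "tri x1 x2 x3 x"
  have "card (branches D3 x) = card (set [\<Phi> ` {x1<..<x2}, \<Phi> ` {x2<..<x3}, \<Phi> ` {x3<..<x1 + 1}])"
    by (simp add: branches_tri(1)[OF t])
  also have "\<dots> = 3"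
    using distinct_card[OF branches_tri(2)[OF t]] by simp
  finally show "x \<in> branch_points D3"
    using tri_in_D3[OF t] by (simp add: branch_points_def)
qed

lemma branch_point_orbit:
  assumes "tri x1 x2 x3 x"
  shows "\<exists>n. (quad ^^ n) x = \<beta>"
proof (rule three_orbit_beta)
  have "x1 < x2" "x2 < x1 + 1" "x2 < x3" "x3 < x2 + 1" "x1 < x3" "x3 < x1 + 1"
    using assms by (auto simp: tri_def)
  then have "\<forall>k::int. x1 \<noteq> x2 + k \<and> x2 \<noteq> x3 + k \<and> x1 \<noteq> x3 + k"
    using not_int_shift by blast
  then show "three x"
    using assms unfolding three_def tri_def by blast
qed

end

section \<open>The coloring-free description of the group\<close>

lemma cyclic3_rotate: "cyclic3 i j k \<Longrightarrow> cyclic3 j k i"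
  by (auto simp: cyclic3_def)

lemma atLeast1_atMost3: "{1..3::nat} = {1, 2, 3}" "{Suc 0..3} = {Suc 0, 2, 3}"
  by auto

text \<open>The arrangements of three letters that are not in cyclic order are the transpositions,
  which are odd; those in cyclic order are the identity and two products of two
  transpositions.\<close>

lemma alt_group_3_iff:
  "p \<in> carrier (alt_group 3) \<longleftrightarrow> (\<forall>i. i \<notin> {1..3} \<longrightarrow> p i = i) \<and> cyclic3 (p 1) (p 2) (p 3)"
proof
  assume "p \<in> carrier (alt_group 3)"
  then have p: "p permutes {1..3}" and even: "evenperm p"
    by (simp_all add: alt_group_carrier)
  have out: "p i = i" if "i \<notin> {1..3}" for i
    using p that by (auto simp: permutes_def)
  have "p i \<in> {1, 2, 3}" if "i \<in> {1, 2, 3}" for i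
    using permutes_in_image[OF p, of i] that by (auto simp: atLeast1_atMost3)
  then have in3: "p 1 \<in> {1, 2, 3}" "p 2 \<in> {1, 2, 3}" "p 3 \<in> {1, 2, 3}"
    by simp_all
  have ne: "p 1 \<noteq> p 2" "p 2 \<noteq> p 3" "p 1 \<noteq> p 3"
    using permutes_inj[OF p] by (auto simp: inj_eq)
  have odd: False if "p a = b" "p b = a" "p d = d" "a \<noteq> b" "{1, 2, 3} = {a, b, d}" for a b d
  proof -
    have "p = Transposition.transpose a b"
    proof
      fix i
      have "d \<noteq> a" "d \<noteq> b"
        using that(1-4) by auto
      show "p i = Transposition.transpose a b i"
      proof (cases "i \<in> {1, 2, 3}")
        case True
        then have "i = a \<or> i = b \<or> i = d"
          unfolding that(5) by simp
        then show ?thesis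
          using that(1-3) \<open>d \<noteq> a\<close> \<open>d \<noteq> b\<close> by (elim disjE) simp_all
      next
        case False
        then have "i \<noteq> a" "i \<noteq> b" "p i = i"
          using that(5) out[of i] by (auto simp: atLeast1_atMost3)
        then show ?thesis by simp
      qed
    qed
    then show False
      using even that(4) by (simp add: evenperm_swap)
  qed
  have "cyclic3 (p 1) (p 2) (p 3)"
  proof (rule ccontr)
    assume "\<not> ?thesis"
    then have "p 1 = 1 \<and> p 2 = 3 \<and> p 3 = 2 \<or> p 1 = 2 \<and> p 2 = 1 \<and> p 3 = 3 \<or> p 1 = 3 \<and> p 2 = 2 \<and> p 3 = 1"
      using in3 ne unfolding cyclic3_def insert_iff empty_iff prod.inject by (elim disjE) simp_all
    then show False
      using odd[of 2 3 1] odd[of 1 2 3] odd[of 1 3 2] by (elim disjE) (auto simp: insert_commute)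
  qed
  then show "(\<forall>i. i \<notin> {1..3} \<longrightarrow> p i = i) \<and> cyclic3 (p 1) (p 2) (p 3)"
    using out by blast
next
  assume p: "(\<forall>i. i \<notin> {1..3} \<longrightarrow> p i = i) \<and> cyclic3 (p 1) (p 2) (p 3)"
  have ext: "p = q" if "p 1 = q 1" "p 2 = q 2" "p 3 = q 3" "\<And>i. i \<notin> {1..3} \<Longrightarrow> q i = i" for q
  proof
    fix i show "p i = q i"
      using p that by (cases "i \<in> {1..3}") (auto simp: atLeast1_atMost3)
  qed
  have perm: "Transposition.transpose i j permutes {1..3}" if "i \<in> {1..3}" "j \<in> {1..3}" for i j :: nat
    using that by (rule permutes_swap_id)
  have comp: "Transposition.transpose i j \<circ> Transposition.transpose k l \<in> carrier (alt_group 3)"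
    if "i \<in> {1..3}" "j \<in> {1..3}" "k \<in> {1..3}" "l \<in> {1..3}" "i \<noteq> j" "k \<noteq> l" for i j k l :: nat
    unfolding alt_group_carrier
  proof
    show "Transposition.transpose i j \<circ> Transposition.transpose k l permutes {1..3}"
      by (rule permutes_compose[OF perm perm]) (rule that)+
    show "evenperm (Transposition.transpose i j \<circ> Transposition.transpose k l)"
      using that(5,6) by (simp add: evenperm_comp permutation_swap_id evenperm_swap)
  qed
  consider "p 1 = 1" "p 2 = 2" "p 3 = 3" | "p 1 = 2" "p 2 = 3" "p 3 = 1" | "p 1 = 3" "p 2 = 1" "p 3 = 2"
    using p by (auto simp: cyclic3_def)
  then show "p \<in> carrier (alt_group 3)"
  proof cases
    case 1
    then have "p = id"
      by (intro ext) auto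
    then show ?thesis
      by (simp add: alt_group_carrier permutes_id evenperm_id)
  next
    case 2
    then have "p = Transposition.transpose 1 2 \<circ> Transposition.transpose 2 3"
      by (intro ext) (auto simp: Transposition.transpose_def)
    then show ?thesis
      using comp[of 1 2 2 3] by simp
  next
    case 3
    then have "p = Transposition.transpose 2 3 \<circ> Transposition.transpose 1 2"
      by (intro ext) (auto simp: Transposition.transpose_def)
    then show ?thesis
      using comp[of 2 3 1 2] by simp
  qed
qed

lemma cyclic3_permute:
  assumes "cyclic3 i j k" "cyclic3 (p 1) (p 2) (p 3)"
  shows "cyclic3 (p i) (p j) (p k)"
  using assms by (auto simp: cyclic3_def)

lemma cyclic3_permute_conv:
  assumes "cyclic3 i j k" "cyclic3 (p i) (p j) (p k)"
  shows "cyclic3 (p 1) (p 2) (p 3)"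
  using assms by (auto simp: cyclic3_def)

section \<open>Homeomorphisms permute branches and branch points\<close>

lemma homeomorphism_components:
  assumes h: "homeomorphism S T f g" and C: "C \<in> components S"
  shows "f ` C \<in> components T"
  unfolding in_components_maximal
proof (intro conjI allI impI)
  have cf: "continuous_on S f" and cg: "continuous_on T g" and fS: "f ` S = T" and gT: "g ` T = S"
    and gf: "\<And>x. x \<in> S \<Longrightarrow> g (f x) = x" and fg: "\<And>y. y \<in> T \<Longrightarrow> f (g y) = y"
    using h by (auto simp: homeomorphism_def)
  have CS: "C \<subseteq> S" "C \<noteq> {}" "connected C"
    and max: "\<And>D. D \<noteq> {} \<Longrightarrow> C \<subseteq> D \<Longrightarrow> D \<subseteq> S \<Longrightarrow> connected D \<Longrightarrow> D = C"
    using C unfolding in_components_maximal by auto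
  show "f ` C \<noteq> {}" "f ` C \<subseteq> T"
    using CS fS by auto
  show "connected (f ` C)"
    using CS by (intro connected_continuous_image continuous_on_subset[OF cf]) auto
  fix D assume D: "D \<noteq> {} \<and> f ` C \<subseteq> D \<and> D \<subseteq> T \<and> connected D"
  have "g ` D = C"
  proof (rule max)
    show "C \<subseteq> g ` D"
    proof
      fix y assume "y \<in> C"
      then have "f y \<in> D" "y = g (f y)"
        using D CS(1) gf by auto
      then show "y \<in> g ` D"
        by (rule rev_image_eqI)
    qed
    show "g ` D \<subseteq> S"
      using D gT by blast
    show "connected (g ` D)"
      using D by (intro connected_continuous_image continuous_on_subset[OF cg]) auto
  qed (use D in auto)
  then have "f ` C = (\<lambda>y. f (g y)) ` D"
    by (simp add: image_image flip: \<open>g ` D = C\<close>)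
  also have "\<dots> = (\<lambda>y. y) ` D"
    using D fg by (intro image_cong) auto
  finally show "D = f ` C"
    by simp
qed

lemma homeomorphism_branches:
  assumes h: "homeomorphism X X f g" and x: "x \<in> X"
  shows "branches X (f x) = image f ` branches X x"
proof -
  have *: "homeomorphism (X - {x}) (X - {f x}) f g" if "homeomorphism X X f g" "x \<in> X" for f g and x :: 'a
  proof (rule homeomorphism_of_subsets[OF that(1)])
    have "inj_on f X"
      using that(1) by (metis homeomorphism_apply1 inj_onI)
    then show "f ` (X - {x}) = X - {f x}"
      using that inj_on_image_set_diff[of f X X "{x}"] by (simp add: homeomorphism_image1)
  qed auto
  have gx: "homeomorphism X X g f" "f x \<in> X" "g (f x) = x"
    using h x by (auto simp: homeomorphism_symD homeomorphism_def)
  show ?thesis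
  proof
    show "image f ` branches X x \<subseteq> branches X (f x)"
      unfolding branches_def using homeomorphism_components[OF *[OF h x]] by blast
    show "branches X (f x) \<subseteq> image f ` branches X x"
    proof
      fix C assume C: "C \<in> branches X (f x)"
      then have "g ` C \<in> branches X x"
        using homeomorphism_components[OF *[OF gx(1,2)]] gx(3) unfolding branches_def by simp
      moreover have "f ` (g ` C) = C"
      proof -
        have "C \<subseteq> X"
          using C unfolding branches_def by (meson Diff_subset in_components_subset order_trans)
        then have "(\<lambda>y. f (g y)) ` C = (\<lambda>y. y) ` C"
          using h by (intro image_cong) (auto simp: homeomorphism_def)
        then show ?thesis
          by (simp add: image_image)
      qed
      ultimately show "C \<in> image f ` branches X x"
        by (metis imageI)
    qed
  qed
qed

lemma homeomorphism_branch_point: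
  assumes h: "homeomorphism X X f g" and x: "x \<in> branch_points X"
  shows "f x \<in> branch_points X"
proof -
  have xX: "x \<in> X"
    using x by (simp add: branch_points_def)
  have "inj_on (image f) (branches X x)"
  proof (rule inj_on_subset)
    have "inj_on f X"
      using h by (metis homeomorphism_apply1 inj_onI)
    then show "inj_on (image f) (Pow X)"
      by (rule inj_on_image_Pow)
    show "branches X x \<subseteq> Pow X"
      unfolding branches_def using in_components_subset by blast
  qed
  moreover have "f x \<in> X"
    using h xX by (auto simp: homeomorphism_def)
  ultimately show ?thesis
    using x unfolding branch_points_def
    by (simp add: homeomorphism_branches[OF h xX] finite_image_iff card_image)
qed

section \<open>Orientation of the circle in terms of angles\<close>

lemma circle_oriented_e:
  "circle_oriented z1 z2 z3 \<longleftrightarrow> (\<exists>a b d. a < b \<and> b < d \<and> d < a + 1 \<and> z1 = e a \<and> z2 = e b \<and> z3 = e d)"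
proof
  assume "circle_oriented z1 z2 z3"
  then obtain a b d where *: "a < b" "b < d" "d < a + 2 * pi" "z1 = cis a" "z2 = cis b" "z3 = cis d"
    by (auto simp: circle_oriented_def)
  have "a / (2 * pi) < b / (2 * pi)" "b / (2 * pi) < d / (2 * pi)"
    using * by (auto intro: divide_strict_right_mono)
  moreover have "d / (2 * pi) < (a + 2 * pi) / (2 * pi)"
    using * by (intro divide_strict_right_mono) auto
  moreover have "(a + 2 * pi) / (2 * pi) = a / (2 * pi) + 1"
    by (simp add: field_simps)
  ultimately show "\<exists>a b d. a < b \<and> b < d \<and> d < a + 1 \<and> z1 = e a \<and> z2 = e b \<and> z3 = e d"
    using * by (intro exI[of _ "a / (2 * pi)"] exI[of _ "b / (2 * pi)"] exI[of _ "d / (2 * pi)"])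
      (auto simp: e_def)
next
  assume "\<exists>a b d. a < b \<and> b < d \<and> d < a + 1 \<and> z1 = e a \<and> z2 = e b \<and> z3 = e d"
  then obtain a b d where *: "a < b" "b < d" "d < a + 1" "z1 = e a" "z2 = e b" "z3 = e d"
    by blast
  have "2 * pi * d < 2 * pi * (a + 1)"
    using * by (intro mult_strict_left_mono) auto
  then show "circle_oriented z1 z2 z3"
    unfolding circle_oriented_def using *
    by (intro exI[of _ "2 * pi * a"] exI[of _ "2 * pi * b"] exI[of _ "2 * pi * d"])
      (auto simp: e_def distrib_left)
qed

lemma circle_interval_e:
  assumes "u < v" "v < u + 1"
  shows "circle_interval (e u) (e v) = e ` {u<..<v}"
proof
  show "circle_interval (e u) (e v) \<subseteq> e ` {u<..<v}"
  proof
    fix z assume "z \<in> circle_interval (e u) (e v)"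
    then obtain a b d where *: "a < b" "b < d" "d < a + 1" "e u = e a" "z = e b" "e v = e d"
      unfolding circle_interval_def circle_oriented_e by auto
    obtain k j :: int where k: "u = a + k" and j: "v = d + j"
      using *(4,6) unfolding e_eq_iff by auto
    have "- 1 < real_of_int (j - k)" "real_of_int (j - k) < 1"
      using * k j assms by auto
    then have "j - k = 0"
      by (rule int_eq_0)
    then show "z \<in> e ` {u<..<v}"
      using * k j by (intro image_eqI[of _ _ "b + k"]) auto
  qed
  show "e ` {u<..<v} \<subseteq> circle_interval (e u) (e v)"
  proof (rule image_subsetI)
    fix t assume "t \<in> {u<..<v}"
    then show "e t \<in> circle_interval (e u) (e v)"
      unfolding circle_interval_def circle_oriented_e mem_Collect_eq using assms
      by (intro exI[of _ u] exI[of _ t] exI[of _ v]) auto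
  qed
qed

context riemann_exterior
begin

section \<open>Branches as images of arcs, and their cyclic order\<close>

definition gap :: "real \<Rightarrow> real \<Rightarrow> complex set" where
  "gap u v = \<Phi> ` {u<..<v}"

lemma gap_add_int: "gap (u + of_int k) (v + of_int k) = gap u v"
proof -
  have "gap (u + of_int k) (v + of_int k) \<subseteq> gap u v" for u v k
    unfolding gap_def
  proof (rule image_subsetI)
    fix t assume "t \<in> {u + of_int k<..<v + of_int k}"
    then show "\<Phi> t \<in> \<Phi> ` {u<..<v}"
      using Phi_add_int[of t "- k"] by (intro image_eqI[of _ _ "t - of_int k"]) auto
  qed
  from this[of u k v] this[of "u + of_int k" "- k" "v + of_int k"] show ?thesis
    by simp
qed

lemma gap_add_1 [simp]: "gap (u + 1) (v + 1) = gap u v"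
  using gap_add_int[of u 1 v] by simp

lemma branches_gaps:
  assumes "tri x1 x2 x3 x"
  shows "branches D3 x = {gap x1 x2, gap x2 x3, gap x3 (x1 + 1)}"
    and "gap x1 x2 \<noteq> gap x2 x3" "gap x2 x3 \<noteq> gap x3 (x1 + 1)" "gap x1 x2 \<noteq> gap x3 (x1 + 1)"
  using branches_tri[OF assms] by (auto simp: gap_def)

lemma tri_next_unique:
  assumes "tri a y2 y3 x" "tri a z2 z3 x"
  shows "y2 = z2 \<and> y3 = z3"
proof -
  have "z2 = y2 \<or> z2 = y3" "z3 = y2 \<or> z3 = y3"
    using tri_fibre[OF assms(1), of z2] tri_fibre[OF assms(1), of z3] assms(2)
    by (auto simp: tri_def)
  then show ?thesis
    using assms by (auto simp: tri_def)
qed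

text \<open>The angles of \<open>x\<close> are determined up to an integer shift and the choice of
  the first one. For this reason later choices of a triple are harmless.\<close>

lemma tri_gaps_unique:
  assumes x: "tri x1 x2 x3 x" and y: "tri y1 y2 y3 x"
  shows "(gap y1 y2, gap y2 y3, gap y3 (y1 + 1)) \<in>
    {(gap x1 x2, gap x2 x3, gap x3 (x1 + 1)), (gap x2 x3, gap x3 (x1 + 1), gap x1 x2),
     (gap x3 (x1 + 1), gap x1 x2, gap x2 x3)}"
proof -
  obtain k :: int where k: "x1 \<le> y1 + k" "y1 + k < x1 + 1"
    using ex_int_shift by blast
  define z1 z2 z3 where "z1 = y1 + k" and "z2 = y2 + k" and "z3 = y3 + k"
  have z: "tri z1 z2 z3 x"
    unfolding z1_def z2_def z3_def by (rule tri_add_int[OF y])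
  have "gap z3 (z1 + 1) = gap y3 (y1 + 1)"
    using gap_add_int[of y3 k "y1 + 1"] by (simp add: z1_def z3_def ac_simps)
  then have g: "(gap y1 y2, gap y2 y3, gap y3 (y1 + 1)) = (gap z1 z2, gap z2 z3, gap z3 (z1 + 1))"
    by (simp add: z1_def z2_def z3_def gap_add_int)
  have "z1 = x1 \<or> z1 = x2 \<or> z1 = x3"
    using tri_fibre[OF x, of z1] k z by (auto simp: tri_def z1_def)
  then show ?thesis
  proof (elim disjE)
    assume "z1 = x1"
    then show ?thesis
      using tri_next_unique[of z1 z2 z3 x x2 x3] x z g by simp
  next
    assume "z1 = x2"
    then show ?thesis
      using tri_next_unique[of z1 z2 z3 x x3 "x1 + 1"] tri_rotate[OF x] z g by simp
  next
    assume "z1 = x3"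
    then show ?thesis
      using tri_next_unique[of z1 z2 z3 x "x1 + 1" "x2 + 1"] tri_rotate[OF tri_rotate[OF x]] z g by simp
  qed
qed

definition oriented_at :: "(complex \<Rightarrow> complex) \<Rightarrow> complex \<Rightarrow> bool" where
  "oriented_at g x \<longleftrightarrow> (\<exists>x1 x2 x3 y1 y2 y3. tri x1 x2 x3 x \<and> tri y1 y2 y3 (g x) \<and>
     g ` gap x1 x2 = gap y1 y2 \<and> g ` gap x2 x3 = gap y2 y3 \<and> g ` gap x3 (x1 + 1) = gap y3 (y1 + 1))"

lemma oriented_atI:
  assumes "tri x1 x2 x3 x" "tri y1 y2 y3 (g x)"
    "g ` gap x1 x2 = gap y1 y2" "g ` gap x2 x3 = gap y2 y3" "g ` gap x3 (x1 + 1) = gap y3 (y1 + 1)"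
  shows "oriented_at g x"
  unfolding oriented_at_def using assms by (intro exI conjI)

lemma oriented_atE:
  assumes "oriented_at g x"
  obtains x1 x2 x3 y1 y2 y3 where "tri x1 x2 x3 x" "tri y1 y2 y3 (g x)"
    "g ` gap x1 x2 = gap y1 y2" "g ` gap x2 x3 = gap y2 y3" "g ` gap x3 (x1 + 1) = gap y3 (y1 + 1)"
  using assms unfolding oriented_at_def by (elim exE conjE) (rule that)

end

locale oriented_coloring = riemann_exterior +
  fixes \<phi> :: "complex \<Rightarrow> complex" and c :: "complex set \<Rightarrow> nat"
  assumes phi: "\<And>z. z \<in> S1 \<Longrightarrow> \<phi> z = \<psi> z"
    and coloring: "coloring D3 c"
    and same: "same_orientation D3 c \<phi>"
begin

lemma phi_e [simp]: "\<phi> (e t) = \<Phi> t"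
  by (simp add: phi \<Phi>_def)

lemma preimage_enumeration_tri:
  assumes x: "tri x1 x2 x3 x" and z: "preimage_enumeration \<phi> x z"
  obtains y1 y2 y3 where "tri y1 y2 y3 x" "z 1 = e y1" "z 2 = e y2" "z 3 = e y3"
proof -
  obtain a b d where abd: "a < b" "b < d" "d < a + 1" "z 1 = e a" "z 2 = e b" "z 3 = e d"
    using z unfolding preimage_enumeration_def circle_oriented_e by blast
  have "z i \<in> {w \<in> S1. \<phi> w = x}" if "i \<in> {1..3}" for i
    using z that unfolding preimage_enumeration_def bij_betw_def by blast
  from this[of 1] this[of 2] this[of 3] have F: "\<Phi> a = x" "\<Phi> b = x" "\<Phi> d = x"
    using abd by auto
  obtain y2 y3 where y: "tri a y2 y3 x"
    using tri_start[OF x F(1)] .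
  have "b = y2 \<or> b = y3" "d = y2 \<or> d = y3"
    using tri_fibre[OF y, of b] tri_fibre[OF y, of d] F abd by auto
  then have "b = y2" "d = y3"
    using abd y by (auto simp: tri_def)
  then show ?thesis
    using that[OF y] abd by simp
qed

lemma ex_preimage_enumeration:
  assumes x: "tri x1 x2 x3 x"
  shows "\<exists>z. preimage_enumeration \<phi> x z"
proof
  define z where "z = (\<lambda>i::nat. if i = 1 then e x1 else if i = 2 then e x2 else e x3)"
  have o: "x1 < x2" "x2 < x3" "x3 < x1 + 1" and F: "\<Phi> x1 = x" "\<Phi> x2 = x" "\<Phi> x3 = x"
    using x by (auto simp: tri_def)
  have ne: "e p \<noteq> e q" if "p < q" "q < p + 1" for p q
    using not_int_shift[OF that] by (simp add: e_eq_iff)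
  have "e x1 \<noteq> e x2" "e x2 \<noteq> e x3" "e x1 \<noteq> e x3"
    using o ne[of x1 x2] ne[of x2 x3] ne[of x1 x3] by auto
  then have "inj_on z {1..3}"
    unfolding atLeast1_atMost3 by (auto simp: z_def inj_on_def)
  moreover have "z ` {1..3} = {w \<in> S1. \<phi> w = x}"
  proof
    show "z ` {1..3} \<subseteq> {w \<in> S1. \<phi> w = x}"
      using F by (auto simp: z_def)
    show "{w \<in> S1. \<phi> w = x} \<subseteq> z ` {1..3}"
    proof
      fix w assume w: "w \<in> {w \<in> S1. \<phi> w = x}"
      then obtain t where t: "x1 \<le> t" "t < x1 + 1" "w = e t"
        using e_surj[of w x1] by auto
      then have "t = x1 \<or> t = x2 \<or> t = x3"
        using tri_fibre[OF x, of t] w by simp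
      then show "w \<in> z ` {1..3}"
        using t by (auto simp: z_def atLeast1_atMost3)
    qed
  qed
  moreover have "circle_oriented (z 1) (z 2) (z 3)"
    unfolding circle_oriented_e z_def using o by auto
  ultimately show "preimage_enumeration \<phi> x z"
    unfolding preimage_enumeration_def bij_betw_def by simp
qed

text \<open>The enumeration picked by \<open>SOME\<close> comes from some triple at
  \<open>x\<close>, and any two triples differ by a rotation, which \<open>cyclic3\<close> does not
  see.\<close>

lemma loop_orientation_tri:
  assumes x: "tri x1 x2 x3 x"
  shows "loop_orientation \<phi> x (gap x1 x2) (gap x2 x3) (gap x3 (x1 + 1)) = 1"
proof -
  define z where "z = (SOME z. preimage_enumeration \<phi> x z)"
  have "preimage_enumeration \<phi> x z"
    unfolding z_def by (rule someI_ex[OF ex_preimage_enumeration[OF x]])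
  then obtain y1 y2 y3 where y: "tri y1 y2 y3 x" and z: "z 1 = e y1" "z 2 = e y2" "z 3 = e y3"
    using preimage_enumeration_tri[OF x] by blast
  have o: "y1 < y2" "y2 < y3" "y3 < y1 + 1"
    using y by (auto simp: tri_def)
  have im: "\<phi> ` circle_interval (e u) (e v) = gap u v" if "u < v" "v < u + 1" for u v
    using circle_interval_e[OF that] by (simp add: image_image gap_def)
  have "e y1 = e (y1 + 1)"
    using e_add_int[of y1 1] by simp
  then have b: "\<phi> ` circle_interval (z 1) (z 2) = gap y1 y2" "\<phi> ` circle_interval (z 2) (z 3) = gap y2 y3"
    "\<phi> ` circle_interval (z 3) (z 1) = gap y3 (y1 + 1)"
    using im[of y1 y2] im[of y2 y3] im[of y3 "y1 + 1"] o z by auto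
  have ci: "\<phi> ` circle_interval (z i) (z (i mod 3 + 1)) =
      (if i = 1 then gap y1 y2 else if i = 2 then gap y2 y3 else gap y3 (y1 + 1))" if i: "i \<in> {1..3}" for i
  proof -
    have m: "(1::nat) mod 3 + 1 = 2" "(2::nat) mod 3 + 1 = 3" "(3::nat) mod 3 + 1 = 1"
      by simp_all
    from i consider "i = 1" | "i = 2" | "i = 3"
      by (auto simp: atLeast1_atMost3)
    then show ?thesis
    proof cases
      case 1 show ?thesis unfolding 1 m b by simp
    next
      case 2 show ?thesis unfolding 2 m b by simp
    next
      case 3 show ?thesis unfolding 3 m b by simp
    qed
  qed
  have idx: "branch_index \<phi> z A = i" if i: "i \<in> {1..3}" and A: "A = \<phi> ` circle_interval (z i) (z (i mod 3 + 1))" for A i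
    unfolding branch_index_def
  proof (rule the_equality)
    fix j assume j: "j \<in> {1..3} \<and> A = \<phi> ` circle_interval (z j) (z (j mod 3 + 1))"
    then have "(if i = 1 then gap y1 y2 else if i = 2 then gap y2 y3 else gap y3 (y1 + 1)) =
        (if j = 1 then gap y1 y2 else if j = 2 then gap y2 y3 else gap y3 (y1 + 1))"
      using A ci[OF i] ci[of j] by simp
    moreover have "i = 1 \<or> i = 2 \<or> i = 3" "j = 1 \<or> j = 2 \<or> j = 3"
      using i j by auto
    ultimately show "j = i"
      using branches_gaps(2-4)[OF y] by (elim disjE) simp_all
  qed (use i A in auto)
  have "branch_index \<phi> z (gap y1 y2) = 1" "branch_index \<phi> z (gap y2 y3) = 2"
    "branch_index \<phi> z (gap y3 (y1 + 1)) = 3"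
    using idx[of 1] idx[of 2] idx[of 3] ci[of 1] ci[of 2] ci[of 3] by simp_all
  then have "cyclic3 (branch_index \<phi> z (gap x1 x2)) (branch_index \<phi> z (gap x2 x3))
      (branch_index \<phi> z (gap x3 (x1 + 1)))"
    using tri_gaps_unique[OF y x] by (auto simp: cyclic3_def)
  then show ?thesis
    by (simp add: loop_orientation_def Let_def flip: z_def)
qed

lemma branch_point_iff: "x \<in> branch_points D3 \<longleftrightarrow> (\<exists>x1 x2 x3. tri x1 x2 x3 x)"
  by (simp add: branch_points_D3)

lemma cyclic3_colors:
  assumes x: "tri x1 x2 x3 x"
  shows "cyclic3 (c (gap x1 x2)) (c (gap x2 x3)) (c (gap x3 (x1 + 1)))"
proof -
  have "x \<in> branch_points D3"
    using x branch_point_iff by blast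
  then have "coloring_orientation c (gap x1 x2) (gap x2 x3) (gap x3 (x1 + 1)) =
      loop_orientation \<phi> x (gap x1 x2) (gap x2 x3) (gap x3 (x1 + 1))"
    using same branches_gaps[OF x] unfolding same_orientation_def by simp
  then show ?thesis
    using loop_orientation_tri[OF x] by (simp add: coloring_orientation_def split: if_splits)
qed

lemma color_inj:
  assumes "x \<in> branch_points D3"
  shows "inj_on c (branches D3 x)"
  using coloring assms by (auto simp: coloring_def bij_betw_def)

lemma local_action_color:
  assumes "x \<in> branch_points D3" "A \<in> branches D3 x"
  shows "local_action D3 c g x (c A) = c (g ` A)"
proof -
  have "c A \<in> {1..3}"
    using coloring assms unfolding coloring_def by (meson bij_betw_apply)
  moreover have "inv_into (branches D3 x) c (c A) = A"
    using color_inj[OF assms(1)] assms(2) by (rule inv_into_f_f)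
  ultimately show ?thesis
    by (simp add: local_action_def)
qed

text \<open>Colors read in the order of the angles are cyclically ordered at \<open>x\<close> and at
  \<open>g x\<close>. So a local action in the alternating group means that \<open>g\<close> carries
  the one cyclic order to the other; injectivity of \<open>c\<close> on the branches at
  \<open>g x\<close> turns equal colors into equal branches.\<close>

lemma local_action_alternating_iff:
  assumes h: "homeomorphism D3 D3 g h" and x: "x \<in> branch_points D3"
  shows "local_action D3 c g x \<in> carrier (alt_group 3) \<longleftrightarrow> oriented_at g x"
proof -
  obtain x1 x2 x3 where t: "tri x1 x2 x3 x"
    using x branch_point_iff by blast
  have gx: "g x \<in> branch_points D3"
    by (rule homeomorphism_branch_point[OF h x])
  then obtain y1 y2 y3 where u: "tri y1 y2 y3 (g x)"
    using branch_point_iff by blast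
  have br: "branches D3 (g x) = image g ` branches D3 x"
    using tri_in_D3[OF t] by (rule homeomorphism_branches[OF h])
  let ?p = "local_action D3 c g x"
  let ?A = "gap x1 x2" and ?B = "gap x2 x3" and ?C = "gap x3 (x1 + 1)"
  have p: "?p (c ?A) = c (g ` ?A)" "?p (c ?B) = c (g ` ?B)" "?p (c ?C) = c (g ` ?C)"
    using branches_gaps(1)[OF t] local_action_color[OF x] by auto
  have "?p \<in> carrier (alt_group 3) \<longleftrightarrow> cyclic3 (?p 1) (?p 2) (?p 3)"
    unfolding alt_group_3_iff by (auto simp: local_action_def)
  also have "\<dots> \<longleftrightarrow> cyclic3 (c (g ` ?A)) (c (g ` ?B)) (c (g ` ?C))"
    using cyclic3_permute[OF cyclic3_colors[OF t], of ?p] cyclic3_permute_conv[OF cyclic3_colors[OF t], of ?p] p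
    by metis
  also have "\<dots> \<longleftrightarrow> oriented_at g x"
  proof
    assume cyc: "cyclic3 (c (g ` ?A)) (c (g ` ?B)) (c (g ` ?C))"
    have in_br: "g ` ?A \<in> branches D3 (g x)" "g ` ?B \<in> branches D3 (g x)" "g ` ?C \<in> branches D3 (g x)"
      using br branches_gaps(1)[OF t] by auto
    have inj: "c X = c Y \<Longrightarrow> X = Y" if "X \<in> branches D3 (g x)" "Y \<in> branches D3 (g x)" for X Y
      using color_inj[OF gx] that by (auto dest: inj_onD)
    have cases: "\<exists>y1 y2 y3. tri y1 y2 y3 (g x) \<and>
        c (g ` ?A) = c (gap y1 y2) \<and> c (g ` ?B) = c (gap y2 y3) \<and> c (g ` ?C) = c (gap y3 (y1 + 1))"
    proof -
      have "(c (g ` ?A), c (g ` ?B), c (g ` ?C)) \<in>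
        {(c (gap y1 y2), c (gap y2 y3), c (gap y3 (y1 + 1))), (c (gap y2 y3), c (gap y3 (y1 + 1)), c (gap y1 y2)),
         (c (gap y3 (y1 + 1)), c (gap y1 y2), c (gap y2 y3))}"
        using cyc cyclic3_colors[OF u] by (auto simp: cyclic3_def)
      then consider "c (g ` ?A) = c (gap y1 y2)" "c (g ` ?B) = c (gap y2 y3)" "c (g ` ?C) = c (gap y3 (y1 + 1))"
        | "c (g ` ?A) = c (gap y2 y3)" "c (g ` ?B) = c (gap y3 (y1 + 1))" "c (g ` ?C) = c (gap y1 y2)"
        | "c (g ` ?A) = c (gap y3 (y1 + 1))" "c (g ` ?B) = c (gap y1 y2)" "c (g ` ?C) = c (gap y2 y3)"
        by auto
      then show ?thesis
      proof cases
        case 1 then show ?thesis using u by blast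
      next
        case 2
        then show ?thesis using tri_rotate[OF u]
          by (intro exI[of _ y2] exI[of _ y3] exI[of _ "y1 + 1"]) simp
      next
        case 3
        then show ?thesis using tri_rotate[OF tri_rotate[OF u]]
          by (intro exI[of _ y3] exI[of _ "y1 + 1"] exI[of _ "y2 + 1"]) simp
      qed
    qed
    then obtain w1 w2 w3 where w: "tri w1 w2 w3 (g x)" "c (g ` ?A) = c (gap w1 w2)"
      "c (g ` ?B) = c (gap w2 w3)" "c (g ` ?C) = c (gap w3 (w1 + 1))"
      by blast
    have "g ` ?A = gap w1 w2 \<and> g ` ?B = gap w2 w3 \<and> g ` ?C = gap w3 (w1 + 1)"
      using inj[OF in_br(1) _ w(2)] inj[OF in_br(2) _ w(3)] inj[OF in_br(3) _ w(4)]
        branches_gaps(1)[OF w(1)] by blast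
    then show "oriented_at g x"
      by (intro oriented_atI[where g = g, OF t w(1)]) simp_all
  next
    assume "oriented_at g x"
    then obtain w1 w2 w3 v1 v2 v3 where w: "tri w1 w2 w3 x" and v: "tri v1 v2 v3 (g x)"
      and g: "g ` gap w1 w2 = gap v1 v2" "g ` gap w2 w3 = gap v2 v3" "g ` gap w3 (w1 + 1) = gap v3 (v1 + 1)"
      by (rule oriented_atE)
    have "cyclic3 (c (g ` gap w1 w2)) (c (g ` gap w2 w3)) (c (g ` gap w3 (w1 + 1)))"
      using cyclic3_colors[OF v] g by simp
    note cyc = this this[THEN cyclic3_rotate] this[THEN cyclic3_rotate, THEN cyclic3_rotate]
    show "cyclic3 (c (g ` ?A)) (c (g ` ?B)) (c (g ` ?C))"
      using tri_gaps_unique[OF w t] cyc by auto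
  qed
  finally show ?thesis .
qed

definition G :: "(complex \<Rightarrow> complex) monoid" where
  "G = kaleidoscopic_A3 D3 c"

text \<open>Makes membership checkable for maps that are given on angles, where the order of the
  branches is visible and their colors are not.\<close>

lemma mem_G_iff:
  "g \<in> carrier G \<longleftrightarrow> g \<in> extensional D3 \<and> (\<exists>h. homeomorphism D3 D3 g h) \<and>
    (\<forall>x\<in>branch_points D3. oriented_at g x)"
proof -
  have 1: "g \<in> carrier G \<longleftrightarrow> g \<in> extensional D3 \<and> (\<exists>h. homeomorphism D3 D3 g h) \<and>
      (\<forall>x\<in>branch_points D3. local_action D3 c g x \<in> carrier (alt_group 3))"
    by (simp add: G_def kaleidoscopic_A3_def)
  show ?thesis
  proof (cases "\<exists>h. homeomorphism D3 D3 g h")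
    case True
    then obtain h where h: "homeomorphism D3 D3 g h" ..
    have "(\<forall>x\<in>branch_points D3. local_action D3 c g x \<in> carrier (alt_group 3)) \<longleftrightarrow>
        (\<forall>x\<in>branch_points D3. oriented_at g x)"
      by (intro ball_cong refl local_action_alternating_iff[OF h])
    then show ?thesis
      unfolding 1 by simp
  next
    case False
    then show ?thesis
      unfolding 1 by simp
  qed
qed

lemma mult_G: "g \<otimes>\<^bsub>G\<^esub> h = compose D3 g h" if "g \<in> carrier G" "h \<in> carrier G"
proof -
  have "k \<in> Bij D3" if "k \<in> carrier G" for k
    using that unfolding mem_G_iff Bij_def homeomorphism_def bij_betw_def
    by (auto intro!: inj_on_inverseI)
  then show ?thesis
    using that by (simp add: G_def kaleidoscopic_A3_def BijGroup_def)
qed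

lemma one_G: "\<one>\<^bsub>G\<^esub> = (\<lambda>x\<in>D3. x)"
  by (simp add: G_def kaleidoscopic_A3_def BijGroup_def)

end

section \<open>Constructing elements of the group\<close>

context riemann_exterior
begin

section \<open>Maps of the line that induce homeomorphisms of \<open>D3\<close>\<close>

definition lamination_map :: "(real \<Rightarrow> real) \<Rightarrow> bool" where
  "lamination_map H \<longleftrightarrow> strict_mono H \<and> surj H \<and> (\<forall>t. H (t + 1) = H t + 1) \<and>
     (\<forall>a b. \<Phi> (H a) = \<Phi> (H b) \<longleftrightarrow> \<Phi> a = \<Phi> b)"

definition induced :: "(real \<Rightarrow> real) \<Rightarrow> complex \<Rightarrow> complex" where
  "induced H = (\<lambda>x\<in>D3. \<Phi> (H (SOME t. \<Phi> t = x)))"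

lemma induced_Phi:
  assumes "lamination_map H"
  shows "induced H (\<Phi> t) = \<Phi> (H t)"
proof -
  have "\<Phi> (SOME s. \<Phi> s = \<Phi> t) = \<Phi> t"
    by (rule someI) simp
  then show ?thesis
    using assms by (simp add: induced_def lamination_map_def)
qed

lemma lamination_map_add_int:
  assumes "lamination_map H"
  shows "H (t + of_int k) = H t + of_int k"
proof -
  have 1: "H (t + 1) = H t + 1" for t
    using assms by (simp add: lamination_map_def)
  have nat: "H (t + of_nat n) = H t + of_nat n" for t n
  proof (induction n)
    case (Suc n)
    then show ?case
      using 1[of "t + of_nat n"] by (simp add: ac_simps)
  qed simp
  show ?thesis
  proof (cases "0 \<le> k")
    case True
    then show ?thesis
      using nat[of t "nat k"] by simp
  next
    case False
    then show ?thesis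
      using nat[of "t + of_int k" "nat (- k)"] by simp
  qed
qed

lemma lamination_map_less: "lamination_map H \<Longrightarrow> H a < H b \<longleftrightarrow> a < b"
  by (simp add: lamination_map_def strict_mono_less)

lemma sat_lamination_map:
  assumes H: "lamination_map H" and "sat u v"
  shows "sat (H u) (H v)"
  unfolding sat_def
proof (intro allI impI, elim conjE)
  fix a b assume a: "H u < a" "a < H v" and eq: "\<Phi> a = \<Phi> b"
  obtain a' b' where ab: "a = H a'" "b = H b'"
    using H unfolding lamination_map_def surj_def by metis
  have "u < a'" "a' < v" "\<Phi> a' = \<Phi> b'"
    using a eq H unfolding ab lamination_map_less[OF H] by (simp_all add: lamination_map_def)
  then obtain k :: int where "u < b' + k" "b' + k < v"
    by (rule satD[OF assms(2)])
  then have "H u < H (b' + k)" "H (b' + k) < H v"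
    using lamination_map_less[OF H] by simp_all
  then show "\<exists>k::int. H u < b + k \<and> b + k < H v"
    unfolding ab lamination_map_add_int[OF H] by blast
qed

lemma induced_gap:
  assumes H: "lamination_map H"
  shows "induced H ` gap u v = gap (H u) (H v)"
proof -
  have "H ` {u<..<v} = {H u<..<H v}"
  proof
    show "{H u<..<H v} \<subseteq> H ` {u<..<v}"
    proof
      fix y assume y: "y \<in> {H u<..<H v}"
      obtain t where "y = H t"
        using H unfolding lamination_map_def surj_def by metis
      then show "y \<in> H ` {u<..<v}"
        using y lamination_map_less[OF H] by auto
    qed
  qed (auto simp: lamination_map_less[OF H])
  then show ?thesis
    unfolding gap_def by (simp add: image_image induced_Phi[OF H] flip: \<open>H ` {u<..<v} = {H u<..<H v}\<close>)
qed

lemma tri_lamination_map: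
  assumes H: "lamination_map H" and t: "tri x1 x2 x3 x"
  shows "tri (H x1) (H x2) (H x3) (induced H x)"
proof -
  have F: "x = \<Phi> x1" "\<Phi> x2 = \<Phi> x1" "\<Phi> x3 = \<Phi> x1"
    using t by (auto simp: tri_def)
  have 1: "H (x1 + 1) = H x1 + 1"
    using H by (simp add: lamination_map_def)
  have "H x3 < H x1 + 1"
    using lamination_map_less[OF H, of x3 "x1 + 1"] t 1 by (simp add: tri_def)
  moreover have "sat (H x3) (H x1 + 1)"
    using sat_lamination_map[OF H, of x3 "x1 + 1"] t 1 by (simp add: tri_def)
  moreover have "\<Phi> (H x2) = \<Phi> (H x1)" "\<Phi> (H x3) = \<Phi> (H x1)"
    using H F by (simp_all add: lamination_map_def)
  ultimately show ?thesis
    using t unfolding tri_def F(1) induced_Phi[OF H]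
    by (simp add: lamination_map_less[OF H] sat_lamination_map[OF H])
qed

lemma continuous_on_lamination_map:
  assumes "lamination_map H"
  shows "continuous_on UNIV H"
proof (rule continuous_onI_mono)
  show "open (H ` UNIV)"
    using assms by (simp add: lamination_map_def)
  show "\<And>x y. x \<in> UNIV \<Longrightarrow> y \<in> UNIV \<Longrightarrow> x \<le> y \<Longrightarrow> H x \<le> H y"
    using assms by (simp add: lamination_map_def strict_mono_less_eq)
qed

text \<open>Restricted to \<open>{0..1}\<close>, \<Phi> is a continuous map of a compact space onto
  \<open>D3\<close>, hence a quotient map.\<close>

lemma continuous_on_D3_via_Phi:
  fixes f :: "complex \<Rightarrow> 'b::topological_space"
  assumes "continuous_on UNIV (\<lambda>t. f (\<Phi> t))"
  shows "continuous_on D3 f"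
  unfolding continuous_on_closed_vimage[OF compact_imp_closed[OF compact_D3]]
proof (intro allI impI)
  fix B :: "'b set" assume "closed B"
  then have "closed ((\<lambda>t. f (\<Phi> t)) -` B)"
    using assms by (simp add: continuous_on_closed_vimage)
  then have "compact ({0..1} \<inter> (\<lambda>t. f (\<Phi> t)) -` B)"
    by (intro compact_Int_closed) auto
  then have "compact (\<Phi> ` ({0..1} \<inter> (\<lambda>t. f (\<Phi> t)) -` B))"
    by (intro compact_continuous_image continuous_on_Phi)
  also have "\<Phi> ` ({0..1} \<inter> (\<lambda>t. f (\<Phi> t)) -` B) = f -` B \<inter> D3"
  proof
    show "f -` B \<inter> D3 \<subseteq> \<Phi> ` ({0..1} \<inter> (\<lambda>t. f (\<Phi> t)) -` B)"
    proof
      fix x assume x: "x \<in> f -` B \<inter> D3"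
      then obtain t where "0 \<le> t" "t < 0 + 1" "x = \<Phi> t"
        using D3_Phi by blast
      then show "x \<in> \<Phi> ` ({0..1} \<inter> (\<lambda>t. f (\<Phi> t)) -` B)"
        using x by auto
    qed
  qed auto
  finally show "closed (f -` B \<inter> D3)"
    by (rule compact_imp_closed)
qed

lemma homeomorphism_induced:
  assumes H: "lamination_map H"
  shows "\<exists>h. homeomorphism D3 D3 (induced H) h"
proof (rule homeomorphism_compact[OF compact_D3])
  show "continuous_on D3 (induced H)"
  proof (rule continuous_on_D3_via_Phi)
    show "continuous_on UNIV (\<lambda>t. induced H (\<Phi> t))"
      unfolding induced_Phi[OF H]
      by (rule continuous_on_compose2[OF continuous_on_Phi continuous_on_lamination_map[OF H]]) auto
  qed
  have "induced H ` D3 = \<Phi> ` range H"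
    unfolding Phi_range[symmetric] by (simp add: image_image induced_Phi[OF H])
  then show "induced H ` D3 = D3"
    using H Phi_range by (simp add: lamination_map_def)
  show "inj_on (induced H) D3"
  proof (rule inj_onI)
    fix x y assume xy: "x \<in> D3" "y \<in> D3" and eq: "induced H x = induced H y"
    obtain a b where "x = \<Phi> a" "y = \<Phi> b"
      using xy Phi_range by (metis imageE)
    then show "x = y"
      using eq H by (simp add: induced_Phi[OF H] lamination_map_def)
  qed
qed

lemma oriented_at_induced:
  assumes H: "lamination_map H" and x: "x \<in> branch_points D3"
  shows "oriented_at (induced H) x"
proof -
  obtain x1 x2 x3 where t: "tri x1 x2 x3 x"
    using x branch_points_D3 by auto
  have "H (x1 + 1) = H x1 + 1"
    using H by (simp add: lamination_map_def)
  then show ?thesis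
    using induced_gap[OF H]
    by (intro oriented_atI[where g = "induced H", OF t tri_lamination_map[OF H t]]) simp_all
qed

text \<open>Reduces the construction of a lamination map to one period. The windows of arguments and
  of values may start at different angles \<open>p\<close> and \<open>q\<close>, as the rotation
  requires.\<close>

lemma periodic_extension:
  fixes H0 :: "real \<Rightarrow> real"
  assumes mono: "\<And>s t. p \<le> s \<Longrightarrow> s < t \<Longrightarrow> t < p + 1 \<Longrightarrow> H0 s < H0 t"
    and im: "\<And>t. p \<le> t \<Longrightarrow> t < p + 1 \<Longrightarrow> q \<le> H0 t \<and> H0 t < q + 1"
    and onto: "\<And>y. q \<le> y \<Longrightarrow> y < q + 1 \<Longrightarrow> \<exists>t. p \<le> t \<and> t < p + 1 \<and> H0 t = y"
    and iff: "\<And>a b. p \<le> a \<Longrightarrow> a < p + 1 \<Longrightarrow> p \<le> b \<Longrightarrow> b < p + 1 \<Longrightarrow>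
      \<Phi> (H0 a) = \<Phi> (H0 b) \<longleftrightarrow> \<Phi> a = \<Phi> b"
  shows "\<exists>H. lamination_map H \<and> (\<forall>t. p \<le> t \<longrightarrow> t < p + 1 \<longrightarrow> H t = H0 t)"
proof -
  define fl where "fl = (\<lambda>t. \<lfloor>t - p\<rfloor>)"
  define H where "H = (\<lambda>t. H0 (t - fl t) + fl t)"
  have fl: "p \<le> t - fl t" "t - fl t < p + 1" for t
    unfolding fl_def by linarith+
  have flI: "fl t = k" if "p \<le> t - of_int k" "t - of_int k < p + 1" for t k
    unfolding fl_def using that by (intro floor_unique) auto
  have "strict_mono H"
  proof (rule strict_monoI)
    fix s t :: real assume "s < t"
    show "H s < H t"
    proof (cases "fl s = fl t")
      case True
      then show ?thesis
        using mono[of "s - fl s" "t - fl t"] fl[of s] fl[of t] \<open>s < t\<close> by (simp add: H_def)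
    next
      case False
      have "fl s \<le> fl t"
        unfolding fl_def using \<open>s < t\<close> by (intro floor_mono) auto
      then have "real_of_int (fl s) + 1 \<le> fl t"
        using False by linarith
      then show ?thesis
        using im[OF fl[of s]] im[OF fl[of t]] by (simp add: H_def)
    qed
  qed
  moreover have "surj H"
    unfolding surj_def
  proof
    fix y :: real
    obtain k :: int where "q \<le> y + k" "y + k < q + 1"
      using ex_int_shift by blast
    then obtain t where t: "p \<le> t" "t < p + 1" "H0 t = y + k"
      using onto by blast
    have "fl (t - of_int k) = - k"
      using t by (intro flI) auto
    then have "H (t - of_int k) = y"
      using t by (simp add: H_def)
    then show "\<exists>x. y = H x"
      by metis
  qed
  moreover have "H (t + 1) = H t + 1" for t
  proof -
    have "fl (t + 1) = fl t + 1"
      unfolding fl_def by linarith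
    then show ?thesis
      by (simp add: H_def)
  qed
  moreover have "\<Phi> (H a) = \<Phi> (H b) \<longleftrightarrow> \<Phi> a = \<Phi> b" for a b
  proof -
    have "\<Phi> (t - fl t) = \<Phi> t" for t
      using Phi_add_int[of "t - fl t" "fl t"] by simp
    then show ?thesis
      using iff[OF fl fl, of a b] by (simp add: H_def)
  qed
  moreover have "H t = H0 t" if "p \<le> t" "t < p + 1" for t
    using flI[of t 0] that by (simp add: H_def)
  ultimately show ?thesis
    unfolding lamination_map_def by blast
qed

lemma sat_open:
  assumes "sat u v" "u < v" "v \<le> u + 1"
  shows "openin (top_of_set D3) (gap u v)"
proof -
  have "gap u v = D3 - \<Phi> ` {v..u + 1}"
  proof
    show "gap u v \<subseteq> D3 - \<Phi> ` {v..u + 1}"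
      unfolding gap_def using sat_disjoint[OF assms(1)] by force
    show "D3 - \<Phi> ` {v..u + 1} \<subseteq> gap u v"
    proof
      fix x assume x: "x \<in> D3 - \<Phi> ` {v..u + 1}"
      then obtain t where t: "u \<le> t" "t < u + 1" "x = \<Phi> t"
        using D3_Phi by blast
      have "t < v"
        using x t by (cases "v \<le> t") auto
      moreover have "t \<noteq> u"
      proof
        assume "t = u"
        then have "x = \<Phi> (u + 1)"
          using t by simp
        moreover have "\<Phi> (u + 1) \<in> \<Phi> ` {v..u + 1}"
          using assms(3) by (intro imageI) simp
        ultimately show False
          using x by (metis DiffD2)
      qed
      ultimately show "x \<in> gap u v"
        unfolding gap_def using t by auto
    qed
  qed
  moreover have "closed (\<Phi> ` {v..u + 1})"
    by (intro compact_imp_closed compact_continuous_image continuous_on_Phi) simp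
  ultimately show ?thesis
    by (simp add: Diff_eq openin_open_Int open_Compl)
qed

end

context oriented_coloring
begin

lemma induced_in_G:
  assumes "lamination_map H"
  shows "induced H \<in> carrier G"
  unfolding mem_G_iff
  using homeomorphism_induced[OF assms] oriented_at_induced[OF assms] by (simp add: induced_def)

lemma G_in_D3: "g \<in> carrier G \<Longrightarrow> x \<in> D3 \<Longrightarrow> g x \<in> D3"
  unfolding mem_G_iff homeomorphism_def by auto

lemma G_image: "g \<in> carrier G \<Longrightarrow> g ` D3 = D3"
  unfolding mem_G_iff homeomorphism_def by auto

lemma G_inj: "g \<in> carrier G \<Longrightarrow> inj_on g D3"
  unfolding mem_G_iff by (metis homeomorphism_apply1 inj_onI)

lemma G_continuous: "g \<in> carrier G \<Longrightarrow> continuous_on D3 g"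
  unfolding mem_G_iff homeomorphism_def by auto

lemma G_branch_point: "g \<in> carrier G \<Longrightarrow> x \<in> branch_points D3 \<Longrightarrow> g x \<in> branch_points D3"
  unfolding mem_G_iff using homeomorphism_branch_point by blast

lemma mult_G_apply: "g \<in> carrier G \<Longrightarrow> h \<in> carrier G \<Longrightarrow> x \<in> D3 \<Longrightarrow> (g \<otimes>\<^bsub>G\<^esub> h) x = g (h x)"
  by (simp add: mult_G compose_eq)

lemma G_eqI:
  assumes "g \<in> carrier G" "h \<in> carrier G" "\<And>x. x \<in> D3 \<Longrightarrow> g x = h x"
  shows "g = h"
  using assms unfolding mem_G_iff by (intro extensionalityI[of g D3 h]) auto

lemma G_branch_image:
  assumes "g \<in> carrier G" "x \<in> D3"
  shows "branches D3 (g x) = image g ` branches D3 x"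
  using assms unfolding mem_G_iff using homeomorphism_branches by blast

section \<open>Gluing elements over disjoint arcs\<close>

definition glue :: "'i set \<Rightarrow> ('i \<Rightarrow> complex set) \<Rightarrow> ('i \<Rightarrow> complex \<Rightarrow> complex) \<Rightarrow> complex \<Rightarrow> complex" where
  "glue I B k = (\<lambda>x\<in>D3. if \<exists>n\<in>I. x \<in> B n then k (THE n. n \<in> I \<and> x \<in> B n) x else x)"

lemma glue_in:
  assumes "disjoint_family_on B I" "n \<in> I" "x \<in> B n" "x \<in> D3"
  shows "glue I B k x = k n x"
proof -
  have "(THE n. n \<in> I \<and> x \<in> B n) = n"
    using assms unfolding disjoint_family_on_def by (intro the_equality) auto
  then show ?thesis
    using assms by (auto simp: glue_def)
qed

lemma glue_out: "x \<in> D3 \<Longrightarrow> (\<And>n. n \<in> I \<Longrightarrow> x \<notin> B n) \<Longrightarrow> glue I B k x = x"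
  by (auto simp: glue_def)

text \<open>At a point outside all pieces, a piece of diameter below half the tolerance moves its
  points by less than that, whatever its map does. Only finitely many pieces are larger, and the map
  of each is continuous and fixes the boundary of its piece.\<close>

lemma continuous_on_glue:
  fixes k :: "'i \<Rightarrow> complex \<Rightarrow> complex"
  assumes disj: "disjoint_family_on B I"
    and op: "\<And>n. n \<in> I \<Longrightarrow> openin (top_of_set D3) (B n)"
    and ck: "\<And>n. n \<in> I \<Longrightarrow> continuous_on D3 (k n)"
    and kB: "\<And>n. n \<in> I \<Longrightarrow> k n ` B n \<subseteq> B n"
    and fr: "\<And>n x. n \<in> I \<Longrightarrow> x \<in> closure (B n) \<Longrightarrow> x \<notin> B n \<Longrightarrow> k n x = x"
    and small: "\<And>\<epsilon>. 0 < \<epsilon> \<Longrightarrow> finite {n \<in> I. \<exists>x\<in>B n. \<exists>y\<in>B n. \<epsilon> \<le> dist x y}"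
  shows "continuous_on D3 (glue I B k)"
  unfolding continuous_on_def
proof
  fix x assume x: "x \<in> D3"
  have BD: "B n \<subseteq> D3" if "n \<in> I" for n
    using openin_imp_subset[OF op[OF that]] .
  let ?g = "glue I B k"
  show "(?g \<longlongrightarrow> ?g x) (at x within D3)"
  proof (cases "\<exists>n\<in>I. x \<in> B n")
    case True
    then obtain n where n: "n \<in> I" "x \<in> B n"
      by blast
    obtain U where U: "open U" "B n = D3 \<inter> U"
      using op[OF n(1)] unfolding openin_open by blast
    have "(k n \<longlongrightarrow> ?g x) (at x within D3)"
      using ck[OF n(1)] x glue_in[OF disj n x] unfolding continuous_on_def by metis
    moreover have "\<forall>\<^sub>F y in at x within D3. k n y = ?g y"
      unfolding eventually_at_topological
    proof (intro exI[of _ U] conjI ballI impI)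
      fix y assume "y \<in> U" "y \<in> D3"
      then show "k n y = ?g y"
        using glue_in[OF disj n(1), of y k] U(2) by auto
    qed (use U n in auto)
    ultimately show ?thesis
      by (rule Lim_transform_eventually)
  next
    case False
    then have gx: "?g x = x"
      using x by (intro glue_out) auto
    show ?thesis
      unfolding gx tendsto_iff
    proof (intro allI impI)
      fix \<epsilon> :: real assume \<epsilon>: "0 < \<epsilon>"
      define F where "F = {n \<in> I. \<exists>x\<in>B n. \<exists>y\<in>B n. \<epsilon> / 2 \<le> dist x y}"
      have "finite F"
        unfolding F_def using \<epsilon> by (intro small) simp
      have ev: "\<forall>\<^sub>F y in at x within D3. y \<in> B n \<longrightarrow> dist (k n y) x < \<epsilon>" if n: "n \<in> F" for n
      proof (cases "x \<in> closure (B n)")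
        case True
        have "n \<in> I"
          using n by (simp add: F_def)
        then have "k n x = x"
          using fr True \<open>\<not> (\<exists>n\<in>I. x \<in> B n)\<close> by blast
        moreover have "(k n \<longlongrightarrow> k n x) (at x within D3)"
          using ck[OF \<open>n \<in> I\<close>] x unfolding continuous_on_def by blast
        ultimately have "\<forall>\<^sub>F y in at x within D3. dist (k n y) x < \<epsilon>"
          using \<epsilon> unfolding tendsto_iff by simp
        then show ?thesis
          by eventually_elim simp
      next
        case False
        then have "\<forall>\<^sub>F y in at x within D3. y \<in> - closure (B n)"
          by (intro eventually_at_topological[THEN iffD2] exI[of _ "- closure (B n)"]) auto
        then show ?thesis
          by eventually_elim (use closure_subset in blast)
      qed
      have "\<forall>\<^sub>F y in at x within D3. \<forall>n\<in>F. y \<in> B n \<longrightarrow> dist (k n y) x < \<epsilon>"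
        using \<open>finite F\<close> ev by (simp add: eventually_ball_finite)
      moreover have "\<forall>\<^sub>F y in at x within D3. dist y x < \<epsilon> / 2"
        using \<epsilon> eventually_at by (metis half_gt_zero)
      moreover have "\<forall>\<^sub>F y in at x within D3. y \<in> D3"
        by (simp add: eventually_at_filter)
      ultimately show "\<forall>\<^sub>F y in at x within D3. dist (?g y) x < \<epsilon>"
      proof eventually_elim
        case (elim y)
        show ?case
        proof (cases "\<exists>n\<in>I. y \<in> B n")
          case True
          then obtain n where n: "n \<in> I" "y \<in> B n"
            by blast
          have gy: "?g y = k n y"
            using glue_in[OF disj n] elim(3) by simp
          show ?thesis
          proof (cases "n \<in> F")
            case True
            then show ?thesis
              using elim(1) n gy by simp
          next
            case False
            then have "dist (k n y) y < \<epsilon> / 2"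
              using n kB[OF n(1)] unfolding F_def by (force simp: not_le)
            then show ?thesis
              using elim(2) gy dist_triangle[of "k n y" x y] by simp
          qed
        next
          case False
          then have "?g y = y"
            using elim(3) by (intro glue_out) auto
          then show ?thesis
            using elim(2) \<epsilon> by simp
        qed
      qed
    qed
  qed
qed

text \<open>A branch accumulates at its base point. Two maps that agree near that point can
  therefore be compared on whole branches, since images of branches that meet are equal.\<close>

lemma gap_meets_open:
  assumes U: "openin (top_of_set D3) U" "\<Phi> a \<in> U" and "a < b"
  shows "gap a b \<inter> U \<noteq> {}"
proof -
  obtain V where V: "open V" "U = D3 \<inter> V"
    using U(1) unfolding openin_open by blast
  have "open (\<Phi> -` V)"
    using continuous_on_Phi[of UNIV] V(1) by (simp add: continuous_on_open_vimage)
  then obtain \<delta> where \<delta>: "0 < \<delta>" "\<And>t. dist t a < \<delta> \<Longrightarrow> t \<in> \<Phi> -` V"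
    using U(2) V(2) unfolding open_dist by blast
  define t where "t = a + min (\<delta> / 2) ((b - a) / 2)"
  have "a < t" "t < b" "dist t a < \<delta>"
    using \<open>a < b\<close> \<delta>(1) unfolding t_def dist_real_def by (auto simp: min_def field_simps)
  then have "\<Phi> t \<in> gap a b \<inter> U"
    using \<delta>(2)[of t] V(2) by (auto simp: gap_def)
  then show ?thesis
    by blast
qed

lemma closure_gap: "closure (gap u v) \<subseteq> \<Phi> ` {u..v}"
proof (rule closure_minimal)
  show "closed (\<Phi> ` {u..v})"
    by (intro compact_imp_closed compact_continuous_image continuous_on_Phi) simp
qed (auto simp: gap_def)

text \<open>Orientation at \<open>x\<close> is decided by small parts of the branches, as a
  homeomorphism maps branches to branches. At a point inside a piece the glued map agrees nearby
  with one \<open>k n\<close>; at a point outside all pieces each piece lies within one branch, so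
  every branch is mapped to itself.\<close>

lemma glue_in_G:
  fixes u v :: "'i \<Rightarrow> real"
  defines "B \<equiv> \<lambda>n. gap (u n) (v n)"
  assumes uv: "\<And>n. n \<in> I \<Longrightarrow> sat (u n) (v n) \<and> u n < v n \<and> v n \<le> u n + 1 \<and> \<Phi> (u n) = \<Phi> (v n)"
    and disj: "disjoint_family_on B I"
    and k: "\<And>n. n \<in> I \<Longrightarrow> k n \<in> carrier G \<and> k n ` B n = B n \<and> k n (\<Phi> (u n)) = \<Phi> (u n)"
    and small: "\<And>\<epsilon>. 0 < \<epsilon> \<Longrightarrow> finite {n \<in> I. \<exists>x\<in>B n. \<exists>y\<in>B n. \<epsilon> \<le> dist x y}"
  shows "glue I B k \<in> carrier G"
proof -
  let ?g = "glue I B k"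
  have op: "openin (top_of_set D3) (B n)" if "n \<in> I" for n
    unfolding B_def using uv[OF that] by (intro sat_open) auto
  have BD: "B n \<subseteq> D3" for n
    by (auto simp: B_def gap_def)
  have fr: "x = \<Phi> (u n)" if n: "n \<in> I" and x: "x \<in> closure (B n)" "x \<notin> B n" for n x
  proof -
    have "x \<in> \<Phi> ` {u n..v n}"
      using closure_gap x(1) unfolding B_def by blast
    then obtain t where t: "u n \<le> t" "t \<le> v n" "x = \<Phi> t"
      by (metis atLeastAtMost_iff imageE)
    then have "t = u n \<or> t = v n"
      using x(2) unfolding B_def gap_def by force
    then show ?thesis
      using t uv[OF n] by auto
  qed
  have "\<exists>h. \<forall>n\<in>I. homeomorphism D3 D3 (k n) (h n)"
    using k unfolding mem_G_iff by (intro bchoice) blast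
  then obtain h where h: "\<And>n. n \<in> I \<Longrightarrow> homeomorphism D3 D3 (k n) (h n)"
    by blast
  have hk: "h n (k n x) = x" "k n (h n x) = x" if "n \<in> I" "x \<in> D3" for n x
    using h[OF that(1)] that(2) by (auto simp: homeomorphism_def)
  have hB: "h n ` B n = B n" if n: "n \<in> I" for n
  proof -
    have "h n ` B n = (\<lambda>x. h n (k n x)) ` B n"
      using k[OF n] by (metis image_image)
    also have "\<dots> = (\<lambda>x. x) ` B n"
      using hk(1)[OF n] BD by (intro image_cong) auto
    finally show ?thesis by simp
  qed
  have hu: "h n (\<Phi> (u n)) = \<Phi> (u n)" if n: "n \<in> I" for n
    using hk(1)[OF n, of "\<Phi> (u n)"] k[OF n] by simp
  have cg: "continuous_on D3 ?g"
  proof (rule continuous_on_glue[OF disj op _ _ _ small])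
    show "k n x = x" if "n \<in> I" "x \<in> closure (B n)" "x \<notin> B n" for n x
      using fr[OF that] k[OF that(1)] by simp
  qed (use k G_continuous in auto)
  have ch: "continuous_on D3 (glue I B h)"
  proof (rule continuous_on_glue[OF disj op _ _ _ small])
    show "continuous_on D3 (h n)" if "n \<in> I" for n
      using h[OF that] by (simp add: homeomorphism_def)
    show "h n x = x" if "n \<in> I" "x \<in> closure (B n)" "x \<notin> B n" for n x
      using fr[OF that] hu[OF that(1)] by simp
  qed (use hB in auto)
  have inv: "glue I B p (glue I B q x) = x" and maps: "glue I B q x \<in> D3"
    if x: "x \<in> D3" and pq: "\<And>n. n \<in> I \<Longrightarrow> q n ` B n = B n" "\<And>n x. n \<in> I \<Longrightarrow> x \<in> D3 \<Longrightarrow> p n (q n x) = x"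
    for p q x
  proof -
    have "glue I B p (glue I B q x) = x \<and> glue I B q x \<in> D3"
    proof (cases "\<exists>n\<in>I. x \<in> B n")
      case True
      then obtain n where n: "n \<in> I" "x \<in> B n"
        by blast
      then have qx: "q n x \<in> B n"
        using pq(1) by blast
      then have "q n x \<in> D3"
        using BD by blast
      then show ?thesis
        using glue_in[OF disj n x, of q] glue_in[OF disj n(1) qx, of p] pq(2)[OF n(1) x] by simp
    next
      case False
      then have "glue I B q x = x" "glue I B p x = x"
        using x by (auto intro!: glue_out)
      then show ?thesis
        using x by simp
    qed
    then show "glue I B p (glue I B q x) = x" "glue I B q x \<in> D3"
      by auto
  qed
  have homeo: "homeomorphism D3 D3 ?g (glue I B h)"
  proof (rule homeomorphismI[OF cg ch])
    show "?g ` D3 \<subseteq> D3" "glue I B h ` D3 \<subseteq> D3"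
      using maps[of _ k h] maps[of _ h k] k hB hk by auto
  qed (use inv[of _ k h] inv[of _ h k] k hB hk in auto)
  have br: "branches D3 (?g x) = image ?g ` branches D3 x" if "x \<in> D3" for x
    using homeomorphism_branches[OF homeo that] .
  have eq: "C = D" if "C \<in> branches D3 x" "D \<in> branches D3 x" "C \<inter> D \<noteq> {}" for C D x
    using that unfolding branches_def using components_nonoverlap by blast
  have "oriented_at ?g x" if x: "x \<in> branch_points D3" for x
  proof (cases "\<exists>n\<in>I. x \<in> B n")
    case True
    then obtain n where n: "n \<in> I" "x \<in> B n"
      by blast
    have xD: "x \<in> D3"
      using n BD by blast
    have gx: "?g x = k n x"
      by (rule glue_in[OF disj n xD])
    have "oriented_at (k n) x"
      using k[OF n(1)] x unfolding mem_G_iff by blast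
    then obtain x1 x2 x3 y1 y2 y3 where t: "tri x1 x2 x3 x" and y: "tri y1 y2 y3 (k n x)"
      and im: "k n ` gap x1 x2 = gap y1 y2" "k n ` gap x2 x3 = gap y2 y3" "k n ` gap x3 (x1 + 1) = gap y3 (y1 + 1)"
      by (rule oriented_atE)
    have same: "?g ` gap s t = k n ` gap s t" if st: "\<Phi> s = x" "s < t" "gap s t \<in> branches D3 x" for s t
    proof (rule eq)
      show "?g ` gap s t \<in> branches D3 (k n x)"
        using br[OF xD] st(3) unfolding gx by blast
      show "k n ` gap s t \<in> branches D3 (k n x)"
        using G_branch_image[of "k n" x] k[OF n(1)] xD st(3) by blast
      obtain z where z: "z \<in> gap s t" "z \<in> B n"
        using gap_meets_open[OF op[OF n(1)], of s t] st n(2) by auto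
      then have "?g z = k n z"
        using BD by (intro glue_in[OF disj n(1)]) auto
      then show "?g ` gap s t \<inter> k n ` gap s t \<noteq> {}"
        using z(1) by (metis IntI empty_iff imageI)
    qed
    have o: "x1 < x2" "x2 < x3" "x3 < x1 + 1" "\<Phi> x1 = x" "\<Phi> x2 = x" "\<Phi> x3 = x"
      using t by (auto simp: tri_def)
    show ?thesis
    proof (rule oriented_atI[OF t])
      show "tri y1 y2 y3 (?g x)"
        using y gx by simp
    qed (use same o im branches_gaps(1)[OF t] in auto)
  next
    case False
    have xD: "x \<in> D3"
      using x by (simp add: branch_points_def)
    have gx: "?g x = x"
      using False xD by (intro glue_out) auto
    have inside: "B n \<subseteq> A" if A: "A \<in> branches D3 x" and n: "n \<in> I" and ne: "B n \<inter> A \<noteq> {}" for A n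
    proof -
      have "connected (B n)"
        unfolding B_def gap_def by (intro connected_continuous_image continuous_on_Phi) simp
      moreover have "B n \<subseteq> D3 - {x}"
        using BD False n by blast
      ultimately show ?thesis
        using components_maximal A ne unfolding branches_def by blast
    qed
    have keep: "?g ` A = A" if A: "A \<in> branches D3 x" for A
    proof (rule eq)
      show "?g ` A \<in> branches D3 x"
        using br[OF xD] A unfolding gx by blast
      have AD: "A \<subseteq> D3" and "A \<noteq> {}"
        using A unfolding branches_def
        by (meson Diff_subset in_components_subset order_trans, metis in_components_nonempty)
      have "?g y \<in> A" if y: "y \<in> A" for y
      proof (cases "\<exists>n\<in>I. y \<in> B n")
        case True
        then obtain n where n: "n \<in> I" "y \<in> B n"
          by blast
        have "?g y = k n y"
          using y AD by (intro glue_in[OF disj n]) auto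
        moreover have "k n y \<in> B n"
          using k[OF n(1)] n(2) by blast
        ultimately show ?thesis
          using inside[OF A n(1)] n(2) y by auto
      next
        case False
        then have "?g y = y"
          using y AD by (intro glue_out) auto
        then show ?thesis
          using y by simp
      qed
      then show "?g ` A \<inter> A \<noteq> {}"
        using \<open>A \<noteq> {}\<close> by blast
    qed (rule A)
    obtain x1 x2 x3 where t: "tri x1 x2 x3 x"
      using x branch_point_iff by blast
    show ?thesis
    proof (rule oriented_atI[OF t])
      show "tri x1 x2 x3 (?g x)"
        using t gx by simp
    qed (use keep branches_gaps(1)[OF t] in auto)
  qed
  moreover have "?g \<in> extensional D3"
    by (simp add: glue_def)
  ultimately show ?thesis
    using homeo unfolding mem_G_iff by blast
qed

end

section \<open>The rotation around the fixed point and the translation\<close>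

context riemann_exterior
begin

section \<open>The half turn, and comparison of fibres piece by piece\<close>

lemma lamination_map_half: "lamination_map (\<lambda>t. t + 1/2)"
proof -
  have "\<exists>x. y = x + 1/2" for y :: real
    by (rule exI[of _ "y - 1/2"]) simp
  then show ?thesis
    unfolding lamination_map_def surj_def by (auto intro: strict_monoI simp: Phi_add_half)
qed

lemma Phi_double_iff:
  assumes a: "1/12 \<le> a + of_int m" "a + of_int m \<le> 7/12" and b: "1/12 \<le> b + of_int n" "b + of_int n \<le> 7/12"
  shows "\<Phi> (2 * a) = \<Phi> (2 * b) \<longleftrightarrow> \<Phi> a = \<Phi> b"
proof -
  have "\<Phi> (2 * (a + of_int m)) = \<Phi> (2 * a)" "\<Phi> (2 * (b + of_int n)) = \<Phi> (2 * b)"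
    unfolding Phi_double by simp_all
  then show ?thesis
    using Phi_double_left[OF a b] by simp
qed

lemma Phi_double_right:
  assumes a: "7/12 \<le> a" "a \<le> 13/12" and b: "7/12 \<le> b" "b \<le> 13/12"
  shows "\<Phi> (2 * a) = \<Phi> (2 * b) \<longleftrightarrow> \<Phi> a = \<Phi> b"
proof -
  have "\<Phi> (2 * (a - 1/2)) = \<Phi> (2 * a)" "\<Phi> (2 * (b - 1/2)) = \<Phi> (2 * b)"
    by (simp_all only: Phi_double Phi_diff_half quad_minus)
  then show ?thesis
    using Phi_double_left[of "a - 1/2" "b - 1/2"] a b by (simp add: Phi_diff_half)
qed

lemma sat_window:
  assumes "sat u v" "u < a" "a < v" "\<Phi> a = \<Phi> b" "v - 1 \<le> b" "b \<le> u + 1"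
  shows "u < b \<and> b < v"
proof -
  obtain k :: int where k: "u < b + k" "b + k < v"
    using satD[OF assms(1-4)] .
  have "k = 0"
    using k assms(5,6) by (intro int_eq_0) auto
  then show ?thesis
    using k by simp
qed

lemma sector_classes:
  assumes a: "1/7 \<le> a" "a < 8/7" and b: "1/7 \<le> b" "b < 8/7" and eq: "\<Phi> a = \<Phi> b"
  shows "a \<in> {1/7, 2/7, 4/7} \<and> b \<in> {1/7, 2/7, 4/7} \<or>
    1/7 < a \<and> a < 2/7 \<and> 1/7 < b \<and> b < 2/7 \<or> 2/7 < a \<and> a < 4/7 \<and> 2/7 < b \<and> b < 4/7 \<or>
    4/7 < a \<and> a < 8/7 \<and> 4/7 < b \<and> b < 8/7"
proof (cases "\<Phi> a = \<beta>")
  case True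
  have "a \<in> {1/7, 2/7, 4/7}"
    by (rule Phi_eq_beta_window[OF True a])
  moreover have "b \<in> {1/7, 2/7, 4/7}"
    using eq True b by (intro Phi_eq_beta_window) auto
  ultimately show ?thesis
    by blast
next
  case False
  then have "a \<noteq> 1/7" "a \<noteq> 2/7" "a \<noteq> 4/7"
    using Phi_sevenths by metis+
  then consider "1/7 < a" "a < 2/7" | "2/7 < a" "a < 4/7" | "4/7 < a"
    using a by linarith
  then show ?thesis
  proof cases
    case 1
    then show ?thesis using sat_window[OF sat_sectors(1) 1 eq] b by auto
  next
    case 2
    then show ?thesis using sat_window[OF sat_sectors(2) 2 eq] b by auto
  next
    case 3
    then show ?thesis using sat_window[OF sat_sectors(3) 3 a(2) eq] a b by auto
  qed
qed

text \<open>On the third branch, where \<open>quad\<close> is not injective, the inverse of \<open>quad \<circ> quad\<close> closes the cycle.\<close>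

lemma rotation_exists:
  "\<exists>H. lamination_map H \<and> (\<forall>t. 1/7 \<le> t \<longrightarrow> t \<le> 4/7 \<longrightarrow> H t = 2 * t) \<and>
     (\<forall>t. 4/7 \<le> t \<longrightarrow> t < 8/7 \<longrightarrow> H t = t/4 + 1)"
proof -
  \<comment> \<open>Doubling maps each of the first two sectors onto the next. Division by 4 takes
    the arc from 4/7 to 8/7 back to the one from 1/7 to 2/7, and the summand 1 keeps the lift
    increasing.\<close>
  define H0 where "H0 = (\<lambda>t::real. if t \<le> 4/7 then 2 * t else t/4 + 1)"
  have "\<exists>H. lamination_map H \<and> (\<forall>t. 1/7 \<le> t \<longrightarrow> t < 1/7 + 1 \<longrightarrow> H t = H0 t)"
  proof (rule periodic_extension)
    fix s t :: real assume "1/7 \<le> s" "s < t" "t < 1/7 + 1"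
    then show "H0 s < H0 t"
      by (auto simp: H0_def)
  next
    fix t :: real assume "1/7 \<le> t" "t < 1/7 + 1"
    then show "2/7 \<le> H0 t \<and> H0 t < 2/7 + 1"
      by (auto simp: H0_def)
  next
    fix y :: real assume y: "2/7 \<le> y" "y < 2/7 + 1"
    show "\<exists>t. 1/7 \<le> t \<and> t < 1/7 + 1 \<and> H0 t = y"
    proof (cases "y \<le> 8/7")
      case True
      then show ?thesis
        using y by (intro exI[of _ "y/2"]) (auto simp: H0_def)
    next
      case False
      then show ?thesis
        using y by (intro exI[of _ "4 * (y - 1)"]) (auto simp: H0_def diff_divide_distrib)
    qed
  next
    fix a b :: real assume a: "1/7 \<le> a" "a < 1/7 + 1" and b: "1/7 \<le> b" "b < 1/7 + 1"
    have sp: "\<Phi> (H0 t) = \<beta> \<and> \<Phi> t = \<beta>" if "t \<in> {1/7, 2/7, 4/7}" for t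
    proof -
      have "\<Phi> t = \<beta>"
        using that Phi_sevenths by blast
      moreover have "H0 t = 2 * t"
        using that by (auto simp: H0_def)
      ultimately show ?thesis
        by (simp add: Phi_double quad_beta)
    qed
    have p12: "\<Phi> (H0 a) = \<Phi> (H0 b) \<longleftrightarrow> \<Phi> a = \<Phi> b" if "a \<le> 4/7" "b \<le> 4/7"
      using Phi_double_left[of a b] a b that by (simp add: H0_def)
    have p3: "\<Phi> (H0 a) = \<Phi> (H0 b) \<longleftrightarrow> \<Phi> a = \<Phi> b" if "4/7 < a" "4/7 < b"
      using Phi_double_left[of "a/4" "b/4"] Phi_double_left[of "a/2" "b/2"] a b that by (simp add: H0_def)
    show "\<Phi> (H0 a) = \<Phi> (H0 b) \<longleftrightarrow> \<Phi> a = \<Phi> b"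
    proof
      assume eq: "\<Phi> a = \<Phi> b"
      show "\<Phi> (H0 a) = \<Phi> (H0 b)"
        using sector_classes[of a b] a b eq sp[of a] sp[of b] p12 p3 by auto
    next
      assume eq: "\<Phi> (H0 a) = \<Phi> (H0 b)"
      \<comment> \<open>The values of \<open>H0\<close> fill the window from 2/7 to 9/7;
        \<open>N\<close> returns them to the window from 1/7 to 8/7 of
        \<open>sector_classes\<close>.\<close>
      define N where "N = (\<lambda>t. if H0 t < 8/7 then H0 t else H0 t - 1)"
      have "\<Phi> (N a) = \<Phi> (N b)"
        using eq by (simp add: N_def)
      moreover have "1/7 \<le> N t \<and> N t < 8/7 \<and> (N t \<in> {1/7, 2/7, 4/7} \<longrightarrow> t \<in> {1/7, 2/7, 4/7}) \<and>
          (4/7 < N t \<longrightarrow> t \<le> 4/7) \<and> (2/7 < N t \<and> N t < 4/7 \<longrightarrow> t \<le> 4/7) \<and> (1/7 < N t \<and> N t < 2/7 \<longrightarrow> 4/7 < t)"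
        if "1/7 \<le> t" "t < 1/7 + 1" for t
        using that unfolding N_def H0_def by auto
      ultimately have "a \<in> {1/7, 2/7, 4/7} \<and> b \<in> {1/7, 2/7, 4/7} \<or> a \<le> 4/7 \<and> b \<le> 4/7 \<or> 4/7 < a \<and> 4/7 < b"
        using sector_classes[of "N a" "N b"] a b by blast
      then show "\<Phi> a = \<Phi> b"
        using sp[of a] sp[of b] p12 p3 eq by auto
    qed
  qed
  then obtain H where H: "lamination_map H" "\<And>t. 1/7 \<le> t \<Longrightarrow> t < 1/7 + 1 \<Longrightarrow> H t = H0 t"
    by blast
  show ?thesis
    using H by (intro exI[of _ H]) (auto simp: H0_def)
qed

lemma outer_inner_cells:
  assumes s: "4/7 < s" "s < 8/7" and t: "4/7 < t" "t < 8/7" and eq: "\<Phi> s = \<Phi> t"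
  shows "(s \<le> 7/12 \<or> 13/12 \<le> s) \<and> (t \<le> 7/12 \<or> 13/12 \<le> t) \<or>
    7/12 \<le> s \<and> s \<le> 13/12 \<and> 7/12 \<le> t \<and> t \<le> 13/12"
proof -
  have opp: False if "s < 7/12 \<or> 13/12 < s" "7/12 < t" "t < 13/12" "4/7 < s" "s < 8/7" "\<Phi> s = \<Phi> t" for s t
  proof -
    have "\<Phi> (s - 1) = \<Phi> s"
      by simp
    then show ?thesis
      using that Phi_opposite_sides[of s t] Phi_opposite_sides[of "s - 1" t] by fastforce
  qed
  show ?thesis
  proof -
    have "\<not> ((s < 7/12 \<or> 13/12 < s) \<and> 7/12 < t \<and> t < 13/12)"
      using opp[of s t] s eq by blast
    moreover have "\<not> ((t < 7/12 \<or> 13/12 < t) \<and> 7/12 < s \<and> s < 13/12)"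
      using opp[of t s] t eq by auto
    ultimately show ?thesis
      by argo
  qed
qed

text \<open>The map \<open>h\<close> translates along the arc from \<open>\<beta>\<close> to \<open>- \<i>\<close> in the branch \<open>\<Phi> (4/7, 8/7)\<close>. It
  refines the subdivision of that branch into cells in its first cell and maps it to the
  subdivision that refines the last cell, as the standard generator of Thompson's group does.\<close>

lemma translation_exists:
  "\<exists>H. lamination_map H \<and> (\<forall>t. 8/7 \<le> t \<longrightarrow> t < 11/7 \<longrightarrow> H t = t) \<and>
     (\<forall>t. 4/7 \<le> t \<longrightarrow> t \<le> 65/112 \<longrightarrow> H t = 8 * t - 4) \<and>
     (\<forall>t. 65/112 \<le> t \<longrightarrow> t \<le> 7/12 \<longrightarrow> H t = t + 1/16) \<and>
     (\<forall>t. 7/12 \<le> t \<longrightarrow> t \<le> 13/12 \<longrightarrow> H t = (t + 2) / 4) \<and>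
     (\<forall>t. 13/12 \<le> t \<longrightarrow> t \<le> 123/112 \<longrightarrow> H t = t - 5/16) \<and>
     (\<forall>t. 123/112 \<le> t \<longrightarrow> t \<le> 8/7 \<longrightarrow> H t = 8 * t - 8)"
proof -
  \<comment> \<open>\<open>8 * t - 4\<close> sends 65/112 to 9/14 and \<open>8 * t - 8\<close> sends
    123/112 to 11/14, which are angles of \<open>- \<beta>\<close>. The piece of slope 1/4 joins the
    angles 7/12 and 13/12 of 0 and fixes 2/3. The shifts by 1/16 and 5/16 are those that fit
    continuously in between.\<close>
  define H0 where "H0 = (\<lambda>t::real. if t \<le> 65/112 then 8 * t - 4 else if t \<le> 7/12 then t + 1/16
    else if t \<le> 13/12 then (t + 2) / 4 else if t \<le> 123/112 then t - 5/16
    else if t \<le> 8/7 then 8 * t - 8 else t)"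
  have "\<exists>H. lamination_map H \<and> (\<forall>t. 4/7 \<le> t \<longrightarrow> t < 4/7 + 1 \<longrightarrow> H t = H0 t)"
  proof (rule periodic_extension)
    fix s t :: real assume "4/7 \<le> s" "s < t" "t < 4/7 + 1"
    then show "H0 s < H0 t"
      by (auto simp: H0_def)
  next
    fix t :: real assume "4/7 \<le> t" "t < 4/7 + 1"
    then show "4/7 \<le> H0 t \<and> H0 t < 4/7 + 1"
      by (auto simp: H0_def)
  next
    fix y :: real assume y: "4/7 \<le> y" "y < 4/7 + 1"
    consider "y \<le> 9/14" | "9/14 < y" "y \<le> 31/48" | "31/48 < y" "y \<le> 37/48" | "37/48 < y" "y \<le> 11/14"
      | "11/14 < y" "y \<le> 8/7" | "8/7 < y"
      by linarith
    then show "\<exists>t. 4/7 \<le> t \<and> t < 4/7 + 1 \<and> H0 t = y"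
    proof cases
      case 1 then show ?thesis using y by (intro exI[of _ "(y + 4) / 8"]) (auto simp: H0_def add_divide_distrib)
    next
      case 2 then show ?thesis using y by (intro exI[of _ "y - 1/16"]) (auto simp: H0_def)
    next
      case 3 then show ?thesis using y by (intro exI[of _ "4 * y - 2"]) (auto simp: H0_def)
    next
      case 4 then show ?thesis using y by (intro exI[of _ "y + 5/16"]) (auto simp: H0_def)
    next
      case 5 then show ?thesis using y by (intro exI[of _ "(y + 8) / 8"]) (auto simp: H0_def add_divide_distrib)
    next
      case 6 then show ?thesis using y by (intro exI[of _ y]) (auto simp: H0_def)
    qed
  next
    fix a b :: real assume a: "4/7 \<le> a" "a < 4/7 + 1" and b: "4/7 \<le> b" "b < 4/7 + 1"
    define idp where "idp = (\<lambda>t::real. t = 4/7 \<or> 8/7 \<le> t)"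
    define outer where "outer = (\<lambda>t::real. 4/7 < t \<and> t \<le> 65/112 \<or> 123/112 \<le> t \<and> t < 8/7)"
    define middle where "middle = (\<lambda>t::real. 65/112 < t \<and> t \<le> 7/12 \<or> 13/12 \<le> t \<and> t < 123/112)"
    define inner where "inner = (\<lambda>t::real. 7/12 \<le> t \<and> t \<le> 13/12)"
    \<comment> \<open>Multiplication by 8 modulo 1 unfolds the cell between \<open>\<beta>\<close>
      and 0 onto the branch; \<open>middle\<close> is the part of the cell that goes to the arc from
      9/14 to 11/14, apart from the angles of 0 that it shares with \<open>inner\<close>, and
      \<open>outer\<close> is the rest.\<close>
    define \<tau> where "\<tau> = (\<lambda>t::real. if t \<le> 7/12 then 8 * t - 4 else 8 * t - 8)"
    have tau8: "\<Phi> (\<tau> t) = \<Phi> (8 * t)" for t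
      using Phi_add_int[of "8 * t" "-4"] Phi_add_int[of "8 * t" "-8"] by (simp add: \<tau>_def)
    have cell_iff: "\<Phi> (4 * s) = \<Phi> (4 * t) \<longleftrightarrow> \<Phi> s = \<Phi> t" "\<Phi> (8 * s) = \<Phi> (8 * t) \<longleftrightarrow> \<Phi> s = \<Phi> t"
      if s: "4/7 < s \<and> s \<le> 7/12 \<or> 13/12 \<le> s \<and> s < 8/7" and t: "4/7 < t \<and> t \<le> 7/12 \<or> 13/12 \<le> t \<and> t < 8/7" for s t
    proof -
      have m: "\<exists>m::int. 1/12 \<le> s + m \<and> s + m \<le> 7/12" "\<exists>m::int. 1/12 \<le> 2 * s + m \<and> 2 * s + m \<le> 7/12"
        "\<exists>m::int. 1/12 \<le> 4 * s + m \<and> 4 * s + m \<le> 7/12"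
        if "4/7 < s \<and> s \<le> 7/12 \<or> 13/12 \<le> s \<and> s < 8/7" for s :: real
      proof -
        show "\<exists>m::int. 1/12 \<le> s + m \<and> s + m \<le> 7/12"
          using that by (intro exI[of _ "if s \<le> 7/12 then 0 else -1"]) auto
        show "\<exists>m::int. 1/12 \<le> 2 * s + m \<and> 2 * s + m \<le> 7/12"
          using that by (intro exI[of _ "if s \<le> 7/12 then -1 else -2"]) auto
        show "\<exists>m::int. 1/12 \<le> 4 * s + m \<and> 4 * s + m \<le> 7/12"
          using that by (intro exI[of _ "if s \<le> 7/12 then -2 else -4"]) auto
      qed
      have "\<Phi> (2 * s) = \<Phi> (2 * t) \<longleftrightarrow> \<Phi> s = \<Phi> t"
        using m(1)[OF s] m(1)[OF t] Phi_double_iff by blast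
      moreover have "\<Phi> (2 * (2 * s)) = \<Phi> (2 * (2 * t)) \<longleftrightarrow> \<Phi> (2 * s) = \<Phi> (2 * t)"
        using m(2)[OF s] m(2)[OF t] Phi_double_iff by blast
      moreover have "\<Phi> (2 * (4 * s)) = \<Phi> (2 * (4 * t)) \<longleftrightarrow> \<Phi> (4 * s) = \<Phi> (4 * t)"
        using m(3)[OF s] m(3)[OF t] Phi_double_iff by blast
      ultimately show "\<Phi> (4 * s) = \<Phi> (4 * t) \<longleftrightarrow> \<Phi> s = \<Phi> t" "\<Phi> (8 * s) = \<Phi> (8 * t) \<longleftrightarrow> \<Phi> s = \<Phi> t"
        by simp_all
    qed
    note eight = cell_iff(2)
    have four: "\<Phi> (4 * s - 2) = \<Phi> (4 * t - 2) \<longleftrightarrow> \<Phi> s = \<Phi> t"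
      if s: "9/14 < s" "s < 11/14" and t: "9/14 < t" "t < 11/14" for s t
    proof -
      have "\<Phi> (2 * s) = \<Phi> (2 * t) \<longleftrightarrow> \<Phi> s = \<Phi> t"
        using s t by (intro Phi_double_right) auto
      moreover have "\<Phi> (2 * (2 * s)) = \<Phi> (2 * (2 * t)) \<longleftrightarrow> \<Phi> (2 * s) = \<Phi> (2 * t)"
        using s t by (intro Phi_double_iff[of _ "-1" _ "-1"]) auto
      moreover have "\<Phi> (4 * s - 2) = \<Phi> (4 * s)" for s
        using Phi_add_int[of "4 * s" "-2"] by simp
      ultimately show ?thesis
        by simp
    qed
    have pi: "\<Phi> (H0 s) = \<Phi> (H0 t) \<longleftrightarrow> \<Phi> s = \<Phi> t" if "idp s" "idp t" for s t
    proof -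
      have "H0 t = t" if "idp t" for t
        using that unfolding idp_def H0_def by auto
      then show ?thesis
        using that by simp
    qed
    have po: "\<Phi> (H0 s) = \<Phi> (H0 t) \<longleftrightarrow> \<Phi> s = \<Phi> t" if "outer s" "outer t" for s t
    proof -
      have "\<Phi> (H0 t) = \<Phi> (8 * t)" if "outer t" for t
      proof -
        have "H0 t = \<tau> t"
          using that by (auto simp: outer_def H0_def \<tau>_def)
        then show ?thesis
          by (simp add: tau8)
      qed
      then show ?thesis
        using eight[of s t] that by (auto simp: outer_def)
    qed
    have pn: "\<Phi> (H0 s) = \<Phi> (H0 t) \<longleftrightarrow> \<Phi> s = \<Phi> t" if "inner s" "inner t" for s t
    proof -
      have H: "4 * H0 t - 2 = t" "9/14 < H0 t" "H0 t < 11/14" if "inner t" for t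
      proof -
        have "H0 t = (t + 2) / 4" "7/12 \<le> t" "t \<le> 13/12"
          using that by (auto simp: inner_def H0_def)
        then show "4 * H0 t - 2 = t" "9/14 < H0 t" "H0 t < 11/14"
          by simp_all
      qed
      show ?thesis
        using four[OF H(2,3)[OF that(1)] H(2,3)[OF that(2)]] H(1)[OF that(1)] H(1)[OF that(2)] by simp
    qed
    have pm: "\<Phi> (H0 s) = \<Phi> (H0 t) \<longleftrightarrow> \<Phi> s = \<Phi> t" if s: "middle s" and t: "middle t" for s t
    proof -
      have H: "9/14 < H0 t" "H0 t < 11/14"
        "4/7 < 4 * H0 t - 2 \<and> 4 * H0 t - 2 \<le> 7/12 \<or> 13/12 \<le> 4 * H0 t - 2 \<and> 4 * H0 t - 2 < 8/7"
        "\<Phi> (4 * (4 * H0 t - 2)) = \<Phi> (16 * t)"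
        "7/12 \<le> \<tau> t" "\<tau> t \<le> 13/12" "4/7 < t \<and> t \<le> 7/12 \<or> 13/12 \<le> t \<and> t < 8/7"
        "\<Phi> (2 * \<tau> t) = \<Phi> (16 * t)"
        if t: "middle t" for t
      proof -
        have "65/112 < t \<and> t \<le> 7/12 \<and> H0 t = t + 1/16 \<or> 13/12 \<le> t \<and> t < 123/112 \<and> H0 t = t - 5/16"
          using t by (auto simp: middle_def H0_def)
        then show "9/14 < H0 t" "H0 t < 11/14"
          "4/7 < 4 * H0 t - 2 \<and> 4 * H0 t - 2 \<le> 7/12 \<or> 13/12 \<le> 4 * H0 t - 2 \<and> 4 * H0 t - 2 < 8/7"
          "\<Phi> (4 * (4 * H0 t - 2)) = \<Phi> (16 * t)"
          using Phi_add_int[of "16 * t" "-7"] Phi_add_int[of "16 * t" "-13"] by auto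
        show "7/12 \<le> \<tau> t" "\<tau> t \<le> 13/12" "4/7 < t \<and> t \<le> 7/12 \<or> 13/12 \<le> t \<and> t < 8/7"
          "\<Phi> (2 * \<tau> t) = \<Phi> (16 * t)"
          using t Phi_add_int[of "16 * t" "-8"] Phi_add_int[of "16 * t" "-16"]
          by (auto simp: middle_def \<tau>_def)
      qed
      \<comment> \<open>On the middle piece \<open>H0\<close> is a piecewise shift and not a
        multiplication. But \<open>16 * t\<close> is reached modulo 1 from \<open>t\<close> and from
        \<open>H0 t\<close>, and each of the multiplications involved preserves and separates fibres
        on the arcs where it is used.\<close>
      have "\<Phi> (H0 s) = \<Phi> (H0 t) \<longleftrightarrow> \<Phi> (4 * H0 s - 2) = \<Phi> (4 * H0 t - 2)"
        using four H(1,2)[OF s] H(1,2)[OF t] by blast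
      also have "\<dots> \<longleftrightarrow> \<Phi> (16 * s) = \<Phi> (16 * t)"
        using cell_iff(1)[OF H(3)[OF s] H(3)[OF t]] H(4)[OF s] H(4)[OF t] by simp
      also have "\<dots> \<longleftrightarrow> \<Phi> (2 * \<tau> s) = \<Phi> (2 * \<tau> t)"
        using H(8)[OF s] H(8)[OF t] by simp
      also have "\<dots> \<longleftrightarrow> \<Phi> (\<tau> s) = \<Phi> (\<tau> t)"
        using H(5,6)[OF s] H(5,6)[OF t] by (intro Phi_double_right)
      also have "\<dots> \<longleftrightarrow> \<Phi> s = \<Phi> t"
        unfolding tau8 by (rule eight[OF H(7)[OF s] H(7)[OF t]])
      finally show ?thesis .
    qed
    have window: "idp s \<and> idp t \<or> 4/7 < s \<and> s < 8/7 \<and> 4/7 < t \<and> t < 8/7"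
      if s: "4/7 \<le> s" "s < 4/7 + 1" and t: "4/7 \<le> t" "t < 4/7 + 1" and eq: "\<Phi> s = \<Phi> t" for s t
    proof -
      have "4/7 < s \<and> s < 8/7 \<longleftrightarrow> 4/7 < t \<and> t < 8/7"
        using sat_window[OF sat_sectors(3), of s t] sat_window[OF sat_sectors(3), of t s] s t eq by auto
      then show ?thesis
        using s t unfolding idp_def by linarith
    qed
    have in_middle: "9/14 < s \<and> s < 11/14 \<longleftrightarrow> 9/14 < t \<and> t < 11/14"
      if s: "4/7 < s" "s < 8/7" and t: "4/7 < t" "t < 8/7" and eq: "\<Phi> s = \<Phi> t" for s t
      using sat_window[OF sat_minus_sectors(1), of s t] sat_window[OF sat_minus_sectors(1), of t s] s t eq by auto
    have pieces: "outer s \<and> outer t \<or> middle s \<and> middle t \<or> inner s \<and> inner t"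
      if s: "4/7 < s" "s < 8/7" and t: "4/7 < t" "t < 8/7" and eq: "\<Phi> s = \<Phi> t" for s t
      using outer_inner_cells[OF s t eq]
    proof
      assume st: "(s \<le> 7/12 \<or> 13/12 \<le> s) \<and> (t \<le> 7/12 \<or> 13/12 \<le> t)"
      then have "\<Phi> (\<tau> s) = \<Phi> (\<tau> t)"
        unfolding tau8 using s t eq by (subst eight) auto
      moreover have T: "4/7 < \<tau> t \<and> \<tau> t < 8/7" "9/14 < \<tau> t \<and> \<tau> t < 11/14 \<Longrightarrow> middle t"
        "\<not> (9/14 < \<tau> t \<and> \<tau> t < 11/14) \<Longrightarrow> outer t"
        if "t \<le> 7/12 \<or> 13/12 \<le> t" "4/7 < t" "t < 8/7" for t
        using that unfolding \<tau>_def middle_def outer_def by (auto split: if_splits)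
      ultimately show ?thesis
        using in_middle[of "\<tau> s" "\<tau> t"] T[of s] T[of t] st s t by blast
    qed (simp add: inner_def)
    have H0_E: "4/7 < H0 t \<and> H0 t < 8/7" if "4/7 < t" "t < 8/7" for t
      using that by (auto simp: H0_def)
    have pieces': "outer s \<and> outer t \<or> middle s \<and> middle t \<or> inner s \<and> inner t"
      if s: "4/7 < s" "s < 8/7" and t: "4/7 < t" "t < 8/7" and eq: "\<Phi> (H0 s) = \<Phi> (H0 t)" for s t
    proof (cases "9/14 < H0 s \<and> H0 s < 11/14")
      case False
      then have "\<not> (9/14 < H0 t \<and> H0 t < 11/14)"
        using in_middle[of "H0 s" "H0 t"] H0_E s t eq by blast
      moreover have "outer t" if "\<not> (9/14 < H0 t \<and> H0 t < 11/14)" "4/7 < t" "t < 8/7" for t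
        using that unfolding H0_def outer_def by (auto split: if_splits)
      ultimately show ?thesis
        using False s t by blast
    next
      case True
      then have t': "9/14 < H0 t \<and> H0 t < 11/14"
        using in_middle[of "H0 s" "H0 t"] H0_E s t eq by blast
      have "\<Phi> (4 * H0 s - 2) = \<Phi> (4 * H0 t - 2)"
        using four[of "H0 s" "H0 t"] True t' eq by blast
      then have "(4 * H0 s - 2 \<le> 7/12 \<or> 13/12 \<le> 4 * H0 s - 2) \<and> (4 * H0 t - 2 \<le> 7/12 \<or> 13/12 \<le> 4 * H0 t - 2) \<or>
          7/12 \<le> 4 * H0 s - 2 \<and> 4 * H0 s - 2 \<le> 13/12 \<and> 7/12 \<le> 4 * H0 t - 2 \<and> 4 * H0 t - 2 \<le> 13/12"
        using True t' by (intro outer_inner_cells) auto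
      moreover have "4 * H0 t - 2 \<le> 7/12 \<or> 13/12 \<le> 4 * H0 t - 2 \<Longrightarrow> middle t"
        "7/12 \<le> 4 * H0 t - 2 \<and> 4 * H0 t - 2 \<le> 13/12 \<Longrightarrow> inner t"
        if "9/14 < H0 t \<and> H0 t < 11/14" "4/7 < t" "t < 8/7" for t
        using that unfolding H0_def middle_def inner_def by (auto split: if_splits)
      ultimately show ?thesis
        using True t' s t by blast
    qed
    show "\<Phi> (H0 a) = \<Phi> (H0 b) \<longleftrightarrow> \<Phi> a = \<Phi> b"
    proof
      assume eq: "\<Phi> a = \<Phi> b"
      then show "\<Phi> (H0 a) = \<Phi> (H0 b)"
        using window[OF a b eq] pieces[of a b] pi po pm pn by blast
    next
      assume eq: "\<Phi> (H0 a) = \<Phi> (H0 b)"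
      have im: "4/7 \<le> H0 t \<and> H0 t < 4/7 + 1" "idp (H0 t) \<Longrightarrow> idp t"
        "4/7 < H0 t \<and> H0 t < 8/7 \<Longrightarrow> 4/7 < t \<and> t < 8/7" if "4/7 \<le> t" "t < 4/7 + 1" for t
        using that unfolding H0_def idp_def by (auto split: if_splits)
      have "idp a \<and> idp b \<or> 4/7 < a \<and> a < 8/7 \<and> 4/7 < b \<and> b < 8/7"
        using window[of "H0 a" "H0 b"] im[OF a] im[OF b] eq by blast
      then show "\<Phi> a = \<Phi> b"
        using pieces'[of a b] pi po pm pn eq by blast
    qed
  qed
  then obtain H where H: "lamination_map H" "\<And>t. 4/7 \<le> t \<Longrightarrow> t < 4/7 + 1 \<Longrightarrow> H t = H0 t"
    by blast
  show ?thesis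
    using H by (intro exI[of _ H]) (auto simp: H0_def)
qed

end

section \<open>The gliding hump on the circle\<close>

lemma funpow_mono_strict:
  fixes f :: "real \<Rightarrow> real"
  assumes "strict_mono f" "f x > x"
  shows "incseq (\<lambda>n. (f ^^ n) x)"
proof (rule incseq_SucI)
  fix n show "(f ^^ n) x \<le> (f ^^ Suc n) x"
    using assms(2) by (induction n) (auto simp: strict_mono_less_eq[OF assms(1)])
qed

text \<open>Let \<open>p\<close> be the last fixed point below the moving point \<open>t0\<close>. A
  point slightly above \<open>p\<close> increases to a fixed point, and there is none between
  \<open>p\<close> and \<open>t0\<close>; so it is carried beyond \<open>t0\<close>, however close
  to \<open>p\<close> it started.\<close>

lemma iterates_leave_fixed_point_right:
  fixes f :: "real \<Rightarrow> real"
  assumes mono: "strict_mono f" and cont: "continuous_on UNIV f" and per: "\<And>t. f (t - 2 * pi) = f t - 2 * pi"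
    and bd: "\<And>n t. \<bar>(f ^^ n) t - t\<bar> < pi / 3" and t0: "t0 < f t0"
  shows "\<exists>p d. 0 < d \<and> f p = p \<and> (\<forall>\<delta>>0. \<exists>x n. \<bar>x - p\<bar> < \<delta> \<and> d \<le> \<bar>(f ^^ n) x - p\<bar>)"
proof -
  have fixed_limit: "\<exists>L. f L = L \<and> x < L \<and> (\<forall>n. (f ^^ n) x \<le> L) \<and> (\<lambda>n. (f ^^ n) x) \<longlonglongrightarrow> L" if x: "x < f x" for x
  proof -
    have inc: "incseq (\<lambda>n. (f ^^ n) x)"
      by (rule funpow_mono_strict[OF mono x])
    have "(f ^^ n) x \<le> x + pi / 3" for n
      using bd[of n x] by linarith
    then obtain L where L: "(\<lambda>n. (f ^^ n) x) \<longlonglongrightarrow> L" "\<forall>n. (f ^^ n) x \<le> L"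
      using incseq_convergent[OF inc, of "x + pi / 3"] by blast
    have "(\<lambda>n. f ((f ^^ n) x)) \<longlonglongrightarrow> f L"
      using continuous_on_tendsto_compose[OF cont L(1)] by simp
    moreover have "(\<lambda>n. f ((f ^^ n) x)) \<longlonglongrightarrow> L"
      using LIMSEQ_Suc[OF L(1)] by simp
    ultimately have "f L = L"
      using LIMSEQ_unique by blast
    moreover have "x < L"
      using L(2)[rule_format, of 1] x by simp
    ultimately show ?thesis
      using L by blast
  qed
  obtain q where q: "f q = q" "\<forall>n. (f ^^ n) t0 \<le> q" "(\<lambda>n. (f ^^ n) t0) \<longlonglongrightarrow> q"
    using fixed_limit[OF t0] by blast
  \<comment> \<open>The fixed point \<open>q\<close> above \<open>t0\<close> is less than a period
    away, so its translate by a period is a fixed point below \<open>t0\<close>; this makes the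
    supremum that defines \<open>p\<close> meaningful.\<close>
  have "q \<le> t0 + pi / 3"
  proof (rule LIMSEQ_le_const2[OF q(3)], intro exI allI impI)
    fix n show "(f ^^ n) t0 \<le> t0 + pi / 3"
      using bd[of n t0] by linarith
  qed
  moreover have "0 < pi"
    by simp
  ultimately have "q - 2 * pi \<le> t0"
    by linarith
  moreover have "f (q - 2 * pi) = q - 2 * pi"
    using per q(1) by simp
  ultimately have ne: "{x. x \<le> t0 \<and> f x = x} \<noteq> {}"
    by blast
  have cl: "closed {x. x \<le> t0 \<and> f x = x}"
    by (intro closed_Collect_conj closed_Collect_le closed_Collect_eq continuous_intros cont)
  have bdd: "bdd_above {x. x \<le> t0 \<and> f x = x}"
    by (rule bdd_aboveI[of _ t0]) auto
  define p where "p = Sup {x. x \<le> t0 \<and> f x = x}"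
  have p: "p \<le> t0" "f p = p"
    using closed_contains_Sup[OF ne bdd cl] by (simp_all add: p_def)
  have pt: "p < t0"
    using p t0 by (cases "p = t0") auto
  have nofix: "f x \<noteq> x" if "p < x" "x \<le> t0" for x
    using cSup_upper[OF _ bdd, of x] that unfolding p_def[symmetric] by auto
  have up: "x < f x" if x: "p < x" "x \<le> t0" for x
  proof (rule ccontr)
    assume "\<not> x < f x"
    then have "\<exists>y. x \<le> y \<and> y \<le> t0 \<and> f y - y = 0"
      using x t0 by (intro IVT') (auto intro!: continuous_intros continuous_on_subset[OF cont])
    then show False
      using nofix x by force
  qed
  have "\<exists>x n. \<bar>x - p\<bar> < \<delta> \<and> t0 - p \<le> \<bar>(f ^^ n) x - p\<bar>" if \<delta>: "0 < \<delta>" for \<delta>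
  proof -
    define x where "x = p + min (\<delta> / 2) (t0 - p)"
    have x: "p < x" "x \<le> t0" "\<bar>x - p\<bar> < \<delta>"
      using \<delta> pt by (auto simp: x_def min_def)
    obtain L where L: "f L = L" "x < L" "(\<lambda>n. (f ^^ n) x) \<longlonglongrightarrow> L"
      using fixed_limit[OF up[OF x(1,2)]] by blast
    have "t0 < L"
      using nofix[of L] L x by (cases "L \<le> t0") auto
    then have "\<forall>\<^sub>F n in sequentially. t0 < (f ^^ n) x"
      by (rule order_tendstoD(1)[OF L(3)])
    then obtain n where "t0 < (f ^^ n) x"
      using eventually_happens'[OF sequentially_bot] by blast
    then show ?thesis
      using x(3) by (intro exI[of _ x] exI[of _ n]) auto
  qed
  then show ?thesis
    using p(2) pt by (intro exI[of _ p] exI[of _ "t0 - p"]) auto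
qed

text \<open>Reflection of the line turns a point that moves down into one that moves up.\<close>

lemma iterates_leave_fixed_point:
  fixes f :: "real \<Rightarrow> real"
  assumes mono: "strict_mono f" and cont: "continuous_on UNIV f" and per: "\<And>t. f (t + 2 * pi) = f t + 2 * pi"
    and bd: "\<And>n t. \<bar>(f ^^ n) t - t\<bar> < pi / 3" and t0: "f t0 \<noteq> t0"
  shows "\<exists>p d. 0 < d \<and> f p = p \<and> (\<forall>\<delta>>0. \<exists>x n. \<bar>x - p\<bar> < \<delta> \<and> d \<le> \<bar>(f ^^ n) x - p\<bar>)"
proof (cases "t0 < f t0")
  case True
  have "f (t - 2 * pi) = f t - 2 * pi" for t
    using per[of "t - 2 * pi"] by simp
  then show ?thesis
    by (rule iterates_leave_fixed_point_right[OF mono cont _ bd True])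
next
  case False
  define g where "g = (\<lambda>t. - f (- t))"
  have gn: "(g ^^ n) t = - (f ^^ n) (- t)" for n t
    by (induction n) (auto simp: g_def)
  have "\<exists>p d. 0 < d \<and> g p = p \<and> (\<forall>\<delta>>0. \<exists>x n. \<bar>x - p\<bar> < \<delta> \<and> d \<le> \<bar>(g ^^ n) x - p\<bar>)"
  proof (rule iterates_leave_fixed_point_right)
    show "strict_mono g"
      using mono unfolding g_def strict_mono_def by auto
    show "continuous_on UNIV g"
      unfolding g_def by (intro continuous_intros continuous_on_compose2[OF cont]) auto
    show "g (t - 2 * pi) = g t - 2 * pi" for t
      using per[of "- t"] by (simp add: g_def)
    show "\<bar>(g ^^ n) t - t\<bar> < pi / 3" for n t
      using bd[of n "- t"] unfolding gn by linarith
    show "- t0 < g (- t0)"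
      using False t0 by (simp add: g_def)
  qed
  then obtain p d where pd: "0 < d" "g p = p" "\<And>\<delta>. 0 < \<delta> \<Longrightarrow> \<exists>x n. \<bar>x - p\<bar> < \<delta> \<and> d \<le> \<bar>(g ^^ n) x - p\<bar>"
    by blast
  have "\<exists>x n. \<bar>x - (- p)\<bar> < \<delta> \<and> d \<le> \<bar>(f ^^ n) x - (- p)\<bar>" if \<delta>: "0 < \<delta>" for \<delta>
  proof -
    obtain x n where "\<bar>x - p\<bar> < \<delta>" "d \<le> \<bar>(g ^^ n) x - p\<bar>"
      using pd(3)[OF \<delta>] by blast
    then show ?thesis
      unfolding gn by (intro exI[of _ "- x"] exI[of _ n]) auto
  qed
  moreover have "f (- p) = - p"
    using pd(2) by (simp add: g_def)
  ultimately show ?thesis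
    using pd(1) by (intro exI[of _ "- p"] exI[of _ d]) auto
qed

section \<open>Lifting circle maps with small displacement\<close>

lemma small_Arg:
  assumes "norm u = 1" "norm (u - 1) \<le> 1/2"
  shows "\<bar>Arg u\<bar> < pi / 3"
proof (rule ccontr)
  assume "\<not> ?thesis"
  then have "pi / 3 \<le> \<bar>Arg u\<bar>" "\<bar>Arg u\<bar> \<le> pi"
    using Arg_bounded[of u] by auto
  then have "cos \<bar>Arg u\<bar> \<le> cos (pi / 3)"
    by (intro cos_monotone_0_pi_le) auto
  moreover have "u = cis (Arg u)"
    using assms(1) by (metis cis_Arg norm_eq_zero zero_neq_one sgn_eq div_by_1 of_real_1)
  then have "Re u = cos (Arg u)"
    by (metis cis.sel(1))
  ultimately have "Re u \<le> 1/2"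
    by (simp add: cos_60)
  moreover have "(norm (u - 1))\<^sup>2 = 2 - 2 * Re u"
    using assms(1) unfolding cmod_power2 by (simp add: cmod_def power2_eq_square algebra_simps)
  moreover have "(norm (u - 1))\<^sup>2 \<le> (1/2)\<^sup>2"
    using assms(2) by (intro power_mono) auto
  ultimately show False
    by (simp add: power2_eq_square)
qed

lemma circle_cis: "z \<in> sphere 0 1 \<Longrightarrow> \<exists>t. z = cis t"
  by (metis cis_Arg dist_0_norm mem_sphere norm_eq_zero zero_neq_one sgn_eq div_by_1 of_real_1)

lemma norm_cis_diff: "norm (cis s - cis t) = norm (cis (s - t) - 1)"
proof -
  have "cis s - cis t = cis t * (cis (s - t) - 1)"
    by (simp add: algebra_simps cis_mult)
  then show ?thesis
    by (simp add: norm_mult)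
qed

lemma norm_cis_minus_1_sq: "(norm (cis d - 1))\<^sup>2 = 2 - 2 * cos d"
  unfolding cmod_power2 by (simp add: power2_eq_square algebra_simps)

lemma norm_cis_minus_1_sq_le: "(norm (cis d - 1))\<^sup>2 \<le> d\<^sup>2"
proof -
  have "(sin (d / 2))\<^sup>2 \<le> (d / 2)\<^sup>2"
    using abs_sin_x_le_abs_x by (simp only: abs_le_square_iff)
  moreover have "cos d = 1 - 2 * (sin (d / 2))\<^sup>2"
    using cos_double_sin[of "d / 2"] by simp
  ultimately show ?thesis
    unfolding norm_cis_minus_1_sq by (simp add: power_divide)
qed

text \<open>Small iterates lift to the real line; there a point that moves is attracted
  by a fixed point and repelled by another one.\<close>

lemma small_iterates_not_equicontinuous:
  fixes w :: "complex \<Rightarrow> complex"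
  assumes cont: "continuous_on S1 w" and im: "w ` S1 \<subseteq> S1" and inj: "inj_on w S1"
    and small: "\<And>n z. z \<in> S1 \<Longrightarrow> dist ((w ^^ n) z) z \<le> 1/2"
    and z0: "z0 \<in> S1" "w z0 \<noteq> z0"
  shows "\<exists>\<eta>>0. \<forall>\<delta>>0. \<exists>n. \<exists>x\<in>S1. \<exists>y\<in>S1. dist x y < \<delta> \<and> \<eta> \<le> dist ((w ^^ n) x) ((w ^^ n) y)"
proof -
  \<comment> \<open>The quotient of \<open>w z\<close> by \<open>z\<close> stays near 1, well inside
    the domain where \<open>Arg\<close> is continuous, so this is a continuous lift of
    \<open>w\<close>.\<close>
  define W where "W = (\<lambda>t. t + Arg (w (cis t) / cis t))"
  have wn: "(w ^^ n) z \<in> S1" if "z \<in> S1" for n z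
  proof (induction n)
    case (Suc n)
    then have "w ((w ^^ n) z) \<in> S1"
      using im by blast
    then show ?case by simp
  qed (use that in simp)
  have quot: "norm ((w ^^ n) (cis t) / cis t) = 1" "norm ((w ^^ n) (cis t) / cis t - 1) \<le> 1/2" for n t
  proof -
    show "norm ((w ^^ n) (cis t) / cis t) = 1"
      using wn[of "cis t" n] by (simp add: norm_divide)
    have "(w ^^ n) (cis t) / cis t - 1 = ((w ^^ n) (cis t) - cis t) / cis t"
      by (simp add: field_simps)
    then show "norm ((w ^^ n) (cis t) / cis t - 1) \<le> 1/2"
      using small[of "cis t" n] by (simp add: norm_divide dist_norm)
  qed
  have cisArg: "cis (Arg u) = u" if "norm u = 1" for u
    using that by (metis cis_Arg norm_eq_zero zero_neq_one sgn_eq div_by_1 of_real_1)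
  have cisW: "cis (W t) = w (cis t)" for t
    using cisArg[of "w (cis t) / cis t"] quot(1)[of 1 t] by (simp add: W_def flip: cis_mult)
  have cisWn: "cis ((W ^^ n) t) = (w ^^ n) (cis t)" for n t
    by (induction n) (auto simp: cisW)
  have Wper: "W (t + 2 * pi) = W t + 2 * pi" for t
  proof -
    have "cis (t + 2 * pi) = cis t"
      by (simp add: complex_eq_iff)
    then show ?thesis
      by (simp add: W_def)
  qed
  have Wd: "\<bar>W t - t\<bar> < pi / 3" for t
    using small_Arg[OF quot[of 1 t]] by (simp add: W_def)
  \<comment> \<open>\<open>W ^^ n\<close> lifts \<open>w ^^ n\<close>, a priori only up to full
    turns. One more application adds less than \<open>pi / 3\<close>, so the displacement stays
    below \<open>pi\<close>, where \<open>Arg\<close> recovers it; smallness of the iterate then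
    restores the bound \<open>pi / 3\<close>.\<close>
  have bd: "\<bar>(W ^^ n) t - t\<bar> < pi / 3" for n t
  proof (induction n)
    case (Suc n)
    have "\<bar>W ((W ^^ n) t) - t\<bar> < pi"
      using Suc Wd[of "(W ^^ n) t"] pi_gt_zero by linarith
    then have "\<bar>(W ^^ Suc n) t - t\<bar> < pi"
      by simp
    then have "Arg (cis ((W ^^ Suc n) t - t)) = (W ^^ Suc n) t - t"
      by (intro Arg_cis) auto
    moreover have "cis ((W ^^ Suc n) t - t) = (w ^^ Suc n) (cis t) / cis t"
      by (simp only: cis_divide[symmetric] cisWn)
    ultimately show ?case
      using small_Arg[OF quot[of "Suc n" t]] by simp
  qed simp
  have contW: "continuous_on UNIV W"
  proof -
    have q: "continuous_on UNIV (\<lambda>t. w (cis t) / cis t)"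
      by (intro continuous_intros continuous_on_compose2[OF cont]) auto
    have contArg: "continuous_on {u. norm u = 1 \<and> norm (u - 1) \<le> 1/2} Arg"
    proof (rule continuous_at_imp_continuous_on, rule ballI)
      fix u :: complex assume u: "u \<in> {u. norm u = 1 \<and> norm (u - 1) \<le> 1/2}"
      have "0 < Re u"
        using abs_Re_le_cmod[of "u - 1"] u by (simp add: abs_if split: if_splits)
      then show "isCont Arg u"
        by (intro continuous_at_Arg) (auto simp: complex_nonpos_Reals_iff)
    qed
    have "continuous_on UNIV (\<lambda>t. Arg (w (cis t) / cis t))"
      by (rule continuous_on_compose2[OF contArg q]) (use quot[of 1] in auto)
    then show ?thesis
      unfolding W_def by (intro continuous_on_add continuous_on_id)
  qed
  have Wint: "W (t + 2 * pi * of_int k) = W t + 2 * pi * of_int k" for t k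
  proof -
    have "cis (t + 2 * pi * of_int k) = cis t"
      using cis_multiple_2pi[of "of_int k"] by (simp flip: cis_mult)
    then show ?thesis
      by (simp add: W_def)
  qed
  have injW: "inj W"
  proof (rule injI)
    fix s t assume eq: "W s = W t"
    then have "w (cis s) = w (cis t)"
      using cisW by metis
    then have "cis s = cis t"
      using inj_onD[OF inj, of "cis s" "cis t"] by simp
    then have "sin s = sin t \<and> cos s = cos t"
      by (simp add: complex_eq_iff)
    then obtain k :: int where k: "s = t + 2 * pi * k"
      unfolding sin_cos_eq_iff by auto
    then show "s = t"
      using eq Wint[of t k] by simp
  qed
  have monoW: "strict_mono W"
  proof (rule strict_monoI)
    fix s t :: real assume st: "s < t"
    obtain m :: nat where m: "t - s < real m * (2 * pi)"
      using reals_Archimedean3[of "2 * pi"] by auto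
    let ?b = "s + 2 * pi * of_int (int m)"
    have b: "t < ?b"
      using m by (simp add: algebra_simps)
    then have "s < ?b"
      using st by simp
    \<comment> \<open>A continuous injection is monotone on an interval; a full turn of the argument
      adds a full turn to the value, so the direction is upward.\<close>
    have "(W s < W t \<and> W t < W ?b) \<or> (W ?b < W t \<and> W t < W s)"
      by (rule continuous_inj_imp_mono[OF st b continuous_on_subset[OF contW] inj_on_subset[OF injW]]) auto
    then show "W s < W t"
      using Wint[of s "int m"] \<open>s < ?b\<close> by auto
  qed
  obtain t0 where t0: "z0 = cis t0"
    using circle_cis[OF z0(1)] by blast
  have "W t0 \<noteq> t0"
    using z0(2) cisW[of t0] t0 by auto
  then obtain p d where pd: "0 < d" "W p = p"
    "\<And>\<delta>. 0 < \<delta> \<Longrightarrow> \<exists>x n. \<bar>x - p\<bar> < \<delta> \<and> d \<le> \<bar>(W ^^ n) x - p\<bar>"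
    using iterates_leave_fixed_point[OF monoW contW Wper bd] by blast
  have far: "\<exists>x n. \<bar>x - p\<bar> < \<delta> \<and> d \<le> \<bar>(W ^^ n) x - p\<bar> \<and> \<bar>(W ^^ n) x - p\<bar> \<le> pi" if \<delta>: "0 < \<delta>" for \<delta>
  proof -
    obtain x n where x: "\<bar>x - p\<bar> < min \<delta> (pi / 3)" "d \<le> \<bar>(W ^^ n) x - p\<bar>"
      using pd(3)[of "min \<delta> (pi / 3)"] \<delta> pi_gt_zero by (auto simp del: pi_gt_zero)
    moreover have "\<bar>(W ^^ n) x - p\<bar> \<le> pi"
      using bd[of n x] x(1) by linarith
    ultimately show ?thesis
      by auto
  qed
  have dpi: "d \<le> pi"
    using far[of 1] by auto
  have Wp: "(W ^^ n) p = p" for n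
    by (induction n) (auto simp: pd(2))
  show ?thesis
  proof (intro exI[of _ "norm (cis d - 1)"] conjI allI impI)
    have "cos d < cos 0"
      using pd(1) dpi by (intro cos_monotone_0_pi) auto
    then show "0 < norm (cis d - 1)"
      using norm_cis_minus_1_sq[of d] by (auto simp: complex_eq_iff)
    fix \<delta> :: real assume "0 < \<delta>"
    then obtain x n where x: "\<bar>x - p\<bar> < \<delta>" "d \<le> \<bar>(W ^^ n) x - p\<bar>" "\<bar>(W ^^ n) x - p\<bar> \<le> pi"
      using far by blast
    have "dist (cis x) (cis p) \<le> \<bar>x - p\<bar>"
    proof -
      have "(norm (cis (x - p) - 1))\<^sup>2 \<le> (x - p)\<^sup>2"
        by (rule norm_cis_minus_1_sq_le)
      then show ?thesis
        unfolding dist_norm norm_cis_diff by (metis abs_le_square_iff abs_norm_cancel)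
    qed
    moreover have "norm (cis d - 1) \<le> dist ((w ^^ n) (cis x)) ((w ^^ n) (cis p))"
    proof -
      have "cos \<bar>(W ^^ n) x - p\<bar> \<le> cos d"
        using x pd(1) by (intro cos_monotone_0_pi_le) auto
      then have "(norm (cis d - 1))\<^sup>2 \<le> (norm (cis ((W ^^ n) x - p) - 1))\<^sup>2"
        unfolding norm_cis_minus_1_sq by simp
      then have "norm (cis d - 1) \<le> norm (cis ((W ^^ n) x - p) - 1)"
        by (rule power2_le_imp_le) simp
      then show ?thesis
        unfolding dist_norm cisWn[symmetric] Wp norm_cis_diff .
    qed
    ultimately show "\<exists>n. \<exists>x\<in>S1. \<exists>y\<in>S1. dist x y < \<delta> \<and> norm (cis d - 1) \<le> dist ((w ^^ n) x) ((w ^^ n) y)"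
      using x(1) by (intro exI[of _ n] bexI[of _ "cis x"] bexI[of _ "cis p"]) auto
  qed
qed

text \<open>A gliding hump: if the maps \<open>a k\<close> have continuity type \<open>\<omega>\<close>, then for each \<open>L\<close> a power of
  a late generator, inserted into a finitely supported exponent sequence, violates the bound with
  constant \<open>L\<close>, and later insertions are too small to repair this.\<close>

lemma gliding_hump:
  fixes a :: "(nat \<Rightarrow> nat) \<Rightarrow> complex \<Rightarrow> complex"
  assumes mod: "modulus_of_continuity \<omega>"
    and cont: "\<And>k. continuous_on S1 (a k)" and im: "\<And>k. a k ` S1 \<subseteq> S1" and inj: "\<And>k. inj_on (a k) S1"
    and add: "\<And>k l z. z \<in> S1 \<Longrightarrow> a (\<lambda>n. k n + l n) z = a k (a l z)"
    and zero: "\<And>z. z \<in> S1 \<Longrightarrow> a (\<lambda>n. 0) z = z"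
    and tail: "\<And>\<epsilon>. 0 < \<epsilon> \<Longrightarrow> \<exists>N. \<forall>k. (\<forall>n<N. k n = 0) \<longrightarrow> (\<forall>z\<in>S1. dist (a k z) z < \<epsilon>)"
    and nontrivial: "\<And>n. \<exists>z\<in>S1. a (\<lambda>m. if m = n then 1 else 0) z \<noteq> z"
  shows "\<exists>k. \<not> has_continuity_type \<omega> S1 (a k)"
proof (rule ccontr)
  assume "\<not> ?thesis"
  then have type: "has_continuity_type \<omega> S1 (a k)" for k
    by blast
  have \<omega>0: "0 \<le> \<omega> t" if "0 \<le> t" for t
    using mod that by (simp add: modulus_of_continuity_def)
  obtain N0 where "\<forall>k. (\<forall>n<N0. k n = 0) \<longrightarrow> (\<forall>z\<in>S1. dist (a k z) z < 1/2)"
    using tail[of "1/2", OF half_gt_zero[OF zero_less_one]] by (elim exE) (rule that)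
  then have N0: "\<And>k z. (\<forall>n<N0. k n = 0) \<Longrightarrow> z \<in> S1 \<Longrightarrow> dist (a k z) z < 1/2"
    by blast
  have pow: "(a (\<lambda>m. if m = n then 1 else 0) ^^ j) z = a (\<lambda>m. if m = n then j else 0) z" if "z \<in> S1" for n j z
  proof (induction j)
    case 0
    then show ?case using zero[OF that] by (simp cong: if_cong)
  next
    case (Suc j)
    have "(\<lambda>m. if m = n then Suc j else 0) = (\<lambda>m. (if m = n then 1 else 0) + (if m = n then j else 0))"
      by auto
    then show ?case
      using Suc add[OF that] by simp
  qed
  \<comment> \<open>Otherwise the maps \<open>a g\<close> after powers of one late generator share a
    bound and are equicontinuous. Undoing \<open>a g\<close> by its uniformly continuous inverse
    would make the powers of the generator equicontinuous.\<close>
  have violate: "\<exists>n\<ge>M. \<exists>j. \<exists>x\<in>S1. \<exists>y\<in>S1.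
      L * \<omega> (dist x y) < dist (a (\<lambda>m. g m + (if m = n then j else 0)) x) (a (\<lambda>m. g m + (if m = n then j else 0)) y)"
    if L: "0 \<le> L" for g M L
  proof (rule ccontr)
    assume "\<not> ?thesis"
    then have le: "dist (a (\<lambda>m. g m + (if m = n then j else 0)) x) (a (\<lambda>m. g m + (if m = n then j else 0)) y) \<le> L * \<omega> (dist x y)"
      if "M \<le> n" "x \<in> S1" "y \<in> S1" for n j x y
      using that by (force simp: not_less)
    \<comment> \<open>Past \<open>N0\<close> all powers of the generator move points by less than
      1/2, as \<open>small_iterates_not_equicontinuous\<close> requires.\<close>
    define n where "n = max M N0"
    define w where "w = a (\<lambda>m. if m = n then 1 else 0)"
    have wS: "(w ^^ j) z \<in> S1" if "z \<in> S1" for j z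
    proof (induction j)
      case (Suc j)
      then have "w ((w ^^ j) z) \<in> S1"
        using im unfolding w_def by blast
      then show ?case by simp
    qed (use that in simp)
    obtain z0 where z0: "z0 \<in> S1" "w z0 \<noteq> z0"
      using nontrivial unfolding w_def by blast
    have "\<exists>\<eta>>0. \<forall>\<delta>>0. \<exists>j. \<exists>x\<in>S1. \<exists>y\<in>S1. dist x y < \<delta> \<and> \<eta> \<le> dist ((w ^^ j) x) ((w ^^ j) y)"
    proof (rule small_iterates_not_equicontinuous[where w = w, OF _ _ _ _ z0])
      show "dist ((w ^^ j) z) z \<le> 1/2" if "z \<in> S1" for j z
      proof -
        have "\<forall>m<N0. (if m = n then j else 0) = 0"
          by (auto simp: n_def)
        from N0[OF this that] show ?thesis
          using pow[OF that, of j n] by (simp add: w_def)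
      qed
    qed (use cont im inj in \<open>auto simp: w_def\<close>)
    then obtain \<eta> where \<eta>: "0 < \<eta>" "\<And>\<delta>. 0 < \<delta> \<Longrightarrow>
        \<exists>j. \<exists>x\<in>S1. \<exists>y\<in>S1. dist x y < \<delta> \<and> \<eta> \<le> dist ((w ^^ j) x) ((w ^^ j) y)"
      by blast
    obtain b where b: "homeomorphism S1 (a g ` S1) (a g) b"
      using homeomorphism_compact[OF _ cont refl inj] by auto
    then have "uniformly_continuous_on (a g ` S1) b"
      by (intro compact_uniformly_continuous compact_continuous_image cont) (auto simp: homeomorphism_def)
    then obtain \<rho> where \<rho>: "0 < \<rho>" "\<And>u v. u \<in> a g ` S1 \<Longrightarrow> v \<in> a g ` S1 \<Longrightarrow> dist u v < \<rho> \<Longrightarrow> dist (b u) (b v) < \<eta>"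
      unfolding uniformly_continuous_on_def using \<eta>(1) by metis
    have "(\<omega> \<longlongrightarrow> \<omega> 0) (at 0 within {0..})"
      using mod unfolding modulus_of_continuity_def continuous_within by blast
    then have "((\<lambda>t. L * \<omega> t) \<longlongrightarrow> L * \<omega> 0) (at 0 within {0..})"
      by (rule tendsto_mult_left)
    then have "\<forall>\<^sub>F t in at 0 within {0..}. dist (L * \<omega> t) (L * \<omega> 0) < \<rho>"
      using \<rho>(1) by (rule tendstoD)
    then obtain \<delta> where \<delta>: "0 < \<delta>"
      "\<forall>t\<in>{0..}. t \<noteq> 0 \<and> dist t 0 < \<delta> \<longrightarrow> dist (L * \<omega> t) (L * \<omega> 0) < \<rho>"
      unfolding eventually_at by blast
    obtain j x y where xy: "x \<in> S1" "y \<in> S1" "dist x y < \<delta>" "\<eta> \<le> dist ((w ^^ j) x) ((w ^^ j) y)"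
      using \<eta>(2)[OF \<delta>(1)] by blast
    have \<omega>00: "\<omega> 0 = 0"
      using mod by (simp add: modulus_of_continuity_def)
    have "L * \<omega> (dist x y) < \<rho>"
    proof (cases "x = y")
      case True
      then show ?thesis using \<omega>00 \<rho>(1) by simp
    next
      case False
      then have "dist (L * \<omega> (dist x y)) (L * \<omega> 0) < \<rho>"
        using \<delta>(2)[rule_format, of "dist x y"] xy(3) by simp
      then show ?thesis
        using \<omega>00 by (simp add: dist_real_def)
    qed
    moreover have "a (\<lambda>m. g m + (if m = n then j else 0)) z = a g ((w ^^ j) z)" if "z \<in> S1" for z
      using add[OF that] pow[OF that, of j n] by (simp add: w_def)
    ultimately have "dist (a g ((w ^^ j) x)) (a g ((w ^^ j) y)) < \<rho>"
      using le[of n x y j] xy(1,2) by (simp add: n_def)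
    then have "dist (b (a g ((w ^^ j) x))) (b (a g ((w ^^ j) y))) < \<eta>"
      using wS xy(1,2) by (intro \<rho>(2)) auto
    then show False
      using b wS xy by (simp add: homeomorphism_def)
  qed
  \<comment> \<open>A state is an exponent sequence together with a bound for its support.
    \<open>Q i\<close> keeps the exponents below the old bound and demands that the violation with
    constant \<open>i\<close> persist under all insertions past the new bound.\<close>
  define P where "P = (\<lambda>(i::nat) (s::(nat \<Rightarrow> nat) \<times> nat). \<forall>m\<ge>snd s. fst s m = 0)"
  define Q where "Q = (\<lambda>(i::nat) (s::(nat \<Rightarrow> nat) \<times> nat) s'. snd s < snd s' \<and> (\<forall>m<snd s. fst s' m = fst s m) \<and>
    (\<exists>x\<in>S1. \<exists>y\<in>S1. \<forall>t. (\<forall>m<snd s'. t m = 0) \<longrightarrow>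
      real i * \<omega> (dist x y) < dist (a (\<lambda>m. fst s' m + t m) x) (a (\<lambda>m. fst s' m + t m) y)))"
  have "\<exists>S. \<forall>i. P i (S i) \<and> Q i (S i) (S (Suc i))"
  proof (rule dependent_nat_choice)
    show "\<exists>s. P 0 s"
      by (intro exI[of _ "(\<lambda>_. 0, 0)"]) (simp add: P_def)
    fix s :: "(nat \<Rightarrow> nat) \<times> nat" and i assume "P i s"
    then have g0: "\<And>m. snd s \<le> m \<Longrightarrow> fst s m = 0"
      by (simp add: P_def)
    obtain n j x y where n: "snd s \<le> n" and xy: "x \<in> S1" "y \<in> S1"
      and v: "real i * \<omega> (dist x y) < dist (a (\<lambda>m. fst s m + (if m = n then j else 0)) x) (a (\<lambda>m. fst s m + (if m = n then j else 0)) y)"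
      using violate[of "real i" "snd s" "fst s"] by auto
    define g where "g = (\<lambda>m. fst s m + (if m = n then j else 0))"
    \<comment> \<open>Half of the excess over the bound. A later insertion first moves
      \<open>x\<close> and \<open>y\<close> by so little that each value of \<open>a g\<close>
      changes by less than \<open>e\<close>; hence the strict inequality survives.\<close>
    define e where "e = (dist (a g x) (a g y) - real i * \<omega> (dist x y)) / 2"
    have e: "0 < e"
      using v by (simp add: e_def g_def)
    obtain d1 where d1: "0 < d1" "\<And>z. z \<in> S1 \<Longrightarrow> dist z x < d1 \<Longrightarrow> dist (a g z) (a g x) < e"
      using cont[of g] xy(1) e unfolding continuous_on_iff by metis
    obtain d2 where d2: "0 < d2" "\<And>z. z \<in> S1 \<Longrightarrow> dist z y < d2 \<Longrightarrow> dist (a g z) (a g y) < e"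
      using cont[of g] xy(2) e unfolding continuous_on_iff by metis
    have "0 < min d1 d2"
      using d1(1) d2(1) by simp
    then obtain N where "\<forall>k. (\<forall>n<N. k n = 0) \<longrightarrow> (\<forall>z\<in>S1. dist (a k z) z < min d1 d2)"
      using tail by blast
    then have N: "\<And>k z. (\<forall>n<N. k n = 0) \<Longrightarrow> z \<in> S1 \<Longrightarrow> dist (a k z) z < min d1 d2"
      by blast
    define N' where "N' = max N (Suc n)"
    have "real i * \<omega> (dist x y) < dist (a (\<lambda>m. g m + t m) x) (a (\<lambda>m. g m + t m) y)"
      if t: "\<forall>m<N'. t m = 0" for t
    proof -
      have t': "\<forall>m<N. t m = 0"
        using t by (simp add: N'_def)
      have S: "a t x \<in> S1" "a t y \<in> S1"
        using im[of t] xy by blast+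
      have "dist (a g (a t x)) (a g x) < e" "dist (a g (a t y)) (a g y) < e"
        using d1(2)[OF S(1)] d2(2)[OF S(2)] N[OF t' xy(1)] N[OF t' xy(2)] by auto
      moreover have "dist (a g x) (a g y) \<le> dist (a g (a t x)) (a g x) + dist (a g (a t x)) (a g (a t y)) + dist (a g (a t y)) (a g y)"
        using dist_triangle[of "a g x" "a g y" "a g (a t x)"] dist_triangle[of "a g (a t x)" "a g y" "a g (a t y)"]
          dist_commute[of "a g x" "a g (a t x)"] by linarith
      ultimately show ?thesis
        using add[OF xy(1), of g t] add[OF xy(2), of g t] by (simp add: e_def)
    qed
    moreover have "g m = 0" if "N' \<le> m" for m
      using g0[of m] that n by (auto simp: g_def N'_def)
    moreover have "snd s < N'" "\<And>m. m < snd s \<Longrightarrow> g m = fst s m"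
      using n by (auto simp: N'_def g_def)
    moreover have "\<exists>x\<in>S1. \<exists>y\<in>S1. \<forall>t. (\<forall>m<N'. t m = 0) \<longrightarrow>
        real i * \<omega> (dist x y) < dist (a (\<lambda>m. g m + t m) x) (a (\<lambda>m. g m + t m) y)"
      by (rule bexI[OF bexI[OF _ xy(2)] xy(1)]) (use calculation(1) in blast)
    ultimately show "\<exists>s'. P (Suc i) s' \<and> Q i s s'"
      unfolding P_def Q_def by (intro exI[of _ "(g, N')"]) simp
  qed
  then obtain S where P: "\<And>i. P i (S i)" and Q: "\<And>i. Q i (S i) (S (Suc i))"
    by blast
  define N where "N = (\<lambda>i. snd (S i))"
  define g where "g = (\<lambda>i. fst (S i))"
  have N_less: "N i < N (Suc i)" for i
    using Q[of i] by (simp add: Q_def N_def)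
  then have N_mono: "strict_mono N"
    by (simp add: strict_mono_Suc_iff)
  have N_ge: "i \<le> N i" for i
    using strict_mono_imp_increasing[OF N_mono] .
  have g_agree: "g j m = g i m" if "i \<le> j" "m < N i" for i j m
    using that(1)
  proof (induction j rule: dec_induct)
    case (step j)
    have "m < N j"
      using that(2) strict_mono_less_eq[OF N_mono, of i j] step(1) by simp
    then have "g (Suc j) m = g j m"
      using Q[of j] by (simp add: Q_def N_def g_def)
    then show ?case
      using step by simp
  qed simp
  \<comment> \<open>The exponent at \<open>m\<close> is final from stage \<open>Suc m\<close> on,
    since \<open>N (Suc m)\<close> exceeds \<open>m\<close>.\<close>
  define k where "k = (\<lambda>m. g (Suc m) m)"
  have k_agree: "k m = g i m" if "m < N i" for i m
  proof -
    have "m < N (Suc m)"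
      using N_ge[of "Suc m"] by simp
    then show ?thesis
      using g_agree[of i "Suc m" m] g_agree[of "Suc m" i m] that by (cases "i \<le> Suc m") (auto simp: k_def)
  qed
  have kt: "k = (\<lambda>m. g i m + (if m < N i then 0 else k m))" for i
    using k_agree[of _ i] P[of i] by (auto simp: P_def N_def g_def)
  obtain L where L: "0 < L" "\<And>x y. x \<in> S1 \<Longrightarrow> y \<in> S1 \<Longrightarrow> dist (a k x) (a k y) \<le> L * \<omega> (dist x y)"
    using type[of k] unfolding has_continuity_type_def by blast
  obtain i :: nat where i: "L \<le> real i"
    using real_arch_simple by blast
  obtain x y where xy: "x \<in> S1" "y \<in> S1" and v: "\<And>t. (\<forall>m<N (Suc i). t m = 0) \<Longrightarrow>
      real i * \<omega> (dist x y) < dist (a (\<lambda>m. g (Suc i) m + t m) x) (a (\<lambda>m. g (Suc i) m + t m) y)"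
    using Q[of i] unfolding Q_def N_def g_def by blast
  have "real i * \<omega> (dist x y) < dist (a k x) (a k y)"
    using v[of "\<lambda>m. if m < N (Suc i) then 0 else k m"] kt[of "Suc i"] by simp
  moreover have "L * \<omega> (dist x y) \<le> real i * \<omega> (dist x y)"
    using i \<omega>0 by (intro mult_right_mono) auto
  ultimately show False
    using L(2)[OF xy] by simp
qed

section \<open>Every group element acts as a power of the rotation\<close>

context riemann_exterior
begin

section \<open>Fixed choices of the rotation and the translation, and the cells\<close>

definition rotation :: "real \<Rightarrow> real" where
  "rotation = (SOME H. lamination_map H \<and> (\<forall>t. 1/7 \<le> t \<longrightarrow> t \<le> 4/7 \<longrightarrow> H t = 2 * t) \<and>
     (\<forall>t. 4/7 \<le> t \<longrightarrow> t < 8/7 \<longrightarrow> H t = t/4 + 1))"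

lemma rotation: "lamination_map rotation" "1/7 \<le> t \<Longrightarrow> t \<le> 4/7 \<Longrightarrow> rotation t = 2 * t"
    "4/7 \<le> t \<Longrightarrow> t < 8/7 \<Longrightarrow> rotation t = t/4 + 1"
  using someI_ex[OF rotation_exists] unfolding rotation_def by auto

definition translation :: "real \<Rightarrow> real" where
  "translation = (SOME H. lamination_map H \<and> (\<forall>t. 8/7 \<le> t \<longrightarrow> t < 11/7 \<longrightarrow> H t = t) \<and>
     (\<forall>t. 4/7 \<le> t \<longrightarrow> t \<le> 65/112 \<longrightarrow> H t = 8 * t - 4) \<and>
     (\<forall>t. 65/112 \<le> t \<longrightarrow> t \<le> 7/12 \<longrightarrow> H t = t + 1/16) \<and>
     (\<forall>t. 7/12 \<le> t \<longrightarrow> t \<le> 13/12 \<longrightarrow> H t = (t + 2) / 4) \<and>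
     (\<forall>t. 13/12 \<le> t \<longrightarrow> t \<le> 123/112 \<longrightarrow> H t = t - 5/16) \<and>
     (\<forall>t. 123/112 \<le> t \<longrightarrow> t \<le> 8/7 \<longrightarrow> H t = 8 * t - 8))"

lemma translation: "lamination_map translation" "8/7 \<le> t \<Longrightarrow> t < 11/7 \<Longrightarrow> translation t = t"
     "4/7 \<le> t \<Longrightarrow> t \<le> 65/112 \<Longrightarrow> translation t = 8 * t - 4"
     "65/112 \<le> t \<Longrightarrow> t \<le> 7/12 \<Longrightarrow> translation t = t + 1/16"
     "7/12 \<le> t \<Longrightarrow> t \<le> 13/12 \<Longrightarrow> translation t = (t + 2) / 4"
     "13/12 \<le> t \<Longrightarrow> t \<le> 123/112 \<Longrightarrow> translation t = t - 5/16"
     "123/112 \<le> t \<Longrightarrow> t \<le> 8/7 \<Longrightarrow> translation t = 8 * t - 8"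
proof -
  have *: "lamination_map translation \<and> (\<forall>t. 8/7 \<le> t \<longrightarrow> t < 11/7 \<longrightarrow> translation t = t) \<and>
     (\<forall>t. 4/7 \<le> t \<longrightarrow> t \<le> 65/112 \<longrightarrow> translation t = 8 * t - 4) \<and>
     (\<forall>t. 65/112 \<le> t \<longrightarrow> t \<le> 7/12 \<longrightarrow> translation t = t + 1/16) \<and>
     (\<forall>t. 7/12 \<le> t \<longrightarrow> t \<le> 13/12 \<longrightarrow> translation t = (t + 2) / 4) \<and>
     (\<forall>t. 13/12 \<le> t \<longrightarrow> t \<le> 123/112 \<longrightarrow> translation t = t - 5/16) \<and>
     (\<forall>t. 123/112 \<le> t \<longrightarrow> t \<le> 8/7 \<longrightarrow> translation t = 8 * t - 8)"
    unfolding translation_def by (rule someI_ex[OF translation_exists])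
  show "lamination_map translation"
    using * by blast
  show "8/7 \<le> t \<Longrightarrow> t < 11/7 \<Longrightarrow> translation t = t"
    using * by blast
  show "4/7 \<le> t \<Longrightarrow> t \<le> 65/112 \<Longrightarrow> translation t = 8 * t - 4"
    using * by blast
  show "65/112 \<le> t \<Longrightarrow> t \<le> 7/12 \<Longrightarrow> translation t = t + 1/16"
    using * by blast
  show "7/12 \<le> t \<Longrightarrow> t \<le> 13/12 \<Longrightarrow> translation t = (t + 2) / 4"
    using * by blast
  show "13/12 \<le> t \<Longrightarrow> t \<le> 123/112 \<Longrightarrow> translation t = t - 5/16"
    using * by blast
  show "123/112 \<le> t \<Longrightarrow> t \<le> 8/7 \<Longrightarrow> translation t = 8 * t - 8"
    using * by blast
qed

text \<open>The cells are the translates of \<open>\<Phi> (11/14, 15/14)\<close> by powers of \<open>translation\<close>; they converge to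
  the end point \<open>\<Phi> (2/3)\<close>.\<close>

definition lo :: "nat \<Rightarrow> real" where "lo n = 2/3 + (5/42) / 4 ^ n"
definition hi :: "nat \<Rightarrow> real" where "hi n = 2/3 + (17/42) / 4 ^ n"
definition cell :: "nat \<Rightarrow> complex set" where "cell n = gap (lo n) (hi n)"

text \<open>5/42 and 17/42 are the distances of 11/14 and 15/14 from the attracting fixed point 2/3
  of \<open>t \<mapsto> (t + 2) / 4\<close>. The cells are disjoint because a quarter of 17 is less
  than 5.\<close>

lemma lo_hi: "2/3 < lo n" "lo n < hi n" "hi n \<le> 15/14" "n < m \<Longrightarrow> hi m \<le> lo n"
proof -
  have "(17/42) * (1 / 4 ^ n) \<le> (17/42) * (1::real)"
    by (intro mult_left_mono) auto
  then show "hi n \<le> 15/14"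
    by (simp add: hi_def)
  show "2/3 < lo n" "lo n < hi n"
    by (simp_all add: lo_def hi_def divide_strict_right_mono)
  assume "n < m"
  then have "(4::real) ^ Suc n \<le> 4 ^ m"
    by (intro power_increasing) auto
  then have "(17/42) / 4 ^ m \<le> (17/42) / (4::real) ^ Suc n"
    by (intro divide_left_mono) auto
  also have "\<dots> \<le> (5/42) / 4 ^ n"
    by (simp add: field_simps)
  finally show "hi m \<le> lo n"
    by (simp add: lo_def hi_def)
qed

lemma translation_lo_hi: "translation (lo n) = lo (Suc n)" "translation (hi n) = hi (Suc n)"
proof -
  have "translation t = (t + 2) / 4" if "2/3 < t" "t \<le> 15/14" for t
    using that by (intro translation(5)) auto
  then have "translation (lo n) = (lo n + 2) / 4" "translation (hi n) = (hi n + 2) / 4"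
    using lo_hi(1-3)[of n] by auto
  then show "translation (lo n) = lo (Suc n)" "translation (hi n) = hi (Suc n)"
    by (auto simp: lo_def hi_def field_simps)
qed

lemma sat_cell: "sat (lo n) (hi n) \<and> \<Phi> (lo n) = \<Phi> (hi n)"
proof (induction n)
  case 0
  have 0: "lo 0 = 11/14" "hi 0 = 15/14"
    by (simp_all add: lo_def hi_def)
  show ?case
    unfolding 0 using sat_minus_sectors Phi_minus_beta by simp
next
  case (Suc n)
  then show ?case
    using sat_lamination_map[OF translation(1), of "lo n" "hi n"] translation(1)
    by (simp add: translation_lo_hi lamination_map_def flip: translation_lo_hi)
qed

lemma cell_subset: "cell n \<subseteq> D3"
  by (auto simp: cell_def gap_def)

lemma disjoint_cells: "disjoint_family cell"
proof -
  have *: "cell n \<inter> cell m = {}" if "n < m" for n m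
  proof (rule ccontr)
    assume "cell n \<inter> cell m \<noteq> {}"
    then obtain x where "x \<in> cell n" "x \<in> cell m"
      by blast
    then obtain s t where st: "lo n < s" "s < hi n" "lo m < t" "t < hi m" "\<Phi> t = \<Phi> s"
      unfolding cell_def gap_def by force
    then show False
      using sat_disjoint[of "lo m" "hi m" t s] sat_cell[of m] lo_hi(4)[OF that] lo_hi(3)[of n] lo_hi(1)[of m]
      by linarith
  qed
  show ?thesis
    unfolding disjoint_family_on_def using * by (metis Int_commute linorder_neqE_nat)
qed

lemma small_cells:
  assumes "0 < \<epsilon>"
  shows "\<exists>N. \<forall>n\<ge>N. \<forall>x\<in>cell n. \<forall>y\<in>cell n. dist x y < \<epsilon>"
proof -
  have "uniformly_continuous_on {0..2} \<Phi>"
    by (intro compact_uniformly_continuous continuous_on_Phi) simp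
  then obtain \<delta> where \<delta>: "0 < \<delta>"
    "\<And>s t. s \<in> {0..2} \<Longrightarrow> t \<in> {0..2} \<Longrightarrow> dist s t < \<delta> \<Longrightarrow> dist (\<Phi> s) (\<Phi> t) < \<epsilon>"
    using assms unfolding uniformly_continuous_on_def by metis
  obtain N where N: "(1/4::real) ^ N < \<delta>"
    using real_arch_pow_inv[OF \<delta>(1), of "1/4"] by auto
  have "dist x y < \<epsilon>" if "N \<le> n" and x: "x \<in> cell n" and y: "y \<in> cell n" for n x y
  proof -
    obtain s t where st: "lo n < s" "s < hi n" "lo n < t" "t < hi n" "x = \<Phi> s" "y = \<Phi> t"
      using x y unfolding cell_def gap_def by auto
    have "hi n - lo n \<le> (1/4) ^ n"
      by (simp add: hi_def lo_def power_one_over field_simps)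
    also have "\<dots> \<le> (1/4) ^ N"
      using that(1) by (intro power_decreasing) auto
    finally have "dist s t < \<delta>"
      using st N unfolding dist_real_def by linarith
    then show ?thesis
      using \<delta>(2)[of s t] st lo_hi(1,3)[of n] by simp
  qed
  then show ?thesis
    by blast
qed

lemma orbit_beta_mono:
  assumes "(quad ^^ n) x = \<beta>" "n \<le> m"
  shows "(quad ^^ m) x = \<beta>"
proof -
  have "(quad ^^ k) \<beta> = \<beta>" for k
    by (induction k) (auto simp: quad_beta)
  then show ?thesis
    using assms by (metis comp_apply funpow_add le_add_diff_inverse2)
qed

end

lemma cyclic_triple_image:
  assumes "(a, b, d) \<in> {(A, B, C), (B, C, A), (C, A, B)}" "(p, q, r) \<in> {(A, B, C), (B, C, A), (C, A, B)}"
    and "f a = p" "f b = q" "f d = r"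
  shows "(f A, f B, f C) \<in> {(A, B, C), (B, C, A), (C, A, B)}"
  using assms by (elim insertE emptyE) simp_all

text \<open>The assumption \<open>type\<close> is the negation of the claim of the theorem; within
  this locale the action turns out not to be minimal.\<close>

locale circle_action = oriented_coloring +
  fixes \<alpha> :: "(complex \<Rightarrow> complex) \<Rightarrow> complex \<Rightarrow> complex" and \<omega> :: "real \<Rightarrow> real"
  assumes mod: "modulus_of_continuity \<omega>"
    and act: "continuous_action G (uniform_topology D3 G) S1 \<alpha>"
    and type: "\<And>g. g \<in> carrier G \<Longrightarrow> has_continuity_type \<omega> S1 (\<alpha> g)"
begin

lemma action: "group_action G S1 \<alpha>"
  using act by (simp add: continuous_action_def)

sublocale group G
  using action group_hom.axioms(1) unfolding group_action_def by blast

lemma act_mult: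
  "g \<in> carrier G \<Longrightarrow> h \<in> carrier G \<Longrightarrow> z \<in> S1 \<Longrightarrow> \<alpha> (g \<otimes>\<^bsub>G\<^esub> h) z = \<alpha> g (\<alpha> h z)"
  by (rule group_action.composition_rule[OF action])

lemma act_one: "z \<in> S1 \<Longrightarrow> \<alpha> \<one>\<^bsub>G\<^esub> z = z"
  using group_action.id_eq_one[OF action] by (metis restrict_apply')

lemma act_image: "g \<in> carrier G \<Longrightarrow> \<alpha> g ` S1 = S1"
  by (rule group_action.surj_prop[OF action])

lemma act_in: "g \<in> carrier G \<Longrightarrow> z \<in> S1 \<Longrightarrow> \<alpha> g z \<in> S1"
  using act_image by blast

lemma act_inj: "g \<in> carrier G \<Longrightarrow> inj_on (\<alpha> g) S1"
  by (rule group_action.inj_prop[OF action])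

text \<open>The values of an element fill the compact set \<open>D3\<close> and are bounded, as the
  supremum metric demands. So every element of \<open>G\<close> is a point of
  \<open>uniform_topology\<close>.\<close>

lemma carrier_subset_funspace: "carrier G \<subseteq> mspace (funspace D3 euclidean_metric)"
proof
  fix g assume g: "g \<in> carrier G"
  then have "bounded (g ` D3)"
    using G_image compact_imp_bounded[OF compact_D3] by simp
  then show "g \<in> mspace (funspace D3 euclidean_metric)"
    using g unfolding mem_G_iff by (simp add: Met_TC.fspace_def mbounded_iff_bounded)
qed

lemma topspace_G: "topspace (uniform_topology D3 G) = carrier G"
  using carrier_subset_funspace by (auto simp: uniform_topology_def simp del: mspace_funspace)

lemma act_continuous_map:
  "continuous_map (prod_topology (uniform_topology D3 G) (top_of_set S1)) euclidean (\<lambda>p. \<alpha> (fst p) (snd p))"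
  using act unfolding continuous_action_def split_beta by (simp add: continuous_map_in_subtopology)

lemma act_continuous:
  assumes g: "g \<in> carrier G"
  shows "continuous_on S1 (\<alpha> g)"
proof -
  have "continuous_map (top_of_set S1) (prod_topology (uniform_topology D3 G) (top_of_set S1)) (\<lambda>z. (g, z))"
    using g by (intro continuous_map_pairedI) (auto simp: topspace_G)
  from continuous_map_compose[OF this act_continuous_map] show ?thesis
    by (simp add: o_def)
qed

text \<open>Joint continuity and compactness of the circle: by the tube lemma the displacement is
  small on a neighbourhood of the identity times the whole circle.\<close>

lemma act_small:
  assumes "0 < \<epsilon>"
  shows "\<exists>\<delta>>0. \<forall>g\<in>carrier G. (\<forall>x\<in>D3. dist (g x) x \<le> \<delta>) \<longrightarrow> (\<forall>z\<in>S1. dist (\<alpha> g z) z < \<epsilon>)"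
proof -
  let ?T = "uniform_topology D3 G"
  let ?W = "{p \<in> topspace (prod_topology ?T (top_of_set S1)). norm (\<alpha> (fst p) (snd p) - snd p) \<in> {..<\<epsilon>}}"
  have snd: "continuous_map (prod_topology ?T (top_of_set S1)) euclidean snd"
    using continuous_map_snd[of ?T "top_of_set S1"] by (simp add: continuous_map_in_subtopology)
  have opW: "openin (prod_topology ?T (top_of_set S1)) ?W"
    by (rule openin_continuous_map_preimage[where Y = euclideanreal])
      (auto intro!: continuous_map_norm continuous_map_diff act_continuous_map snd)
  have sub: "{\<one>\<^bsub>G\<^esub>} \<times> S1 \<subseteq> ?W"
    using act_one assms one_closed by (auto simp: topspace_G)
  have cmp: "compactin (top_of_set S1) S1" "\<one>\<^bsub>G\<^esub> \<in> topspace ?T"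
    by (simp_all add: topspace_G compactin_subtopology)
  obtain U V where U: "openin ?T U" "\<one>\<^bsub>G\<^esub> \<in> U" and V: "S1 \<subseteq> V" "U \<times> V \<subseteq> ?W"
    using tube_lemma_right[OF opW cmp sub] by (elim exE conjE) (rule that)
  let ?F = "funspace D3 (euclidean_metric :: complex metric)"
  interpret F: Metric_space "mspace ?F" "mdist ?F"
    by (rule Metric_space_mspace_mdist)
  obtain U' where U': "openin F.mtopology U'" "U = U' \<inter> carrier G"
    using U(1) unfolding uniform_topology_def mtopology_of_def openin_subtopology by blast
  then obtain r where r: "0 < r" "F.mball \<one>\<^bsub>G\<^esub> r \<subseteq> U'"
    using U(2) unfolding F.openin_mtopology by blast
  have "\<forall>z\<in>S1. dist (\<alpha> g z) z < \<epsilon>" if g: "g \<in> carrier G" and small: "\<forall>x\<in>D3. dist (g x) x \<le> r/2" for g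
  proof -
    have in_F: "g \<in> mspace ?F" "\<one>\<^bsub>G\<^esub> \<in> mspace ?F"
      using carrier_subset_funspace g one_closed by blast+
    have "D3 \<noteq> {}"
      using Phi_in_D3 by blast
    then have "mdist ?F \<one>\<^bsub>G\<^esub> g \<le> r/2"
      using small unfolding funspace_mdist_le[OF in_F(2,1) \<open>D3 \<noteq> {}\<close>] by (simp add: one_G dist_commute)
    then have "g \<in> F.mball \<one>\<^bsub>G\<^esub> r"
      using in_F r(1) unfolding F.in_mball by linarith
    then have "g \<in> U"
      using r(2) U'(2) g by blast
    then show ?thesis
      using V by (force simp: dist_norm)
  qed
  then show ?thesis
    using r(1) by (intro exI[of _ "r/2"]) auto
qed

section \<open>Supports on which elements must act trivially\<close>

definition trivial_on :: "complex set \<Rightarrow> bool" where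
  "trivial_on S \<longleftrightarrow> (\<forall>u\<in>carrier G. (\<forall>x\<in>D3 - S. u x = x) \<longrightarrow> (\<forall>z\<in>S1. \<alpha> u z = z))"

abbreviation "r \<equiv> induced rotation"
abbreviation "s \<equiv> induced (\<lambda>t. t + 1/2)"
abbreviation "h \<equiv> induced translation"

lemma rsh_in_G [simp]: "r \<in> carrier G" "s \<in> carrier G" "h \<in> carrier G"
  using induced_in_G rotation(1) translation(1) lamination_map_half by auto

lemma r_Phi: "r (\<Phi> t) = \<Phi> (rotation t)" and s_Phi: "s (\<Phi> t) = \<Phi> (t + 1/2)" and h_Phi: "h (\<Phi> t) = \<Phi> (translation t)"
  using induced_Phi rotation(1) translation(1) lamination_map_half by auto

lemma support_preserved:
  assumes u: "u \<in> carrier G" and supp: "\<And>x. x \<in> D3 \<Longrightarrow> x \<notin> S \<Longrightarrow> u x = x" and S: "S \<subseteq> D3"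
  shows "u ` S = S"
proof
  show "u ` S \<subseteq> S"
  proof
    fix y assume "y \<in> u ` S"
    then obtain x where x: "x \<in> S" "y = u x"
      by blast
    show "y \<in> S"
    proof (rule ccontr)
      assume "y \<notin> S"
      then have "u (u x) = u x"
        using supp[of y] x S G_in_D3[OF u] by blast
      then have "u x = x"
        using inj_onD[OF G_inj[OF u]] x S G_in_D3[OF u] by blast
      then show False
        using x \<open>y \<notin> S\<close> by simp
    qed
  qed
  show "S \<subseteq> u ` S"
  proof
    fix y assume y: "y \<in> S"
    then obtain x where x: "x \<in> D3" "y = u x"
      using G_image[OF u] S by blast
    then have "x \<in> S"
      using supp[of x] y by (cases "x \<in> S") auto
    then show "y \<in> u ` S"
      using x by blast
  qed
qed

lemma h_pow_cell: "(h [^]\<^bsub>G\<^esub> n) ` cell 0 = cell n"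
proof (induction n)
  case 0
  have "\<one>\<^bsub>G\<^esub> x = x" if "x \<in> cell 0" for x
    using that cell_subset by (auto simp: one_G)
  then show ?case
    by (simp add: image_cong[OF refl, of "cell 0" "\<one>\<^bsub>G\<^esub>" "\<lambda>x. x"])
next
  case (Suc n)
  have "(h [^]\<^bsub>G\<^esub> Suc n) ` cell 0 = h ` ((h [^]\<^bsub>G\<^esub> n) ` cell 0)"
    unfolding nat_pow_Suc2[OF rsh_in_G(3)] image_image
    using cell_subset by (intro image_cong refl mult_G_apply) auto
  also have "\<dots> = h ` cell n"
    using Suc by simp
  also have "\<dots> = cell (Suc n)"
    unfolding cell_def by (simp add: induced_gap[OF translation(1)] translation_lo_hi)
  finally show ?case .
qed

lemma inv_apply: "g \<in> carrier G \<Longrightarrow> x \<in> D3 \<Longrightarrow> (inv\<^bsub>G\<^esub> g) (g x) = x"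
  "g \<in> carrier G \<Longrightarrow> x \<in> D3 \<Longrightarrow> g ((inv\<^bsub>G\<^esub> g) x) = x"
  using mult_G_apply[of "inv\<^bsub>G\<^esub> g" g x] mult_G_apply[of g "inv\<^bsub>G\<^esub> g" x] by (simp_all add: one_G)

lemma act_inv: "g \<in> carrier G \<Longrightarrow> z \<in> S1 \<Longrightarrow> \<alpha> (inv\<^bsub>G\<^esub> g) (\<alpha> g z) = z"
  "g \<in> carrier G \<Longrightarrow> z \<in> S1 \<Longrightarrow> \<alpha> g (\<alpha> (inv\<^bsub>G\<^esub> g) z) = z"
  using act_mult[of "inv\<^bsub>G\<^esub> g" g z] act_mult[of g "inv\<^bsub>G\<^esub> g" z] by (simp_all add: act_one)

text \<open>An element \<open>u\<close> supported on a cell that \<open>h\<close> displaces has commuting conjugates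
  with disjoint supports shrinking to a point; the gliding hump is applied to the products of
  their powers.\<close>

lemma trivial_on_cell: "trivial_on (cell 0)"
  unfolding trivial_on_def
proof (intro ballI impI, rule ccontr)
  fix u z0 assume u: "u \<in> carrier G" and supp: "\<forall>x\<in>D3 - cell 0. u x = x" and z0: "z0 \<in> S1" "\<alpha> u z0 \<noteq> z0"
  \<comment> \<open>The \<open>j\<close>-th power of the conjugate of \<open>u\<close> by the
    \<open>n\<close>-th power of \<open>h\<close>; it is supported on \<open>cell n\<close>.\<close>
  define V where "V = (\<lambda>n (j::nat). h [^]\<^bsub>G\<^esub> n \<otimes>\<^bsub>G\<^esub> u [^]\<^bsub>G\<^esub> j \<otimes>\<^bsub>G\<^esub> inv\<^bsub>G\<^esub> (h [^]\<^bsub>G\<^esub> (n::nat)))"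
  have VG [simp]: "V n j \<in> carrier G" for n and j :: nat
    using u by (simp add: V_def)
  have V0: "V n 0 = \<one>\<^bsub>G\<^esub>" for n
    by (simp add: V_def)
  have Vadd: "V n (i + j) = V n i \<otimes>\<^bsub>G\<^esub> V n j" for n and i j :: nat
  proof -
    have cancel: "inv\<^bsub>G\<^esub> a \<otimes>\<^bsub>G\<^esub> (a \<otimes>\<^bsub>G\<^esub> b) = b" if "a \<in> carrier G" "b \<in> carrier G" for a b
      using that by (simp add: m_assoc[symmetric])
    show ?thesis
      using u by (simp add: V_def m_assoc cancel nat_pow_mult[symmetric])
  qed
  have upow: "(u [^]\<^bsub>G\<^esub> j) x = x" if "x \<in> D3" "x \<notin> cell 0" for x and j :: nat
  proof (induction j)
    case 0
    then show ?case using that by (simp add: one_G)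
  next
    case (Suc j)
    then show ?case
      using that u supp mult_G_apply[of "u [^]\<^bsub>G\<^esub> j" u x] by simp
  qed
  have Vout: "V n j x = x" if x: "x \<in> D3" "x \<notin> cell n" for n j x
  proof -
    let ?H = "h [^]\<^bsub>G\<^esub> n"
    have H: "?H \<in> carrier G" "inv\<^bsub>G\<^esub> ?H \<in> carrier G"
      by simp_all
    have y: "(inv\<^bsub>G\<^esub> ?H) x \<in> D3"
      using G_in_D3[OF H(2) x(1)] .
    have "(inv\<^bsub>G\<^esub> ?H) x \<notin> cell 0"
    proof
      assume "(inv\<^bsub>G\<^esub> ?H) x \<in> cell 0"
      then have "?H ((inv\<^bsub>G\<^esub> ?H) x) \<in> cell n"
        using h_pow_cell[of n] by blast
      then show False
        using x inv_apply(2)[OF H(1) x(1)] by simp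
    qed
    then have "(u [^]\<^bsub>G\<^esub> j) ((inv\<^bsub>G\<^esub> ?H) x) = (inv\<^bsub>G\<^esub> ?H) x"
      using upow y by blast
    then show ?thesis
      using u x H y by (simp add: V_def mult_G_apply inv_apply(2))
  qed
  have Vcell: "V n j ` cell n = cell n" for n j
    using Vout cell_subset by (intro support_preserved) auto
  have cellD: "x \<in> D3" if "x \<in> cell n" for x n
    using that cell_subset by blast
  \<comment> \<open>The infinite product of the powers with exponents \<open>k n\<close>; as the
    supports are disjoint, it is realized by gluing.\<close>
  define P where "P = (\<lambda>k. glue UNIV cell (\<lambda>n. V n (k n)))"
  have PG [simp]: "P k \<in> carrier G" for k
    unfolding P_def cell_def
  proof (rule glue_in_G, fold cell_def)
    show "sat (lo n) (hi n) \<and> lo n < hi n \<and> hi n \<le> lo n + 1 \<and> \<Phi> (lo n) = \<Phi> (hi n)" for n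
      using sat_cell[of n] lo_hi(1-3)[of n] by auto
    show "disjoint_family cell"
      by (rule disjoint_cells)
    have "\<Phi> (lo n) \<notin> cell n" for n
    proof
      assume "\<Phi> (lo n) \<in> cell n"
      then obtain t where "lo n < t" "t < hi n" "\<Phi> t = \<Phi> (lo n + 1)"
        unfolding cell_def gap_def by auto
      then show False
        using sat_disjoint[of "lo n" "hi n" t "lo n + 1"] sat_cell[of n] lo_hi(1-3)[of n] by simp
    qed
    then show "V n (k n) \<in> carrier G \<and> V n (k n) ` cell n = cell n \<and> V n (k n) (\<Phi> (lo n)) = \<Phi> (lo n)" for n
      using Vcell Vout by simp
    fix \<epsilon> :: real assume "0 < \<epsilon>"
    then obtain N where "\<forall>n\<ge>N. \<forall>x\<in>cell n. \<forall>y\<in>cell n. dist x y < \<epsilon>"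
      using small_cells by blast
    then have "{n \<in> UNIV. \<exists>x\<in>cell n. \<exists>y\<in>cell n. \<epsilon> \<le> dist x y} \<subseteq> {..<N}"
      by (force simp: not_less[symmetric])
    then show "finite {n \<in> UNIV. \<exists>x\<in>cell n. \<exists>y\<in>cell n. \<epsilon> \<le> dist x y}"
      by (rule finite_subset) simp
  qed
  have Pin: "P k x = V n (k n) x" if "x \<in> cell n" for k n x
    unfolding P_def using that cellD by (intro glue_in[OF disjoint_cells]) auto
  have Pout: "P k x = x" if "x \<in> D3" "\<And>n. x \<notin> cell n" for k x
    unfolding P_def using that by (intro glue_out) auto
  have Padd: "P (\<lambda>n. k n + l n) = P k \<otimes>\<^bsub>G\<^esub> P l" for k l
  proof (rule G_eqI)
    fix x assume x: "x \<in> D3"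
    show "P (\<lambda>n. k n + l n) x = (P k \<otimes>\<^bsub>G\<^esub> P l) x"
    proof (cases "\<exists>n. x \<in> cell n")
      case True
      then obtain n where n: "x \<in> cell n"
        by blast
      then have "V n (l n) x \<in> cell n"
        using Vcell by blast
      then show ?thesis
        using Pin[OF n] Pin[of "V n (l n) x" n k] x by (simp add: Vadd mult_G_apply)
    next
      case False
      then show ?thesis
        using Pout x by (simp add: mult_G_apply)
    qed
  qed simp_all
  have P0: "P (\<lambda>n. 0) = \<one>\<^bsub>G\<^esub>"
  proof (rule G_eqI)
    fix x assume x: "x \<in> D3"
    show "P (\<lambda>n. 0) x = \<one>\<^bsub>G\<^esub> x"
      using Pin[of x _ "\<lambda>n. 0"] Pout[OF x] x by (cases "\<exists>n. x \<in> cell n") (auto simp: V0 one_G)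
  qed simp_all
  have P1: "P (\<lambda>m. if m = n then 1 else 0) = V n 1" for n
  proof (rule G_eqI)
    fix x assume x: "x \<in> D3"
    show "P (\<lambda>m. if m = n then 1 else 0) x = V n 1 x"
    proof (cases "\<exists>m. x \<in> cell m")
      case True
      then obtain m where m: "x \<in> cell m"
        by blast
      show ?thesis
      proof (cases "m = n")
        case True
        then show ?thesis
          using Pin[OF m] by simp
      next
        case False
        then have "x \<notin> cell n"
          using m disjoint_cells unfolding disjoint_family_on_def by blast
        then show ?thesis
          using Pin[OF m] False Vout[OF x] x by (simp add: V0 one_G)
      qed
    next
      case False
      then show ?thesis
        using Pout x Vout by simp
    qed
  qed simp_all
  have "\<exists>k. \<not> has_continuity_type \<omega> S1 (\<alpha> (P k))"
  proof (rule gliding_hump[OF mod])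
    show "continuous_on S1 (\<alpha> (P k))" "\<alpha> (P k) ` S1 \<subseteq> S1" "inj_on (\<alpha> (P k)) S1" for k
      using act_continuous act_image act_inj by simp_all
    show "\<alpha> (P (\<lambda>n. k n + l n)) z = \<alpha> (P k) (\<alpha> (P l) z)" if "z \<in> S1" for k l z
      using that by (simp add: Padd act_mult)
    show "\<alpha> (P (\<lambda>n. 0)) z = z" if "z \<in> S1" for z
      using that by (simp add: P0 act_one)
    \<comment> \<open>If the first exponents vanish, \<open>P k\<close> moves points only within
      small cells. It is then uniformly close to the identity, and \<open>act_small\<close>
      applies.\<close>
    show "\<exists>N. \<forall>k. (\<forall>n<N. k n = 0) \<longrightarrow> (\<forall>z\<in>S1. dist (\<alpha> (P k) z) z < \<epsilon>)" if \<epsilon>: "0 < \<epsilon>" for \<epsilon>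
    proof -
      obtain \<delta> where \<delta>: "0 < \<delta>" "\<And>g. g \<in> carrier G \<Longrightarrow> (\<forall>x\<in>D3. dist (g x) x \<le> \<delta>) \<Longrightarrow> (\<forall>z\<in>S1. dist (\<alpha> g z) z < \<epsilon>)"
        using act_small[OF \<epsilon>] by blast
      obtain N where N: "\<forall>n\<ge>N. \<forall>x\<in>cell n. \<forall>y\<in>cell n. dist x y < \<delta>"
        using small_cells[OF \<delta>(1)] by blast
      have small: "dist (P k x) x \<le> \<delta>" if k: "\<forall>n<N. k n = 0" and x: "x \<in> D3" for k x
      proof (cases "\<exists>n. x \<in> cell n")
        case True
        then obtain n where n: "x \<in> cell n"
          by blast
        then have Vn: "V n (k n) x \<in> cell n"
          using Vcell by blast
        show ?thesis
        proof (cases "n < N")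
          case True
          then show ?thesis
            using Pin[OF n, of k] k x \<delta>(1) by (simp add: V0 one_G)
        next
          case False
          then have "dist (V n (k n) x) x < \<delta>"
            using N Vn n not_less by blast
          then show ?thesis
            unfolding Pin[OF n] by (rule less_imp_le)
        qed
      next
        case False
        then show ?thesis
          using Pout[OF x] \<delta>(1) by simp
      qed
      show ?thesis
        by (intro exI[of _ N] allI impI \<delta>(2)[OF PG] ballI small) simp_all
    qed
    show "\<exists>z\<in>S1. \<alpha> (P (\<lambda>m. if m = n then 1 else 0)) z \<noteq> z" for n
    proof
      let ?H = "h [^]\<^bsub>G\<^esub> n"
      show z: "\<alpha> ?H z0 \<in> S1"
        using z0(1) by (intro act_in) simp_all
      have "\<alpha> (V n 1) (\<alpha> ?H z0) = \<alpha> ?H (\<alpha> u (\<alpha> (inv\<^bsub>G\<^esub> ?H) (\<alpha> ?H z0)))"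
        using u z act_in by (simp add: V_def act_mult)
      also have "\<dots> = \<alpha> ?H (\<alpha> u z0)"
        using z0(1) by (simp add: act_inv)
      also have "\<dots> \<noteq> \<alpha> ?H z0"
      proof
        assume "\<alpha> ?H (\<alpha> u z0) = \<alpha> ?H z0"
        then have "\<alpha> u z0 = z0"
          using inj_onD[OF act_inj[of ?H]] act_in[OF u z0(1)] z0(1) by simp
        then show False
          using z0(2) by simp
      qed
      finally show "\<alpha> (P (\<lambda>m. if m = n then 1 else 0)) (\<alpha> ?H z0) \<noteq> \<alpha> ?H z0"
        unfolding P1 .
    qed
  qed
  then show False
    using type[OF PG] by blast
qed

text \<open>Conjugation by \<open>k\<close> transports supports by \<open>k\<close> and preserves
  acting trivially.\<close>

lemma trivial_on_image:
  assumes S: "trivial_on S" and SD: "S \<subseteq> D3" and k: "k \<in> carrier G"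
  shows "trivial_on (k ` S)"
  unfolding trivial_on_def
proof (intro ballI impI)
  fix u z assume u: "u \<in> carrier G" and supp: "\<forall>x\<in>D3 - k ` S. u x = x" and z: "z \<in> S1"
  let ?v = "inv\<^bsub>G\<^esub> k \<otimes>\<^bsub>G\<^esub> u \<otimes>\<^bsub>G\<^esub> k"
  have v: "?v \<in> carrier G"
    using u k by simp
  have "?v x = x" if x: "x \<in> D3 - S" for x
  proof -
    have "k x \<notin> k ` S"
      using x SD inj_on_image_mem_iff[OF G_inj[OF k], of x S] by blast
    then have "u (k x) = k x"
      using supp x G_in_D3[OF k] by blast
    then show ?thesis
      using x u k G_in_D3 by (simp add: mult_G_apply inv_apply)
  qed
  then have "\<alpha> ?v w = w" if "w \<in> S1" for w
    using S v that unfolding trivial_on_def by blast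
  from this[of "\<alpha> (inv\<^bsub>G\<^esub> k) z"] have "\<alpha> (inv\<^bsub>G\<^esub> k) (\<alpha> u z) = \<alpha> (inv\<^bsub>G\<^esub> k) z"
    using u k z act_in by (simp add: act_mult act_inv)
  then show "\<alpha> u z = z"
    using inj_onD[OF act_inj[of "inv\<^bsub>G\<^esub> k"]] act_in u k z by simp
qed

text \<open>The half turn takes \<open>cell 0\<close>, bounded by the angles 11/14 and 15/14, to the
  second sector, and the rotation carries that one to the other two.\<close>

lemma trivial_sectors:
  "trivial_on (gap (1/7) (2/7))" "trivial_on (gap (2/7) (4/7))" "trivial_on (gap (4/7) (8/7))"
proof -
  have sub: "gap a b \<subseteq> D3" for a b
    by (auto simp: gap_def)
  have eqs: "lo 0 = 11/14" "hi 0 = 15/14"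
    by (simp_all add: lo_def hi_def)
  have "trivial_on (gap (11/14) (15/14))"
    using trivial_on_cell unfolding cell_def eqs .
  from trivial_on_image[OF this sub rsh_in_G(2)] have "trivial_on (gap (9/7) (11/7))"
    unfolding induced_gap[OF lamination_map_half] by simp
  then show 2: "trivial_on (gap (2/7) (4/7))"
    using gap_add_1[of "2/7" "4/7"] by simp
  have rot: "rotation (2/7) = 4/7" "rotation (4/7) = 8/7" "rotation (8/7) = 9/7"
    using rotation(2)[of "2/7"] rotation(2)[of "4/7"] rotation(2)[of "1/7"]
      lamination_map_add_int[OF rotation(1), of "1/7" 1] by simp_all
  from trivial_on_image[OF 2 sub rsh_in_G(1)] show 3: "trivial_on (gap (4/7) (8/7))"
    unfolding induced_gap[OF rotation(1)] rot .
  from trivial_on_image[OF 3 sub rsh_in_G(1)] have "trivial_on (gap (8/7) (9/7))"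
    unfolding induced_gap[OF rotation(1)] rot .
  then show "trivial_on (gap (1/7) (2/7))"
    using gap_add_1[of "1/7" "2/7"] by simp
qed

lemma act_h: "z \<in> S1 \<Longrightarrow> \<alpha> h z = z"
proof -
  have "h x = x" if x: "x \<in> D3 - gap (4/7) (8/7)" for x
  proof -
    obtain t where t: "4/7 \<le> t" "t < 4/7 + 1" "x = \<Phi> t"
      using D3_Phi x by blast
    have "t = 4/7 \<or> 8/7 \<le> t"
      using x t unfolding gap_def by force
    then have "translation t = t"
      using translation(2,3)[of t] t by auto
    then show ?thesis
      using t h_Phi by simp
  qed
  then show "\<alpha> h z = z" if "z \<in> S1"
    using that trivial_sectors(3) rsh_in_G(3) unfolding trivial_on_def by blast
qed

text \<open>Such an element is the product of its restrictions to the three sectors, each extended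
  by the identity; the restrictions are in \<open>G\<close> because \<open>g\<close> fixes the
  common boundary point \<open>\<beta>\<close>.\<close>

lemma act_trivial_of_sectors:
  assumes g: "g \<in> carrier G" and gb: "g \<beta> = \<beta>"
    and im: "g ` gap (1/7) (2/7) = gap (1/7) (2/7)" "g ` gap (2/7) (4/7) = gap (2/7) (4/7)"
      "g ` gap (4/7) (8/7) = gap (4/7) (8/7)"
    and z: "z \<in> S1"
  shows "\<alpha> g z = z"
proof -
  have part: "\<exists>k\<in>carrier G. (\<forall>x\<in>gap u v. k x = g x) \<and> (\<forall>x\<in>D3 - gap u v. k x = x) \<and> (\<forall>z\<in>S1. \<alpha> k z = z)"
    if uv: "sat u v" "u < v" "v \<le> u + 1" "\<Phi> u = \<beta>" "\<Phi> v = \<beta>" "g ` gap u v = gap u v" "trivial_on (gap u v)"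
    for u v
  proof
    let ?k = "glue {0::nat} (\<lambda>_. gap u v) (\<lambda>_. g)"
    have disj: "disjoint_family_on (\<lambda>_. gap u v) {0::nat}"
      by (simp add: disjoint_family_on_def)
    show k: "?k \<in> carrier G"
      using glue_in_G[of "{0::nat}" "\<lambda>_. u" "\<lambda>_. v" "\<lambda>_. g"] uv g gb disj by simp
    have "?k x = g x" if "x \<in> gap u v" for x
      using glue_in[OF disj, of 0 x] that by (auto simp: gap_def)
    moreover have out: "?k x = x" if "x \<in> D3 - gap u v" for x
      using that by (intro glue_out) auto
    ultimately show "(\<forall>x\<in>gap u v. ?k x = g x) \<and> (\<forall>x\<in>D3 - gap u v. ?k x = x) \<and> (\<forall>z\<in>S1. \<alpha> ?k z = z)"
      using uv(7) k unfolding trivial_on_def by blast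
  qed
  have "\<Phi> (8/7) = \<beta>"
    using Phi_add_1[of "1/7"] Phi_sevenths by simp
  obtain k1 where k1: "k1 \<in> carrier G" "\<And>x. x \<in> gap (1/7) (2/7) \<Longrightarrow> k1 x = g x"
    "\<And>x. x \<in> D3 \<Longrightarrow> x \<notin> gap (1/7) (2/7) \<Longrightarrow> k1 x = x" "\<And>z. z \<in> S1 \<Longrightarrow> \<alpha> k1 z = z"
    using part[OF sat_sectors(1) _ _ Phi_sevenths(1,2) im(1) trivial_sectors(1)] by auto
  obtain k2 where k2: "k2 \<in> carrier G" "\<And>x. x \<in> gap (2/7) (4/7) \<Longrightarrow> k2 x = g x"
    "\<And>x. x \<in> D3 \<Longrightarrow> x \<notin> gap (2/7) (4/7) \<Longrightarrow> k2 x = x" "\<And>z. z \<in> S1 \<Longrightarrow> \<alpha> k2 z = z"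
    using part[OF sat_sectors(2) _ _ Phi_sevenths(2,3) im(2) trivial_sectors(2)] by auto
  obtain k3 where k3: "k3 \<in> carrier G" "\<And>x. x \<in> gap (4/7) (8/7) \<Longrightarrow> k3 x = g x"
    "\<And>x. x \<in> D3 \<Longrightarrow> x \<notin> gap (4/7) (8/7) \<Longrightarrow> k3 x = x" "\<And>z. z \<in> S1 \<Longrightarrow> \<alpha> k3 z = z"
    using part[OF sat_sectors(3) _ _ Phi_sevenths(3) \<open>\<Phi> (8/7) = \<beta>\<close> im(3) trivial_sectors(3)] by auto
  have disj: "gap (1/7) (2/7) \<inter> gap (2/7) (4/7) = {}" "gap (1/7) (2/7) \<inter> gap (4/7) (8/7) = {}"
    "gap (2/7) (4/7) \<inter> gap (4/7) (8/7) = {}"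
    using sat_disjoint[OF sat_sectors(1)] sat_disjoint[OF sat_sectors(2)] unfolding gap_def by fastforce+
  have "g = k1 \<otimes>\<^bsub>G\<^esub> (k2 \<otimes>\<^bsub>G\<^esub> k3)"
  proof (rule G_eqI[OF g])
    fix x assume x: "x \<in> D3"
    then obtain t where t: "1/7 \<le> t" "t < 1/7 + 1" "x = \<Phi> t"
      using D3_Phi by blast
    have cases: "x = \<beta> \<or> x \<in> gap (1/7) (2/7) \<or> x \<in> gap (2/7) (4/7) \<or> x \<in> gap (4/7) (8/7)"
    proof (cases "x = \<beta>")
      case False
      then have "t \<noteq> 1/7" "t \<noteq> 2/7" "t \<noteq> 4/7"
        using t Phi_sevenths by metis+
      then have "1/7 < t \<and> t < 2/7 \<or> 2/7 < t \<and> t < 4/7 \<or> 4/7 < t \<and> t < 8/7"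
        using t(1,2) by auto
      then show ?thesis
        using t(3) by (auto simp: gap_def)
    qed simp
    have nb: "\<beta> \<notin> gap (1/7) (2/7)" "\<beta> \<notin> gap (2/7) (4/7)" "\<beta> \<notin> gap (4/7) (8/7)"
      using Phi_eq_beta_window by (force simp: gap_def)+
    have "k1 (k2 (k3 x)) = g x"
      using cases
    proof (elim disjE)
      assume "x = \<beta>"
      then show ?thesis
        using nb k1(3) k2(3) k3(3) gb x by simp
    next
      assume "x \<in> gap (1/7) (2/7)"
      then show ?thesis
        using disj k1(2) k2(3) k3(3) x by (metis IntI empty_iff)
    next
      assume x2: "x \<in> gap (2/7) (4/7)"
      then have gx2: "g x \<in> gap (2/7) (4/7)" and k3x: "k3 x = x"
        using im(2) k3(3)[OF x] disj by blast+
      have "g x \<notin> gap (1/7) (2/7)"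
        using gx2 disj by blast
      then show ?thesis
        using k3x k1(3)[of "g x"] k2(2)[OF x2] G_in_D3[OF g x] by simp
    next
      assume x3: "x \<in> gap (4/7) (8/7)"
      then have "g x \<in> gap (4/7) (8/7)"
        using im(3) by blast
      then have "g x \<notin> gap (1/7) (2/7)" "g x \<notin> gap (2/7) (4/7)"
        using disj by blast+
      then show ?thesis
        using k1(3)[of "g x"] k2(3)[of "g x"] k3(2)[OF x3] G_in_D3[OF g x] by simp
    qed
    then show "g x = (k1 \<otimes>\<^bsub>G\<^esub> (k2 \<otimes>\<^bsub>G\<^esub> k3)) x"
      using x k1(1) k2(1) k3(1) G_in_D3 by (simp add: mult_G_apply)
  qed (use k1 k2 k3 in auto)
  then show ?thesis
    using z k1(1,4) k2(1,4) k3(1,4) by (simp add: act_mult)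
qed

lemma r_sectors: "r ` gap (1/7) (2/7) = gap (2/7) (4/7)" "r ` gap (2/7) (4/7) = gap (4/7) (8/7)"
  "r ` gap (4/7) (8/7) = gap (1/7) (2/7)" and r_beta: "r \<beta> = \<beta>"
proof -
  have rot: "rotation (1/7) = 2/7" "rotation (2/7) = 4/7" "rotation (4/7) = 8/7" "rotation (8/7) = 9/7"
    using rotation(2)[of "2/7"] rotation(2)[of "4/7"] rotation(2)[of "1/7"]
      lamination_map_add_int[OF rotation(1), of "1/7" 1] by simp_all
  show "r ` gap (1/7) (2/7) = gap (2/7) (4/7)" "r ` gap (2/7) (4/7) = gap (4/7) (8/7)"
    unfolding induced_gap[OF rotation(1)] rot by simp_all
  show "r ` gap (4/7) (8/7) = gap (1/7) (2/7)"
    unfolding induced_gap[OF rotation(1)] rot using gap_add_1[of "1/7" "2/7"] by simp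
  show "r \<beta> = \<beta>"
    using r_Phi[of "1/7"] rot(1) Phi_sevenths by simp
qed

section \<open>Elements that act as a power of the rotation\<close>

definition R :: "nat \<Rightarrow> complex \<Rightarrow> complex" where
  "R i z = (\<alpha> r ^^ i) z"

lemma R_in: "z \<in> S1 \<Longrightarrow> R i z \<in> S1"
proof (induction i)
  case (Suc i)
  then show ?case
    using act_in[OF rsh_in_G(1)] by (simp only: R_def funpow.simps o_apply)
qed (simp add: R_def)

lemma R_add: "R (i + j) z = R i (R j z)"
  by (simp add: R_def funpow_add)

text \<open>The cube of \<open>r\<close> maps every sector to itself, which suffices for acting
  trivially.\<close>

lemma R_3: "z \<in> S1 \<Longrightarrow> R 3 z = z"
proof -
  assume z: "z \<in> S1"
  let ?g = "r \<otimes>\<^bsub>G\<^esub> (r \<otimes>\<^bsub>G\<^esub> r)"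
  have gx: "?g x = r (r (r x))" if "x \<in> D3" for x
    using that G_in_D3[OF rsh_in_G(1)] by (simp add: mult_G_apply)
  have im: "?g ` gap a b = r ` (r ` (r ` gap a b))" for a b
    unfolding image_image by (intro image_cong refl gx) (auto simp: gap_def)
  have "\<alpha> ?g z = z"
  proof (rule act_trivial_of_sectors[OF _ _ _ _ _ z])
    have "\<beta> \<in> D3"
      unfolding \<beta>_def by simp
    then show "?g \<beta> = \<beta>"
      using gx r_beta by simp
  qed (simp_all only: im r_sectors, simp)
  then show "R 3 z = z"
    using z act_in[OF rsh_in_G(1)] by (simp add: act_mult R_def numeral_3_eq_3)
qed

lemma R_mult_3: "z \<in> S1 \<Longrightarrow> R (3 * i) z = z"
proof (induction i)
  case (Suc i)
  have "3 * Suc i = 3 + 3 * i"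
    by simp
  then show ?case
    unfolding \<open>3 * Suc i = 3 + 3 * i\<close> R_add using Suc R_3 by simp
qed (simp add: R_def)

definition acts_as_rotation :: "(complex \<Rightarrow> complex) \<Rightarrow> bool" where
  "acts_as_rotation g \<longleftrightarrow> g \<in> carrier G \<and> (\<exists>i. \<forall>z\<in>S1. \<alpha> g z = R i z)"

lemma acts_as_rotation_mult:
  assumes "acts_as_rotation g" "acts_as_rotation k"
  shows "acts_as_rotation (g \<otimes>\<^bsub>G\<^esub> k)"
proof -
  obtain i j where ij: "\<And>z. z \<in> S1 \<Longrightarrow> \<alpha> g z = R i z" "\<And>z. z \<in> S1 \<Longrightarrow> \<alpha> k z = R j z"
    and G: "g \<in> carrier G" "k \<in> carrier G"
    using assms unfolding acts_as_rotation_def by blast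
  have "\<alpha> (g \<otimes>\<^bsub>G\<^esub> k) z = R (i + j) z" if "z \<in> S1" for z
    using that G ij R_in by (simp add: act_mult R_add)
  then show ?thesis
    using G unfolding acts_as_rotation_def by blast
qed

text \<open>As \<open>R (3 * i)\<close> is the identity on the circle, \<open>R (2 * i)\<close>
  inverts \<open>R i\<close>, so natural exponents are enough.\<close>

lemma acts_as_rotation_inv:
  assumes "acts_as_rotation g"
  shows "acts_as_rotation (inv\<^bsub>G\<^esub> g)"
proof -
  obtain i where i: "\<And>z. z \<in> S1 \<Longrightarrow> \<alpha> g z = R i z" and g: "g \<in> carrier G"
    using assms unfolding acts_as_rotation_def by blast
  have "\<alpha> (inv\<^bsub>G\<^esub> g) z = R (2 * i) z" if z: "z \<in> S1" for z
  proof -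
    have w: "\<alpha> (inv\<^bsub>G\<^esub> g) z \<in> S1"
      using act_in g z by simp
    have "R (2 * i) z = R (2 * i) (\<alpha> g (\<alpha> (inv\<^bsub>G\<^esub> g) z))"
      using act_inv(2)[OF g z] by simp
    also have "\<dots> = R (2 * i + i) (\<alpha> (inv\<^bsub>G\<^esub> g) z)"
      by (simp only: i[OF w] R_add)
    also have "\<dots> = \<alpha> (inv\<^bsub>G\<^esub> g) z"
      using R_mult_3[OF w, of i] by simp
    finally show ?thesis by simp
  qed
  then show ?thesis
    using g unfolding acts_as_rotation_def by blast
qed

lemma acts_as_rotation_r: "acts_as_rotation r"
proof -
  have "\<forall>z\<in>S1. \<alpha> r z = R 1 z"
    by (simp add: R_def)
  then show ?thesis
    unfolding acts_as_rotation_def by auto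
qed

lemma acts_as_rotation_one: "acts_as_rotation \<one>\<^bsub>G\<^esub>"
proof -
  have "\<forall>z\<in>S1. \<alpha> \<one>\<^bsub>G\<^esub> z = R 0 z"
    using act_one by (simp add: R_def)
  then show ?thesis
    unfolding acts_as_rotation_def by auto
qed

lemma acts_as_rotation_h: "acts_as_rotation h"
proof -
  have "\<forall>z\<in>S1. \<alpha> h z = R 0 z"
    using act_h by (simp add: R_def)
  then show ?thesis
    unfolding acts_as_rotation_def by auto
qed

text \<open>Orientation leaves only the cyclic permutations of the three sectors, and composition
  with \<open>r\<close> or its square makes every sector invariant.\<close>

lemma acts_as_rotation_stabilizer:
  assumes g: "g \<in> carrier G" and gb: "g \<beta> = \<beta>"
  shows "acts_as_rotation g"
proof -
  let ?A = "gap (1/7) (2/7)" and ?B = "gap (2/7) (4/7)" and ?C = "gap (4/7) (8/7)"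
  have bD: "\<beta> \<in> D3"
    unfolding \<beta>_def by simp
  have "\<beta> \<in> branch_points D3"
    using tri_beta branch_point_iff by blast
  then have "oriented_at g \<beta>"
    using g unfolding mem_G_iff by blast
  then obtain x1 x2 x3 y1 y2 y3 where x: "tri x1 x2 x3 \<beta>" and y: "tri y1 y2 y3 \<beta>"
    and im: "g ` gap x1 x2 = gap y1 y2" "g ` gap x2 x3 = gap y2 y3" "g ` gap x3 (x1 + 1) = gap y3 (y1 + 1)"
    using gb by (elim oriented_atE) simp
  have one: "(1/7 + 1 :: real) = 8/7"
    by simp
  note im_cyclic = cyclic_triple_image[OF tri_gaps_unique[OF tri_beta x, unfolded one]
      tri_gaps_unique[OF tri_beta y, unfolded one], of "image g", OF im]
  consider "g ` ?A = ?A" "g ` ?B = ?B" "g ` ?C = ?C" | "g ` ?A = ?B" "g ` ?B = ?C" "g ` ?C = ?A"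
    | "g ` ?A = ?C" "g ` ?B = ?A" "g ` ?C = ?B"
    using im_cyclic by (elim insertE emptyE Pair_inject)
  then show ?thesis
  proof cases
    case 1
    then have "\<forall>z\<in>S1. \<alpha> g z = R 0 z"
      using act_trivial_of_sectors[OF g gb] by (simp add: R_def)
    then show ?thesis
      using g unfolding acts_as_rotation_def by blast
  next
    case 2
    let ?k = "r \<otimes>\<^bsub>G\<^esub> (r \<otimes>\<^bsub>G\<^esub> g)"
    have kx: "?k x = r (r (g x))" if "x \<in> D3" for x
      using that g G_in_D3 by (simp add: mult_G_apply)
    have kim: "?k ` gap a b = r ` (r ` (g ` gap a b))" for a b
      unfolding image_image by (intro image_cong refl kx) (auto simp: gap_def)
    have "\<alpha> ?k z = R 0 z" if "z \<in> S1" for z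
      using act_trivial_of_sectors[of ?k z] that g kx[OF bD] gb r_beta 2 by (simp add: kim r_sectors R_def)
    then have k: "acts_as_rotation ?k"
      unfolding acts_as_rotation_def using g by auto
    have cancel: "inv\<^bsub>G\<^esub> r \<otimes>\<^bsub>G\<^esub> (r \<otimes>\<^bsub>G\<^esub> a) = a" if "a \<in> carrier G" for a
      using that by (simp add: m_assoc[symmetric])
    have "g = inv\<^bsub>G\<^esub> r \<otimes>\<^bsub>G\<^esub> (inv\<^bsub>G\<^esub> r \<otimes>\<^bsub>G\<^esub> ?k)"
      using g by (simp add: cancel)
    then show ?thesis
      using acts_as_rotation_mult acts_as_rotation_inv acts_as_rotation_r k by metis
  next
    case 3
    let ?k = "r \<otimes>\<^bsub>G\<^esub> g"
    have kx: "?k x = r (g x)" if "x \<in> D3" for x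
      using that g by (simp add: mult_G_apply)
    have kim: "?k ` gap a b = r ` (g ` gap a b)" for a b
      unfolding image_image by (intro image_cong refl kx) (auto simp: gap_def)
    have "\<alpha> ?k z = R 0 z" if "z \<in> S1" for z
      using act_trivial_of_sectors[of ?k z] that g kx[OF bD] gb r_beta 3 by (simp add: kim r_sectors R_def)
    then have k: "acts_as_rotation ?k"
      unfolding acts_as_rotation_def using g by auto
    have "g = inv\<^bsub>G\<^esub> r \<otimes>\<^bsub>G\<^esub> ?k"
      using g by (simp add: inv_solve_left)
    then show ?thesis
      using acts_as_rotation_mult acts_as_rotation_inv acts_as_rotation_r k by metis
  qed
qed

text \<open>Both \<open>h s\<close> and \<open>s r s\<close> map \<open>\<beta>\<close> to \<open>\<Phi> (37/56)\<close>; since \<open>h\<close> acts trivially, this relation expresses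
  the action of \<open>s\<close> through that of \<open>r\<close>.\<close>

lemma acts_as_rotation_s: "acts_as_rotation s"
proof -
  have bD: "\<beta> \<in> D3"
    unfolding \<beta>_def by simp
  have D: "s \<beta> \<in> D3" "r (s \<beta>) \<in> D3"
    using G_in_D3 bD by simp_all
  have sb: "s \<beta> = \<Phi> (9/14)"
    using s_Phi[of "1/7"] Phi_sevenths(1) by simp
  have hs: "h (s \<beta>) = \<Phi> (37/56)"
    unfolding sb using h_Phi[of "9/14"] translation(5)[of "9/14"] by simp
  have rot: "rotation (9/14) = 9/56 + 1"
    using rotation(3)[of "9/14"] by simp
  have "r (s \<beta>) = \<Phi> (9/56)"
    unfolding sb r_Phi rot by (rule Phi_add_1)
  then have srs: "s (r (s \<beta>)) = \<Phi> (37/56)"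
    using s_Phi[of "9/56"] by simp
  let ?k = "inv\<^bsub>G\<^esub> (s \<otimes>\<^bsub>G\<^esub> (r \<otimes>\<^bsub>G\<^esub> s)) \<otimes>\<^bsub>G\<^esub> (h \<otimes>\<^bsub>G\<^esub> s)"
  have "(s \<otimes>\<^bsub>G\<^esub> (r \<otimes>\<^bsub>G\<^esub> s)) \<beta> = \<Phi> (37/56)" "(h \<otimes>\<^bsub>G\<^esub> s) \<beta> = \<Phi> (37/56)"
    using bD D hs srs by (simp_all add: mult_G_apply)
  then have "?k \<beta> = \<beta>"
    using bD inv_apply(1)[of "s \<otimes>\<^bsub>G\<^esub> (r \<otimes>\<^bsub>G\<^esub> s)" \<beta>] by (simp add: mult_G_apply)
  then obtain i where i: "\<And>z. z \<in> S1 \<Longrightarrow> \<alpha> ?k z = R i z"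
    using acts_as_rotation_stabilizer[of ?k] unfolding acts_as_rotation_def by auto
  \<comment> \<open>\<open>h s\<close> equals \<open>s r s\<close> after \<open>?k\<close>, and
    \<open>h\<close> is trivial on the circle. Cancelling \<open>s\<close> on the left shows that
    \<open>r s\<close> inverts the action of \<open>?k\<close>, which is \<open>R i\<close>.\<close>
  have rel: "z = \<alpha> r (\<alpha> s (R i z))" if z: "z \<in> S1" for z
  proof -
    have "\<alpha> (h \<otimes>\<^bsub>G\<^esub> s) z = \<alpha> (s \<otimes>\<^bsub>G\<^esub> (r \<otimes>\<^bsub>G\<^esub> s)) (\<alpha> ?k z)"
      using z act_in act_inv(2)[of "s \<otimes>\<^bsub>G\<^esub> (r \<otimes>\<^bsub>G\<^esub> s)" "\<alpha> (h \<otimes>\<^bsub>G\<^esub> s) z"] act_mult[of "inv\<^bsub>G\<^esub> (s \<otimes>\<^bsub>G\<^esub> (r \<otimes>\<^bsub>G\<^esub> s))" "h \<otimes>\<^bsub>G\<^esub> s" z]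
      by simp
    then have "\<alpha> s z = \<alpha> s (\<alpha> r (\<alpha> s (R i z)))"
      using z act_in R_in i[OF z] by (simp add: act_mult act_h)
    then show ?thesis
      using inj_onD[OF act_inj[OF rsh_in_G(2)]] z act_in R_in by simp
  qed
  have "\<alpha> s w = R (2 + 2 * i) w" if w: "w \<in> S1" for w
  proof -
    have z: "R (2 * i) w \<in> S1"
      using R_in[OF w] .
    have "R i (R (2 * i) w) = w"
      using R_mult_3[OF w, of i] by (simp flip: R_add)
    then have "R (2 * i) w = R 1 (\<alpha> s w)"
      using rel[OF z] by (simp add: R_def)
    then have "R 2 (R (2 * i) w) = R (2 + 1) (\<alpha> s w)"
      by (simp only: R_add)
    then show ?thesis
      using R_3[of "\<alpha> s w"] act_in[OF rsh_in_G(2) w] unfolding R_add[of 2 "2 * i"] by simp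
  qed
  then show ?thesis
    unfolding acts_as_rotation_def by auto
qed

text \<open>Induction on the number \<open>n\<close> of steps of \<open>quad\<close> to
  \<open>\<beta>\<close>. On the first two sectors \<open>r\<close> acts as one step, and the half
  turn maps \<open>x\<close> to \<open>- x\<close>, which keeps a positive \<open>n\<close>. In the
  third sector \<open>h\<close> removes three steps or moves the point to where these two maps
  apply.\<close>

lemma acts_as_rotation_transitive:
  assumes "x \<in> D3" "(quad ^^ n) x = \<beta>"
  shows "\<exists>g. acts_as_rotation g \<and> g x = \<beta>"
  using assms
proof (induction n arbitrary: x rule: less_induct)
  case (less n)
  have step: "\<exists>g. acts_as_rotation g \<and> g x = \<beta>"
    if "acts_as_rotation k" "acts_as_rotation g" "g (k x) = \<beta>" "x \<in> D3" for g k x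
    using that acts_as_rotation_mult[OF that(2,1)] mult_G_apply[of g k x]
    by (intro exI[of _ "g \<otimes>\<^bsub>G\<^esub> k"]) (auto simp: acts_as_rotation_def)
  have lower: "\<exists>g. acts_as_rotation g \<and> g x = \<beta>"
    if k: "acts_as_rotation k" and x: "x \<in> D3" and n: "(quad ^^ n) x = \<beta>" "x \<noteq> \<beta>" and kx: "k x = quad x" for k x
  proof -
    have "n \<noteq> 0"
      using n by (metis funpow_0)
    then obtain m where m: "n = Suc m"
      using not0_implies_Suc by blast
    have "(quad ^^ m) (quad x) = \<beta>"
      using n(1) unfolding m by (simp add: funpow_swap1)
    then obtain g where "acts_as_rotation g" "g (quad x) = \<beta>"
      using less.IH[of m "quad x"] x m by auto
    then show ?thesis
      using step[OF k _ _ x] kx by metis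
  qed
  have left: "\<exists>g. acts_as_rotation g \<and> g x = \<beta>"
    if t: "1/7 < t" "t < 4/7" "x = \<Phi> t" and n: "(quad ^^ n) x = \<beta>" "x \<noteq> \<beta>" for t x
    using t r_Phi[of t] rotation(2)[of t]
    by (intro lower[OF acts_as_rotation_r _ n]) (auto simp: Phi_double)
  have s_min: "s (\<Phi> t) = \<Phi> (t - 1/2)" for t
    using s_Phi[of t] Phi_add_1[of "t - 1/2"] by (simp add: add.commute)
  have right: "\<exists>g. acts_as_rotation g \<and> g x = \<beta>"
    if t: "9/14 < t" "t < 15/14" "x = \<Phi> t" and n: "(quad ^^ n) x = \<beta>" "x \<noteq> \<beta>" for t x
  proof (cases "s x = \<beta>")
    case True
    then show ?thesis
      using acts_as_rotation_s by blast
  next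
    case False
    have sx: "s x = \<Phi> (t - 1/2)"
      using s_min t by simp
    then have "s x = - x"
      using Phi_diff_half t by simp
    have "n \<noteq> 0"
      using n by (metis funpow_0)
    then have "(quad ^^ n) (s x) = (quad ^^ n) x"
      unfolding \<open>s x = - x\<close> by (cases n) (auto simp: funpow_swap1)
    then obtain g where "acts_as_rotation g" "g (s x) = \<beta>"
      using left[OF _ _ sx] t n False by auto
    then show ?thesis
      using step[OF acts_as_rotation_s] t by auto
  qed
  \<comment> \<open>The half turn merely exchanges this cell with its neighbour across 0, so
    \<open>h\<close> is needed. On the part next to \<open>\<beta>\<close> it acts as three steps of
    \<open>quad\<close>.\<close>
  have outer: "\<exists>g. acts_as_rotation g \<and> g x = \<beta>"
    if t: "4/7 < t \<and> t < 7/12 \<or> 13/12 < t \<and> t < 8/7" "x = \<Phi> t" and n: "(quad ^^ n) x = \<beta>" for t x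
  proof -
    have "\<Phi> (2 * (2 * (2 * t))) = (quad ^^ 3) x"
      unfolding Phi_double t(2) by (simp add: numeral_3_eq_3)
    then have q3: "\<Phi> (8 * t) = (quad ^^ 3) x"
      by simp
    show ?thesis
    proof (cases "t \<le> 65/112 \<or> 123/112 \<le> t")
      case True
      then have "translation t = 8 * t - 4 \<or> translation t = 8 * t - 8"
        using t translation(3,7)[of t] by auto
      then have hx: "h x = (quad ^^ 3) x"
        using h_Phi[of t] t(2) q3 Phi_add_int[of "8 * t" "-4"] Phi_add_int[of "8 * t" "-8"] by auto
      show ?thesis
      proof (cases "n \<le> 3")
        case True
        then have "h x = \<beta>"
          using hx orbit_beta_mono[OF n] by simp
        then show ?thesis
          using acts_as_rotation_h by blast
      next
        case False
        then have "(quad ^^ (n - 3)) (h x) = (quad ^^ n) x"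
          unfolding hx using funpow_add[of "n - 3" 3 quad] by simp
        then obtain g where "acts_as_rotation g" "g (h x) = \<beta>"
          using less.IH[of "n - 3" "h x"] n False t(2) G_in_D3[OF rsh_in_G(3), of x] by auto
        then show ?thesis
          using step[OF acts_as_rotation_h] t(2) by auto
      qed
    next
      case False
      \<comment> \<open>On the middle part \<open>h\<close> preserves \<open>16 * t\<close> modulo
        1, so \<open>x\<close> and \<open>h x\<close> merge after four steps, and \<open>h x\<close>
        lies in the arc treated by \<open>right\<close>.\<close>
      obtain t' where t': "h x = \<Phi> t'" "9/14 < t'" "t' < 11/14" "\<Phi> (16 * t') = \<Phi> (16 * t)"
      proof (cases "t < 7/12")
        case True
        then show ?thesis
          using that[of "t + 1/16"] False t h_Phi[of t] translation(4)[of t] Phi_add_int[of "16 * t" 1] by auto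
      next
        case False
        then show ?thesis
          using that[of "t - 5/16"] \<open>\<not> (t \<le> 65/112 \<or> 123/112 \<le> t)\<close> t h_Phi[of t] translation(6)[of t]
            Phi_add_int[of "16 * t" "-5"] by auto
      qed
      \<comment> \<open>Modulo 1, \<open>8 * t\<close> lies strictly between 9/14 and 11/14, where
        \<open>\<beta>\<close> has no angle. So \<open>n\<close> is at least 4, and merging after
        four steps lets \<open>h x\<close> reach \<open>\<beta>\<close> in \<open>n\<close> steps
        too.\<close>
      have "(quad ^^ 3) x \<noteq> \<beta>"
      proof
        assume "(quad ^^ 3) x = \<beta>"
        then have "\<Phi> (8 * t - 4) = \<beta>" "\<Phi> (8 * t - 8) = \<beta>"
          using q3 Phi_add_int[of "8 * t" "-4"] Phi_add_int[of "8 * t" "-8"] by simp_all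
        then show False
          using Phi_eq_beta_window[of "8 * t - 4"] Phi_eq_beta_window[of "8 * t - 8"] t(1) False by auto
      qed
      then have "\<not> n \<le> 3"
        using orbit_beta_mono[OF n] by blast
      have "\<Phi> (2 * (2 * (2 * (2 * t)))) = (quad ^^ 4) x"
        unfolding Phi_double t(2) by (simp add: eval_nat_numeral)
      moreover have "\<Phi> (2 * (2 * (2 * (2 * t')))) = (quad ^^ 4) (h x)"
        unfolding Phi_double t'(1) by (simp add: eval_nat_numeral)
      moreover have "\<Phi> (2 * (2 * (2 * (2 * t')))) = \<Phi> (2 * (2 * (2 * (2 * t))))"
        using t'(4) by simp
      ultimately have "(quad ^^ 4) (h x) = (quad ^^ 4) x"
        by metis
      then have "(quad ^^ (n - 4 + 4)) (h x) = (quad ^^ (n - 4 + 4)) x"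
        by (simp only: funpow_add o_apply)
      then have hn: "(quad ^^ n) (h x) = \<beta>"
        using n \<open>\<not> n \<le> 3\<close> by simp
      have "h x \<noteq> \<beta>"
        using Phi_eq_beta_window[of t'] t' by auto
      then obtain g where "acts_as_rotation g" "g (h x) = \<beta>"
        using right[OF t'(2) _ t'(1) hn] t'(3) by auto
      then show ?thesis
        using step[OF acts_as_rotation_h] t(2) by auto
    qed
  qed
  obtain t where t: "1/7 \<le> t" "t < 1/7 + 1" "x = \<Phi> t"
    using D3_Phi[OF less.prems(1)] .
  have n: "(quad ^^ n) x = \<beta>"
    by (rule less.prems(2))
  show ?case
  proof (cases "x = \<beta>")
    case True
    then show ?thesis
      using acts_as_rotation_one less.prems(1) by (metis one_G restrict_apply')
  next
    case False
    have "x \<noteq> 0"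
    proof
      assume "x = 0"
      have "n \<noteq> 0"
        using n False by (metis funpow_0)
      then obtain m where "n = Suc m"
        using not0_implies_Suc by blast
      then have "(quad ^^ m) \<i> = \<beta>"
        using n \<open>x = 0\<close> by (simp add: funpow_swap1 quad_def)
      then show False
        using critical_orbit_beta by blast
    qed
    then have ne: "t \<noteq> 7/12" "t \<noteq> 13/12"
      using t(3) Phi_seven_twelfths Phi_thirteen_twelfths by metis+
    have ne': "t \<noteq> 1/7" "t \<noteq> 4/7"
      using t(3) False Phi_sevenths by metis+
    consider "t < 4/7" | "4/7 < t \<and> t < 7/12 \<or> 13/12 < t \<and> t < 8/7" | "9/14 < t" "t < 15/14"
      | "t = 9/14 \<or> t = 15/14" | "7/12 < t \<and> t < 9/14 \<or> 15/14 < t \<and> t < 13/12"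
      using t(1,2) ne ne' by argo
    then show ?thesis
    proof cases
      case 1
      then show ?thesis using left[OF _ 1 t(3) n False] t(1) ne' by simp
    next
      case 2
      then show ?thesis using outer[OF 2 t(3) n] by simp
    next
      case 3
      then show ?thesis using right[OF 3 t(3) n False] by simp
    next
      case 4
      then have "t - 1/2 = 1/7 \<or> t - 1/2 = 4/7"
        by auto
      then have "s x = \<beta>"
        using s_min[of t] t(3) Phi_sevenths by metis
      then show ?thesis
        using acts_as_rotation_s by blast
    next
      case 5
      have sx: "s x = \<Phi> (t - 1/2)" "s x = \<Phi> (t + 1/2)"
        using s_min s_Phi t(3) by simp_all
      then have "s x = - x"
        using Phi_diff_half t(3) by simp
      have "n \<noteq> 0"
        using n False by (metis funpow_0)
      then have sn: "(quad ^^ n) (s x) = \<beta>"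
        unfolding \<open>s x = - x\<close> using n by (cases n) (auto simp: funpow_swap1)
      have "4/7 < t + 1/2 \<and> t + 1/2 < 7/12 \<or> 13/12 < t + 1/2 \<and> t + 1/2 < 8/7 \<or>
          4/7 < t - 1/2 \<and> t - 1/2 < 7/12 \<or> 13/12 < t - 1/2 \<and> t - 1/2 < 8/7"
        using 5 by auto
      then obtain g where "acts_as_rotation g" "g (s x) = \<beta>"
        using outer[OF _ sx(1) sn] outer[OF _ sx(2) sn] by blast
      then show ?thesis
        using step[OF acts_as_rotation_s _ _ less.prems(1)] by blast
    qed
  qed
qed

text \<open>Since \<open>g \<beta>\<close> is a branch point, an element already known to act as a
  rotation moves it back to \<open>\<beta>\<close>; the product then lies in the stabilizer of
  \<open>\<beta>\<close>.\<close>

lemma all_act_as_rotations: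
  assumes g: "g \<in> carrier G"
  shows "acts_as_rotation g"
proof -
  have "g \<beta> \<in> branch_points D3"
    using G_branch_point[OF g] tri_beta branch_point_iff by blast
  then obtain n where n: "(quad ^^ n) (g \<beta>) = \<beta>"
    using branch_point_iff branch_point_orbit by blast
  have bD: "\<beta> \<in> D3"
    unfolding \<beta>_def by simp
  obtain k where k: "acts_as_rotation k" "k (g \<beta>) = \<beta>"
    using acts_as_rotation_transitive[OF G_in_D3[OF g bD] n] by blast
  then have kG: "k \<in> carrier G"
    by (simp add: acts_as_rotation_def)
  have "acts_as_rotation (k \<otimes>\<^bsub>G\<^esub> g)"
    using kG g k(2) bD by (intro acts_as_rotation_stabilizer) (simp_all add: mult_G_apply)
  then have "acts_as_rotation (inv\<^bsub>G\<^esub> k \<otimes>\<^bsub>G\<^esub> (k \<otimes>\<^bsub>G\<^esub> g))"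
    using acts_as_rotation_mult acts_as_rotation_inv k(1) by blast
  moreover have "inv\<^bsub>G\<^esub> k \<otimes>\<^bsub>G\<^esub> (k \<otimes>\<^bsub>G\<^esub> g) = g"
    using kG g by (simp add: m_assoc[symmetric])
  ultimately show ?thesis
    by simp
qed

text \<open>The orbit of 1 is finite, hence closed, so density would make the circle finite; a
  finite connected set has at most one point.\<close>

lemma not_minimal: "\<not> minimal_action G S1 \<alpha>"
proof
  assume "minimal_action G S1 \<alpha>"
  have z: "(1::complex) \<in> S1"
    by simp
  have "orbit G \<alpha> 1 \<subseteq> {R 0 1, R 1 1, R 2 1}"
  proof
    fix w assume "w \<in> orbit G \<alpha> 1"
    then obtain g where "g \<in> carrier G" "w = \<alpha> g 1"
      unfolding orbit_def by blast
    then obtain i where w: "w = R i 1"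
      using all_act_as_rotations[of g] z unfolding acts_as_rotation_def by blast
    have "R i 1 = R (i mod 3 + 3 * (i div 3)) 1"
      by simp
    also have "\<dots> = R (i mod 3) 1"
      unfolding R_add using R_mult_3[OF z] by simp
    finally have "w = R (i mod 3) 1"
      using w by simp
    moreover have "i mod 3 = 0 \<or> i mod 3 = 1 \<or> i mod 3 = 2"
      by presburger
    ultimately show "w \<in> {R 0 1, R 1 1, R 2 1}"
      by auto
  qed
  then have fin: "finite (orbit G \<alpha> 1)"
    by (rule finite_subset) simp
  then have "closure (orbit G \<alpha> 1) = orbit G \<alpha> 1"
    by (simp add: finite_imp_closed)
  then have "S1 \<subseteq> orbit G \<alpha> 1"
    using \<open>minimal_action G S1 \<alpha>\<close> z unfolding minimal_action_def by metis
  then have "finite S1"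
    using fin finite_subset by blast
  moreover have "connected S1"
    by (rule connected_sphere) simp
  ultimately obtain a where "S1 = {a}"
    using connected_finite_iff_sing z by blast
  moreover have "- 1 \<in> S1"
    by simp
  ultimately have "(1::complex) = - 1"
    using z by (metis singletonD)
  then show False
    by simp
qed

end

theorem theorem1p13:
  fixes \<phi> :: "complex \<Rightarrow> complex"
    and c :: "complex set \<Rightarrow> nat"
    and \<omega> :: "real \<Rightarrow> real"
    and \<alpha> :: "(complex \<Rightarrow> complex) \<Rightarrow> complex \<Rightarrow> complex"
    and G :: "(complex \<Rightarrow> complex) monoid"
  defines "G \<equiv> kaleidoscopic_A3 D3 c"
  assumes "caratheodory_loop D3 \<phi>"
    and "kaleidoscopic D3 c"
    and "same_orientation D3 c \<phi>"
    and "modulus_of_continuity \<omega>"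
    and "continuous_action G (uniform_topology D3 G) S1 \<alpha>"
    and "minimal_action G S1 \<alpha>"
  shows "\<exists>g\<in>carrier G. \<not> has_continuity_type \<omega> S1 (\<alpha> g)"
proof (rule ccontr)
  assume type: "\<not> ?thesis"
  obtain \<psi> where \<psi>: "\<psi> holomorphic_on (- cball 0 1)" "bij_betw \<psi> (- cball 0 1) (- D3)"
    "((\<lambda>z. \<psi> z / z) \<longlongrightarrow> 1) at_infinity" "continuous_on (- ball 0 1) \<psi>" "\<forall>z\<in>S1. \<phi> z = \<psi> z"
    using assms(2) unfolding caratheodory_loop_def by blast
  interpret O: oriented_coloring \<psi> \<phi> c
    using \<psi> assms(3,4) by unfold_locales (auto simp: kaleidoscopic_def)
  have "circle_action \<psi> \<phi> c \<alpha> \<omega>"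
    using assms(5,6) type unfolding G_def
    by unfold_locales (auto simp: O.G_def)
  then show False
    using circle_action.not_minimal assms(7) O.G_def unfolding G_def by metis
qed

end
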